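(* Let $m_1,m_2,m_3,m_4>0$ be masses no three of which are equal. Then the balanced four-body configurations (up to rotation and scaling) close to the regular tetrahedron form a $2$-dimensional manifold; in it, the balanced configurations which admit a relative equilibrium motion in $\mathbb{R}^4$ form three regular curves intersecting at the regular tetrahedron.
   Context: Setting: $n=4$ bodies with positive masses $m_1,\dots,m_4$. Let $\mathcal D^*=\{\xi\in\mathbb R^4:\sum_i\xi_i=0\}$ with the Euclidean inner product $\langle\xi,\eta\rangle=\sum_i \xi_i\eta_i/m_i$ ("symmetric" for endomorphisms of $\mathcal D^*$ refers to it); $(e_i)$ is the standard basis of $\mathbb R^4$. A configuration $x=(\vec r_1,\dots,\vec r_4)$ in a Euclidean space $E$, up to translation, is identified with the linear map $x:\mathcal D^*\to E$, $\xi\mapsto\sum\xi_i\vec r_i$; only non-collision configurations ($r_{ij}=|\vec r_i-\vec r_j|>0$ for $i\ne j$) are considered. Put $s_{ij}=r_{ij}^2$. The intrinsic inertia endomorphism $B$ of $x$ is the symmetric endomorphism of $\mathcal D^*$ with $\langle B\xi,\eta\rangle=\langle x(\xi),x(\eta)\rangle_E$; it determines $x$ up to isometry. Let $\Phi(s)=\mathcal G s^{-1/2}$ ($\mathcal G>0$) and $\varphi=\Phi'$. The Wintner–Conley endomorphism is the symmetric endomorphism $A\xi=\sum_{i<j}\varphi(s_{ij})(m_j\xi_i-m_i\xi_j)(e_i-e_j)$ of $\mathcal D^*$; Newton's equations read $\ddot x=2x\circ A$. The configuration is balanced if $AB=BA$. A relative equilibrium motion of $x$ in a Euclidean space $E$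 is a solution of Newton's equations of the form $x(t)=e^{\Omega t}x$ with $\Omega$ a constant antisymmetric endomorphism of $E$ ($x$ being placed isometrically in $E$). The regular tetrahedron is the configuration with all $r_{ij}$ equal. *)

theory Defs
  imports "HOL-Analysis.Analysis"
begin

section \<open>Smooth maps, submanifolds and regular curves\<close>

text \<open>Differentiability class on an open set of a finite-dimensional space: each directional
  derivative of order at most \<open>k\<close> exists and is continuous.\<close>

primrec Ck_on :: "nat \<Rightarrow> ('a::euclidean_space \<Rightarrow> 'b::euclidean_space) \<Rightarrow> 'a set \<Rightarrow> bool" where
  "Ck_on 0 f S \<longleftrightarrow> continuous_on S f"
| "Ck_on (Suc k) f S \<longleftrightarrow>
     (\<forall>x\<in>S. f differentiable (at x)) \<and> (\<forall>v. Ck_on k (\<lambda>x. frechet_derivative f (at x) v) S)"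

definition smooth_on :: "'a::euclidean_space set \<Rightarrow> ('a \<Rightarrow> 'b::euclidean_space) \<Rightarrow> bool" where
  "smooth_on S f \<longleftrightarrow> (\<forall>k. Ck_on k f S)"

text \<open>Embedded submanifolds of Euclidean space, through slice charts.\<close>

definition smooth_submanifold :: "nat \<Rightarrow> 'a::euclidean_space set \<Rightarrow> bool" where
  "smooth_submanifold k M \<longleftrightarrow>
     (\<forall>p\<in>M. \<exists>(U::'a set) (V::'a set) h g L.
        open U \<and> p \<in> U \<and> open V \<and> homeomorphism U V h g \<and> smooth_on U h \<and> smooth_on V g \<and>
        subspace L \<and> dim L = k \<and> h ` (M \<inter> U) = L \<inter> V)"

text \<open>The inverse \<open>g\<close> makes the parametrisation an embedding, so that \<open>C\<close> has no self-intersection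
  and does not accumulate on itself.\<close>

definition regular_curve_through :: "'a::euclidean_space \<Rightarrow> 'a set \<Rightarrow> bool" where
  "regular_curve_through p C \<longleftrightarrow>
     (\<exists>(\<gamma>::real \<Rightarrow> 'a) g. smooth_on {-1<..<1} \<gamma> \<and>
        (\<forall>t\<in>{-1<..<1}. vector_derivative \<gamma> (at t) \<noteq> 0) \<and>
        homeomorphism {-1<..<1} C \<gamma> g \<and> \<gamma> 0 = p)"

section \<open>Configurations\<close>

text \<open>A configuration of four bodies in \<open>'e\<close> is a vector \<open>r :: 'e ^ 4\<close>; up to translation it is the
  linear map \<open>config_map r\<close> restricted to the space \<open>dispositions\<close> of vectors with zero sum.\<close>

definition dispositions :: "(real ^ 4) set" where
  "dispositions = {\<xi>. (\<Sum>i\<in>UNIV. \<xi> $ i) = 0}"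

definition config_map :: "'e::euclidean_space ^ 4 \<Rightarrow> real ^ 4 \<Rightarrow> 'e" where
  "config_map r \<xi> = (\<Sum>i\<in>UNIV. \<xi> $ i *\<^sub>R (r $ i))"

definition sq_dist :: "'e::euclidean_space ^ 4 \<Rightarrow> 4 \<Rightarrow> 4 \<Rightarrow> real" where
  "sq_dist r i j = (dist (r $ i) (r $ j))\<^sup>2"

definition non_collision :: "'e::euclidean_space ^ 4 \<Rightarrow> bool" where
  "non_collision r \<longleftrightarrow> (\<forall>i j. i \<noteq> j \<longrightarrow> dist (r $ i) (r $ j) > 0)"

definition regular_tetrahedron :: "'e::euclidean_space ^ 4 \<Rightarrow> bool" where
  "regular_tetrahedron r \<longleftrightarrow> (\<exists>d>0. \<forall>i j. i \<noteq> j \<longrightarrow> dist (r $ i) (r $ j) = d)"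

text \<open>The squared mutual distances, normalised to have sum \<open>1\<close>, form a complete invariant of a
  non-collision configuration up to isometry and scaling (\<open>shape_eq_iff\<close> below); they are the
  coordinates in which configurations up to rotation and scaling are considered.\<close>

definition shape :: "'e::euclidean_space ^ 4 \<Rightarrow> real ^ 4 ^ 4" where
  "shape r = (\<chi> i j. sq_dist r i j / (\<Sum>k\<in>UNIV. \<Sum>l\<in>UNIV. sq_dist r k l))"

section \<open>Inertia, Wintner--Conley endomorphism and balanced configurations\<close>

definition mass_inner :: "real ^ 4 \<Rightarrow> real ^ 4 \<Rightarrow> real ^ 4 \<Rightarrow> real" where
  "mass_inner m \<xi> \<eta> = (\<Sum>i\<in>UNIV. \<xi> $ i * \<eta> $ i / m $ i)"

text \<open>Endomorphisms of \<open>dispositions\<close> are represented by linear maps of the ambient space which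
  preserve it; only their values on \<open>dispositions\<close> matter.\<close>

definition symmetric_endo :: "real ^ 4 \<Rightarrow> (real ^ 4 \<Rightarrow> real ^ 4) \<Rightarrow> bool" where
  "symmetric_endo m F \<longleftrightarrow> linear F \<and> F ` dispositions \<subseteq> dispositions \<and>
     (\<forall>\<xi>\<in>dispositions. \<forall>\<eta>\<in>dispositions. mass_inner m (F \<xi>) \<eta> = mass_inner m \<xi> (F \<eta>))"

definition is_inertia_endo ::
  "real ^ 4 \<Rightarrow> 'e::euclidean_space ^ 4 \<Rightarrow> (real ^ 4 \<Rightarrow> real ^ 4) \<Rightarrow> bool" where
  "is_inertia_endo m r B \<longleftrightarrow> symmetric_endo m B \<and>
     (\<forall>\<xi>\<in>dispositions. \<forall>\<eta>\<in>dispositions.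
        mass_inner m (B \<xi>) \<eta> = inner (config_map r \<xi>) (config_map r \<eta>))"

definition potential :: "real \<Rightarrow> real \<Rightarrow> real" where
  "potential G s = G * s powr (- 1 / 2)"

definition wintner_conley ::
  "real \<Rightarrow> real ^ 4 \<Rightarrow> 'e::euclidean_space ^ 4 \<Rightarrow> real ^ 4 \<Rightarrow> real ^ 4" where
  "wintner_conley G m r \<xi> =
     (\<Sum>(i, j)\<in>{(i, j). i < j}.
        (deriv (potential G) (sq_dist r i j) * (m $ j * \<xi> $ i - m $ i * \<xi> $ j)) *\<^sub>R
          (axis i 1 - axis j 1))"

definition balanced :: "real \<Rightarrow> real ^ 4 \<Rightarrow> 'e::euclidean_space ^ 4 \<Rightarrow> bool" where
  "balanced G m r \<longleftrightarrow>
     (\<exists>B. is_inertia_endo m r B \<and>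
        (\<forall>\<xi>\<in>dispositions. wintner_conley G m r (B \<xi>) = B (wintner_conley G m r \<xi>)))"

section \<open>Newton's equations and relative equilibria\<close>

definition newton_solution ::
  "real \<Rightarrow> real ^ 4 \<Rightarrow> (real \<Rightarrow> 'e::euclidean_space ^ 4) \<Rightarrow> bool" where
  "newton_solution G m r \<longleftrightarrow>
     (\<forall>t. non_collision (r t)) \<and>
     (\<forall>\<xi>\<in>dispositions. \<exists>v. \<forall>t.
        ((\<lambda>t. config_map (r t) \<xi>) has_vector_derivative v t) (at t) \<and>
        (v has_vector_derivative 2 *\<^sub>R config_map (r t) (wintner_conley G m (r t) \<xi>)) (at t))"

definition exp_endo :: "('e::euclidean_space \<Rightarrow> 'e) \<Rightarrow> 'e \<Rightarrow> 'e" where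
  "exp_endo F v = (\<Sum>n. (F ^^ n) v /\<^sub>R fact n)"

definition antisymmetric :: "('e::euclidean_space \<Rightarrow> 'e) \<Rightarrow> bool" where
  "antisymmetric F \<longleftrightarrow> linear F \<and> (\<forall>u v. inner (F u) v = - inner u (F v))"

text \<open>The map \<open>\<iota>\<close> places the configuration \<open>r\<close> isometrically in \<open>\<real>\<^sup>4\<close>. Translating \<open>r\<close> does not
  affect the condition, since \<open>newton_solution\<close> only sees \<open>config_map\<close> on \<open>dispositions\<close>.\<close>

definition admits_relative_equilibrium_R4 ::
  "real \<Rightarrow> real ^ 4 \<Rightarrow> (real ^ 3) ^ 4 \<Rightarrow> bool" where
  "admits_relative_equilibrium_R4 G m r \<longleftrightarrow>
     (\<exists>(\<iota> :: real ^ 3 \<Rightarrow> real ^ 4) \<Omega>.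
        linear \<iota> \<and> (\<forall>v. norm (\<iota> v) = norm v) \<and> antisymmetric \<Omega> \<and>
        newton_solution G m (\<lambda>t. \<chi> i. exp_endo (\<lambda>v. t *\<^sub>R \<Omega> v) (\<iota> (r $ i))))"

section \<open>The sets of shapes\<close>

text \<open>Four points always lie in a three-dimensional affine subspace, so that \<open>\<real>\<^sup>3\<close> contains all
  configurations up to isometry.\<close>

definition balanced_shapes :: "real \<Rightarrow> real ^ 4 \<Rightarrow> (real ^ 4 ^ 4) set" where
  "balanced_shapes G m = shape ` {r :: (real ^ 3) ^ 4. non_collision r \<and> balanced G m r}"

definition relative_equilibrium_shapes_R4 :: "real \<Rightarrow> real ^ 4 \<Rightarrow> (real ^ 4 ^ 4) set" where
  "relative_equilibrium_shapes_R4 G m =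
     shape ` {r :: (real ^ 3) ^ 4.
       non_collision r \<and> balanced G m r \<and> admits_relative_equilibrium_R4 G m r}"

section \<open>Well-definedness\<close>

lemma inertia_endo_exists:
  fixes r :: "'e::euclidean_space ^ 4"
  assumes m: "\<And>i. m $ i > 0"
  shows "\<exists>B. is_inertia_endo m r B"
proof -
  define M where "M = (\<Sum>i\<in>UNIV. m $ i)"
  have M0: "M > 0" unfolding M_def by (rule sum_pos) (auto simp: m)
  define c where "c = (\<Sum>i\<in>UNIV. m $ i *\<^sub>R (r $ i)) /\<^sub>R M"
  define B where "B = (\<lambda>\<xi>::real^4. \<chi> j. m $ j * inner (config_map r \<xi>) (r $ j - c))"
  have lin_cm: "linear (config_map r)"
    unfolding config_map_def
    by (rule linearI) (auto simp: algebra_simps sum.distrib scaleR_sum_right)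
  have lin: "linear B"
    unfolding B_def
    by (rule linearI)
      (auto simp: vec_eq_iff linear_add[OF lin_cm] linear_cmul[OF lin_cm] algebra_simps)
  have inD: "B \<xi> \<in> dispositions" for \<xi>
  proof -
    have "(\<Sum>j\<in>UNIV. B \<xi> $ j) = inner (config_map r \<xi>) (\<Sum>j\<in>UNIV. m $ j *\<^sub>R (r $ j - c))"
      by (simp add: B_def inner_sum_right)
    also have "(\<Sum>j\<in>UNIV. m $ j *\<^sub>R (r $ j - c)) = (\<Sum>j\<in>UNIV. m $ j *\<^sub>R (r $ j)) - M *\<^sub>R c"
      by (simp add: scaleR_diff_right sum_subtractf M_def scaleR_sum_left)
    also have "\<dots> = 0" using M0 by (simp add: c_def)
    finally show ?thesis by (simp add: dispositions_def)
  qed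
  have eq: "mass_inner m (B \<xi>) \<eta> = inner (config_map r \<xi>) (config_map r \<eta>)"
    if "\<eta> \<in> dispositions" for \<xi> \<eta>
  proof -
    have "mass_inner m (B \<xi>) \<eta> = (\<Sum>j\<in>UNIV. inner (config_map r \<xi>) (\<eta> $ j *\<^sub>R (r $ j - c)))"
      unfolding mass_inner_def B_def
      by (rule sum.cong) (use m in \<open>auto simp: less_imp_neq[symmetric]\<close>)
    also have "\<dots> = inner (config_map r \<xi>) (\<Sum>j\<in>UNIV. \<eta> $ j *\<^sub>R (r $ j - c))"
      by (simp add: inner_sum_right)
    also have "(\<Sum>j\<in>UNIV. \<eta> $ j *\<^sub>R (r $ j - c)) = config_map r \<eta> - (\<Sum>j\<in>UNIV. \<eta> $ j) *\<^sub>R c"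
      by (simp add: scaleR_diff_right sum_subtractf config_map_def scaleR_sum_left)
    finally show ?thesis using that by (simp add: dispositions_def)
  qed
  have comm: "mass_inner m \<xi> \<eta> = mass_inner m \<eta> \<xi>" for \<xi> \<eta>
    by (simp add: mass_inner_def mult.commute)
  have "is_inertia_endo m r B"
    unfolding is_inertia_endo_def symmetric_endo_def
    using lin inD eq comm by (auto simp: inner_commute)
  then show ?thesis by blast
qed

lemma inertia_endo_unique:
  fixes r :: "'e::euclidean_space ^ 4"
  assumes m: "\<And>i. m $ i > 0"
    and B: "is_inertia_endo m r B" and B': "is_inertia_endo m r B'" and \<xi>: "\<xi> \<in> dispositions"
  shows "B \<xi> = B' \<xi>"
proof -
  define \<delta> where "\<delta> = B \<xi> - B' \<xi>"
  have "B \<xi> \<in> dispositions" "B' \<xi> \<in> dispositions"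
    using B B' \<xi> by (auto simp: is_inertia_endo_def symmetric_endo_def)
  then have \<delta>: "\<delta> \<in> dispositions" by (simp add: \<delta>_def dispositions_def sum_subtractf)
  have "mass_inner m \<delta> \<delta> = mass_inner m (B \<xi>) \<delta> - mass_inner m (B' \<xi>) \<delta>"
    unfolding mass_inner_def sum_subtractf[symmetric]
    by (rule sum.cong) (simp_all add: \<delta>_def left_diff_distrib diff_divide_distrib)
  also have "\<dots> = 0" using B B' \<xi> \<delta> by (simp add: is_inertia_endo_def)
  finally have "(\<Sum>i\<in>UNIV. \<delta> $ i * \<delta> $ i / m $ i) = 0" by (simp add: mass_inner_def)
  then have "\<forall>i\<in>UNIV. \<delta> $ i * \<delta> $ i / m $ i = 0"
    using m by (subst (asm) sum_nonneg_eq_0_iff) (auto simp: less_imp_le)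
  then have "\<delta> = 0" using m by (auto simp: vec_eq_iff less_imp_neq[symmetric])
  then show ?thesis by (simp add: \<delta>_def)
qed

lemma regular_tetrahedron_exists: "\<exists>r :: (real ^ 3) ^ 4. regular_tetrahedron r"
proof -
  define r :: "(real ^ 3) ^ 4" where
    "r = (\<chi> i. if i = 1 then vector [1, 1, 1] else if i = 2 then vector [1, -1, -1]
                else if i = 3 then vector [-1, 1, -1] else vector [-1, -1, 1])"
  have "\<forall>i j. i \<noteq> j \<longrightarrow> dist (r $ i) (r $ j) = sqrt 8"
    unfolding forall_4
    by (simp add: r_def dist_norm norm_vec_def L2_set_def sum_3 vector_3)
  then show ?thesis unfolding regular_tetrahedron_def by (intro exI[of _ r] exI[of _ "sqrt 8"]) auto
qed

lemma orthogonal_transformation_from_gram: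
  fixes v w :: "'i \<Rightarrow> 'e::euclidean_space"
  assumes gram: "\<And>i j. inner (v i) (v j) = inner (w i) (w j)"
  shows "\<exists>f. orthogonal_transformation f \<and> (\<forall>i. f (v i) = w i)"
proof -
  obtain B where B: "B \<subseteq> range v" "independent B" "range v \<subseteq> span B"
    using maximal_independent_subset[of "range v"] by blast
  define k where "k = (\<lambda>x. SOME i. v i = x)"
  have k: "v (k x) = x" if "x \<in> B" for x
    unfolding k_def by (rule someI_ex) (use that B(1) in blast)
  obtain g where g: "linear g" "\<And>x. x \<in> B \<Longrightarrow> g x = w (k x)"
    using linear_independent_extend[OF B(2), of "\<lambda>x. w (k x)"] by auto
  have g1: "inner (g u) (w i) = inner u (v i)" if "u \<in> span B" for u i
    using that
  proof (induction rule: span_induct_alt)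
    case base then show ?case by (simp add: linear_0[OF g(1)])
  next
    case (step c x y)
    have "inner (g x) (w i) = inner x (v i)"
      using gram[of "k x" i] k[OF step(1)] g(2)[OF step(1)] by simp
    then show ?case using step
      by (simp add: linear_add[OF g(1)] linear_cmul[OF g(1)] inner_add_left)
  qed
  have g2: "inner (g u) (g u') = inner u u'" if "u \<in> span B" "u' \<in> span B" for u u'
    using that(2)
  proof (induction rule: span_induct_alt)
    case base then show ?case by (simp add: linear_0[OF g(1)])
  next
    case (step c x y)
    have "inner (g u) (g x) = inner u x"
      using g1[OF that(1), of "k x"] k[OF step(1)] g(2)[OF step(1)] by simp
    then show ?case using step
      by (simp add: linear_add[OF g(1)] linear_cmul[OF g(1)] inner_add_right)
  qed
  have gv: "g (v i) = w i" for i
  proof -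
    have vi: "v i \<in> span B" using B(3) by blast
    have "inner (g (v i) - w i) (g (v i) - w i) = 0"
      using g1[OF vi, of i] g2[OF vi vi] gram[of i i]
      by (simp add: inner_diff_left inner_diff_right inner_commute)
    then show ?thesis by simp
  qed
  define T where "T = span B"
  have T: "subspace T" "subspace (g ` T)"
    unfolding T_def using linear_subspace_image[OF g(1)] by auto
  have inj: "inj_on g T"
  proof (rule inj_onI)
    fix x y assume "x \<in> T" "y \<in> T" "g x = g y"
    then have "x - y \<in> span B" "g (x - y) = 0"
      by (auto simp: T_def span_diff linear_diff[OF g(1)])
    then show "x = y" using g2[of "x - y" "x - y"] by simp
  qed
  have dT: "dim (g ` T) = dim T"
    by (rule dim_image_eq[OF g(1)]) (use inj T in \<open>simp add: span_eq_iff[THEN iffD2]\<close>)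
  have dc: "dim (W\<^sup>\<bottom>) = DIM('e) - dim W" if "subspace W" for W :: "'e set"
  proof -
    have "dim {y \<in> UNIV. \<forall>x\<in>W. orthogonal x y} + dim W = dim (UNIV::'e set)"
      by (rule dim_subspace_orthogonal_to_vectors) (use that in auto)
    moreover have "{y \<in> UNIV. \<forall>x\<in>W. orthogonal x y} = W\<^sup>\<bottom>"
      by (auto simp: orthogonal_comp_def)
    ultimately show ?thesis by simp
  qed
  obtain h where h: "linear h" "h ` (T\<^sup>\<bottom>) = (g ` T)\<^sup>\<bottom>" "\<And>x. x \<in> T\<^sup>\<bottom> \<Longrightarrow> norm (h x) = norm x"
    using isometry_subspaces[OF subspace_orthogonal_comp subspace_orthogonal_comp, of T "g ` T"]
      dc[OF T(1)] dc[OF T(2)] dT by metis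
  obtain C where C: "C \<subseteq> T" "pairwise orthogonal C" "\<And>x. x \<in> C \<Longrightarrow> norm x = 1"
    "independent C" "span C = T"
    using orthonormal_basis_subspace[OF T(1)] by metis
  have finC: "finite C" using C(4) independent_imp_finite by blast
  define P where "P = (\<lambda>x. \<Sum>b\<in>C. inner b x *\<^sub>R b)"
  have linP: "linear P"
    unfolding P_def by (rule linearI)
      (simp_all add: inner_add_right algebra_simps sum.distrib scaleR_sum_right)
  have PT: "P x \<in> T" for x
    unfolding P_def using C(1) T(1) by (intro subspace_sum subspace_scale) auto
  have Pc: "x - P x \<in> T\<^sup>\<bottom>" for x
  proof -
    have "orthogonal (x - P x) y" if "y \<in> C" for y
    proof -
      have "inner y (P x) = (\<Sum>b\<in>C. inner b x * inner y b)"
        by (simp add: P_def inner_sum_right)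
      also have "\<dots> = (\<Sum>b\<in>C. if b = y then inner y x else 0)"
      proof (rule sum.cong[OF refl])
        fix b assume "b \<in> C"
        then show "inner b x * inner y b = (if b = y then inner y x else 0)"
          using C(2,3) that by (auto simp: pairwise_def orthogonal_def norm_eq_1)
      qed
      also have "\<dots> = inner y x" using finC that by simp
      finally have "inner y (x - P x) = 0" by (simp add: inner_diff_right)
      then show ?thesis by (simp add: orthogonal_def inner_commute)
    qed
    then have "orthogonal (x - P x) y" if "y \<in> T" for y
      using that orthogonal_to_span[of y C "x - P x"] C(5) by auto
    then show ?thesis by (auto simp: orthogonal_comp_def orthogonal_commute)
  qed
  define f where "f = (\<lambda>x. g (P x) + h (x - P x))"
  have linf: "linear f"
    unfolding f_def
    by (intro linear_compose_add linear_compose[OF linP g(1), unfolded o_def]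
        linear_compose[OF linear_compose_sub[OF linear_ident linP] h(1), unfolded o_def])
  have nf: "norm (f x) = norm x" for x
  proof -
    have "h (x - P x) \<in> (g ` T)\<^sup>\<bottom>" using h(2) Pc by blast
    then have "orthogonal (g (P x)) (h (x - P x))" using PT by (auto simp: orthogonal_comp_def)
    then have "(norm (f x))\<^sup>2 = (norm (g (P x)))\<^sup>2 + (norm (h (x - P x)))\<^sup>2"
      unfolding f_def by (rule norm_add_Pythagorean)
    also have "\<dots> = (norm (P x))\<^sup>2 + (norm (x - P x))\<^sup>2"
      using g2[of "P x" "P x"] PT h(3)[OF Pc] by (simp add: T_def power2_norm_eq_inner)
    also have "\<dots> = (norm (P x + (x - P x)))\<^sup>2"
      by (rule norm_add_Pythagorean[symmetric]) (use PT Pc in \<open>auto simp: orthogonal_comp_def\<close>)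
    finally show ?thesis by simp
  qed
  have "P x = x" if "x \<in> T" for x
  proof -
    have "x - P x \<in> T" using that PT T(1) subspace_diff by blast
    then have "orthogonal (x - P x) (x - P x)" using Pc[of x] by (auto simp: orthogonal_comp_def)
    then show ?thesis by (simp add: orthogonal_self)
  qed
  then have "f (v i) = w i" for i
    using B(3) gv by (auto simp: f_def T_def linear_0[OF h(1)] image_subset_iff)
  then show ?thesis using linf nf by (auto simp: orthogonal_transformation)
qed

lemma shape_eq_iff:
  fixes r r' :: "'e::euclidean_space ^ 4"
  assumes "non_collision r" "non_collision r'"
  shows "shape r = shape r' \<longleftrightarrow>
    (\<exists>f a c. orthogonal_transformation f \<and> c > 0 \<and> (\<forall>i. r' $ i = a + c *\<^sub>R f (r $ i)))"
proof
  define S where "S = (\<lambda>r::'e^4. \<Sum>k\<in>UNIV. \<Sum>l\<in>UNIV. sq_dist r k l)"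
  have S0: "S q > 0" if "non_collision q" for q
  proof -
    have "sq_dist q 1 2 > 0" using that by (simp add: sq_dist_def non_collision_def)
    then show ?thesis unfolding S_def
      by (intro sum_pos2[of _ 1] sum_pos2[of _ 2] sum_nonneg) (auto simp: sq_dist_def)
  qed
  note S0 = S0[OF assms(1)] S0[OF assms(2)]
  {
    assume eq: "shape r = shape r'"
    define c where "c = sqrt (S r' / S r)"
    have c: "c > 0" "c\<^sup>2 = S r' / S r" using S0 by (auto simp: c_def)
    have div: "sq_dist r i j / S r = sq_dist r' i j / S r'" for i j
      using eq by (simp add: shape_def vec_eq_iff S_def)
    have sq: "sq_dist r' i j = c\<^sup>2 * sq_dist r i j" for i j
    proof -
      have "sq_dist r' i j = S r' * (sq_dist r' i j / S r')" using S0 by simp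
      also have "\<dots> = c\<^sup>2 * sq_dist r i j" unfolding div[symmetric] c(2) by simp
      finally show ?thesis .
    qed
    have nrm: "norm (r' $ i - r' $ j) = c * norm (r $ i - r $ j)" for i j
      using sq[of i j] c(1)
      by (simp add: sq_dist_def dist_norm power_mult_distrib[symmetric] power2_eq_iff_nonneg)
    define v where "v = (\<lambda>i. c *\<^sub>R (r $ i - r $ 1))"
    define w where "w = (\<lambda>i. r' $ i - r' $ 1)"
    have nv: "norm (v i) = norm (w i)" "norm (v i - v j) = norm (w i - w j)" for i j
      using nrm[of i 1] nrm[of i j] c(1) by (simp_all add: v_def w_def scaleR_diff_right[symmetric])
    have "inner (v i) (v j) = inner (w i) (w j)" for i j
      using nv(1)[of i] nv(1)[of j] nv(2)[of i j] by (simp add: dot_norm_neg)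
    then obtain f where f: "orthogonal_transformation f" "\<forall>i. f (v i) = w i"
      using orthogonal_transformation_from_gram by metis
    have lin: "linear f" using f(1) by (simp add: orthogonal_transformation)
    have "r' $ i = (r' $ 1 - c *\<^sub>R f (r $ 1)) + c *\<^sub>R f (r $ i)" for i
      using f(2)[rule_format, of i]
      by (simp add: v_def w_def linear_cmul[OF lin] linear_diff[OF lin] algebra_simps)
    then show "\<exists>f a c. orthogonal_transformation f \<and> c > 0 \<and> (\<forall>i. r' $ i = a + c *\<^sub>R f (r $ i))"
      using f(1) c(1) by blast
  next
    assume "\<exists>f a c. orthogonal_transformation f \<and> c > 0 \<and> (\<forall>i. r' $ i = a + c *\<^sub>R f (r $ i))"
    then obtain f a c where f: "orthogonal_transformation f" and c: "c > 0"
      and r': "\<And>i. r' $ i = a + c *\<^sub>R f (r $ i)" by blast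
    have lin: "linear f" using f by (simp add: orthogonal_transformation)
    have "sq_dist r' i j = c\<^sup>2 * sq_dist r i j" for i j
    proof -
      have "r' $ i - r' $ j = c *\<^sub>R f (r $ i - r $ j)"
        by (simp add: r' linear_diff[OF lin] scaleR_diff_right)
      then show ?thesis using f c
        by (simp add: sq_dist_def dist_norm orthogonal_transformation power_mult_distrib)
    qed
    then show "shape r = shape r'"
      using c by (simp add: shape_def sum_distrib_left[symmetric])
  }
qed

end

theory Submission
  imports Defs
begin

text \<open>
  A symmetric matrix of squared distances \<open>X\<close> gives two quadratic forms on the three-dimensional
  space of dispositions with its mass inner product: the form of the inertia endomorphism \<open>B\<close>, which
  is linear in \<open>X\<close>, and the form of the Wintner--Conley endomorphism \<open>A\<close>, which is linear in the
  numbers \<open>\<Phi>'(X\<^bsub>kl\<^esub>)\<close>. At the regular tetrahedron \<open>A\<close> is scalar, and \<open>B\<close> has simple spectrum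
  exactly when no three masses are equal (\<open>mass_frame_distinct_euclidean_norms\<close> proves what is needed).
  By the implicit function theorem an orthonormal eigenframe \<open>V X\<close> of \<open>B\<close> can therefore be chosen
  smoothly near the tetrahedron (\<open>smooth_frame_near_regular_shape\<close>).

  In such a frame a configuration is balanced iff the three off-diagonal entries of \<open>A\<close> vanish, since
  a symmetric endomorphism commutes with \<open>B\<close> iff it is diagonal in an eigenframe of \<open>B\<close>
  (\<open>balanced_iff_frame\<close>). A balanced configuration with eigenvalues \<open>\<alpha>\<^sub>1, \<alpha>\<^sub>2, \<alpha>\<^sub>3 < 0\<close> of \<open>A\<close> and
  \<open>B\<close> invertible has a relative equilibrium motion in dimension four iff two of the \<open>\<alpha>\<^sub>i\<close> agree
  (\<open>relative_equilibrium_iff_double_eigenvalue\<close>): Newton's equations say that \<open>\<Omega>\<^sup>2\<close> extends \<open>2 A\<close>, and the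
  non-zero eigenvalues of the square of an antisymmetric endomorphism have even multiplicity.

  The tangent map of \<open>X \<mapsto> A\<close> at the tetrahedron is a linear isomorphism from symmetric matrices with
  zero diagonal to symmetric endomorphisms, and there the variation of the frame does not contribute,
  because \<open>A\<close> is scalar. Hence the sum of the \<open>X\<^bsub>kl\<^esub>\<close>, the off-diagonal entries of \<open>A\<close> and the
  differences of its diagonal entries are local coordinates on symmetric matrices with zero diagonal,
  among which the shapes are those with sum \<open>1\<close> (\<open>shape_chart_derivative_injective\<close>, \<open>smooth_inverse_function\<close>). In this chart the balanced shapes are
  a coordinate plane, and the three conditions \<open>\<alpha>\<^sub>i = \<alpha>\<^sub>j\<close> are three lines through the origin of that
  plane.
\<close>

section \<open>Maps of class \<open>C\<^sup>k\<close> and smooth maps\<close>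

lemma Ck_on_cong:
  assumes "open S" "\<And>x. x \<in> S \<Longrightarrow> f x = g x" "Ck_on k f S"
  shows "Ck_on k g S"
  using assms(2,3)
proof (induction k arbitrary: f g)
  case 0
  then show ?case by (simp add: continuous_on_eq)
next
  case (Suc k)
  have D: "(g has_derivative frechet_derivative f (at x)) (at x)" if "x \<in> S" for x
    using Suc.prems that assms(1)
    by (metis Ck_on.simps(2) frechet_derivative_works has_derivative_transform_within_open)
  then have "frechet_derivative f (at x) = frechet_derivative g (at x)" if "x \<in> S" for x
    using frechet_derivative_at that by blast
  then have "Ck_on k (\<lambda>x. frechet_derivative g (at x) v) S" for v
    using Suc.prems Suc.IH[of "\<lambda>x. frechet_derivative f (at x) v"] by auto
  then show ?case using D by (auto simp: differentiable_def)
qed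

text \<open>It suffices to know some family of derivatives; \<open>frechet_derivative\<close> then agrees with it on
  the open set.\<close>

lemma Ck_on_SucI:
  assumes "open S" "\<And>x. x \<in> S \<Longrightarrow> (f has_derivative f' x) (at x)"
    "\<And>v. Ck_on k (\<lambda>x. f' x v) S"
  shows "Ck_on (Suc k) f S"
proof -
  have "Ck_on k (\<lambda>x. frechet_derivative f (at x) v) S" for v
    by (rule Ck_on_cong[OF assms(1) _ assms(3)[of v]]) (use assms(2) frechet_derivative_at in metis)
  then show ?thesis using assms(2) by (auto simp: differentiable_def)
qed

lemma Ck_on_SucD:
  assumes "Ck_on (Suc k) f S"
  shows "x \<in> S \<Longrightarrow> (f has_derivative frechet_derivative f (at x)) (at x)"
    and "Ck_on k (\<lambda>x. frechet_derivative f (at x) v) S"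
  using assms frechet_derivative_works by auto

lemma Ck_on_Suc_imp: "Ck_on (Suc k) f S \<Longrightarrow> Ck_on k f S"
proof (induction k arbitrary: f)
  case 0
  then show ?case
    by (auto intro!: continuous_at_imp_continuous_on differentiable_imp_continuous_within)
next
  case (Suc k)
  then show ?case by (metis Ck_on.simps(2))
qed

lemma Ck_on_subset: "Ck_on k f S \<Longrightarrow> T \<subseteq> S \<Longrightarrow> Ck_on k f T"
  by (induction k arbitrary: f) (auto intro: continuous_on_subset)

lemma Ck_on_const: "open S \<Longrightarrow> Ck_on k (\<lambda>x. c) S"
proof (induction k arbitrary: c)
  case (Suc k)
  then show ?case by (intro Ck_on_SucI[where f'="\<lambda>x v. 0"]) auto
qed auto

lemma Ck_on_linear:
  assumes "open S" "bounded_linear f"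
  shows "Ck_on k f S"
proof (cases k)
  case 0
  then show ?thesis using assms by (simp add: linear_continuous_on)
next
  case (Suc k)
  show ?thesis
    unfolding Suc
    by (rule Ck_on_SucI[OF assms(1), where f'="\<lambda>x. f"])
      (auto intro!: Ck_on_const assms bounded_linear_imp_has_derivative)
qed

lemma Ck_on_add:
  assumes "open S" "Ck_on k f S" "Ck_on k g S"
  shows "Ck_on k (\<lambda>x. f x + g x) S"
  using assms(2,3)
proof (induction k arbitrary: f g)
  case 0
  then show ?case by (simp add: continuous_on_add)
next
  case (Suc k)
  note D = Ck_on_SucD[OF Suc.prems(1)] Ck_on_SucD[OF Suc.prems(2)]
  show ?case
    by (rule Ck_on_SucI[OF assms(1)], rule has_derivative_add[OF D(1,3)], assumption+)
      (rule Suc.IH[OF D(2,4)])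
qed

lemma Ck_on_sum:
  assumes "open S" "\<And>i. i \<in> I \<Longrightarrow> Ck_on k (f i) S"
  shows "Ck_on k (\<lambda>x. \<Sum>i\<in>I. f i x) S"
  using assms(2)
proof (induction I rule: infinite_finite_induct)
  case (insert i I)
  then show ?case by (auto intro: Ck_on_add[OF assms(1)])
qed (auto intro: Ck_on_const[OF assms(1)])

lemma Ck_on_bilinear:
  assumes b: "bounded_bilinear b" and "open S" "Ck_on k f S" "Ck_on k g S"
  shows "Ck_on k (\<lambda>x. b (f x) (g x)) S"
  using assms(3,4)
proof (induction k arbitrary: f g)
  case 0
  then show ?case by (simp add: bounded_bilinear.continuous_on[OF b])
next
  case (Suc k)
  note D = Ck_on_SucD[OF Suc.prems(1)] Ck_on_SucD[OF Suc.prems(2)]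
  note C = Suc.prems[THEN Ck_on_Suc_imp]
  show ?case
    by (rule Ck_on_SucI[OF assms(2)], rule bounded_bilinear.FDERIV[OF b D(1,3)], assumption+)
      (intro Ck_on_add assms(2) Suc.IH D C)
qed

lemmas Ck_on_scaleR = Ck_on_bilinear[OF bounded_bilinear_scaleR]
lemmas Ck_on_mult = Ck_on_bilinear[OF bounded_bilinear_mult]

text \<open>The chain rule expresses the derivative of the composite through products of the components of
  the inner derivative with the compositions of the outer partial derivatives, each of which has one
  degree of smoothness less.\<close>

lemma Ck_on_compose:
  fixes f :: "'b::euclidean_space \<Rightarrow> 'c::euclidean_space" and g :: "'a::euclidean_space \<Rightarrow> 'b"
  assumes "open S" "open T" "g ` S \<subseteq> T" "Ck_on k g S" "Ck_on k f T"
  shows "Ck_on k (\<lambda>x. f (g x)) S"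
  using assms(4,5)
proof (induction k arbitrary: f)
  case 0
  then show ?case using assms(3) by (auto intro: continuous_on_compose2)
next
  case (Suc k)
  define Dg where "Dg x = frechet_derivative g (at x)" for x
  define Df where "Df x = frechet_derivative f (at x)" for x
  note D = Ck_on_SucD[OF Suc.prems(1), folded Dg_def] Ck_on_SucD[OF Suc.prems(2), folded Df_def]
  note g = Ck_on_Suc_imp[OF Suc.prems(1)]
  have der: "((\<lambda>x. f (g x)) has_derivative (\<lambda>v. \<Sum>b\<in>Basis. inner b (Dg x v) *\<^sub>R Df (g x) b)) (at x)"
    if "x \<in> S" for x
  proof -
    have gx: "g x \<in> T" using that assms(3) by auto
    have lin: "linear (Df (g x))" by (rule has_derivative_linear[OF D(3)[OF gx]])
    have eq: "Df (g x) w = (\<Sum>b\<in>Basis. inner b w *\<^sub>R Df (g x) b)" for w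
    proof -
      have "Df (g x) w = Df (g x) (\<Sum>b\<in>Basis. inner w b *\<^sub>R b)" by (simp add: euclidean_representation)
      also have "\<dots> = (\<Sum>b\<in>Basis. inner w b *\<^sub>R Df (g x) b)"
        by (simp add: linear_sum[OF lin] linear_cmul[OF lin])
      finally show ?thesis by (simp add: inner_commute)
    qed
    have "((\<lambda>x. f (g x)) has_derivative (\<lambda>v. Df (g x) (Dg x v))) (at x)"
      by (rule has_derivative_compose[OF D(1)[OF that] D(3)[OF gx]])
    then show ?thesis by (subst (asm) eq)
  qed
  have "Ck_on k (\<lambda>x. inner b (Dg x v)) S" for b v
    by (rule Ck_on_bilinear[OF bounded_bilinear_inner assms(1) Ck_on_const[OF assms(1)] D(2)])
  then have C: "Ck_on k (\<lambda>x. \<Sum>b\<in>Basis. inner b (Dg x v) *\<^sub>R Df (g x) b) S" for v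
    by (intro Ck_on_sum[OF assms(1)] Ck_on_scaleR[OF assms(1)] Suc.IH[OF g D(4)])
  show ?case by (rule Ck_on_SucI[OF assms(1) der C])
qed

lemma Ck_on_componentwise:
  assumes "open S" "\<And>b. b \<in> Basis \<Longrightarrow> Ck_on k (\<lambda>x. inner (f x) b) S"
  shows "Ck_on k f S"
proof -
  have "Ck_on k (\<lambda>x. \<Sum>b\<in>Basis. inner (f x) b *\<^sub>R b) S"
    by (intro Ck_on_sum Ck_on_scaleR Ck_on_const assms)
  then show ?thesis by (simp add: euclidean_representation)
qed

lemma Ck_on_powr:
  "Ck_on k (\<lambda>s::real. s powr a) {0<..}"
proof (induction k arbitrary: a)
  case 0
  then show ?case by (auto intro!: continuous_on_powr)
next
  case (Suc k)
  show ?case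
  proof (rule Ck_on_SucI)
    fix s :: real assume "s \<in> {0<..}"
    then show "((\<lambda>s. s powr a) has_derivative (\<lambda>v. v * (a * s powr (a - 1)))) (at s)"
      using has_real_derivative_powr[of s a]
      by (simp add: has_field_derivative_def mult.commute[of _ "a * _"])
  qed (auto intro!: Ck_on_mult Ck_on_const Suc)
qed

lemma smooth_onD: "smooth_on S f \<Longrightarrow> Ck_on k f S"
  by (simp add: smooth_on_def)

lemma smooth_on_subset: "smooth_on S f \<Longrightarrow> T \<subseteq> S \<Longrightarrow> smooth_on T f"
  unfolding smooth_on_def using Ck_on_subset by blast

lemma smooth_on_compose:
  "open S \<Longrightarrow> open T \<Longrightarrow> g ` S \<subseteq> T \<Longrightarrow> smooth_on S g \<Longrightarrow> smooth_on T f \<Longrightarrow> smooth_on S (\<lambda>x. f (g x))"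
  unfolding smooth_on_def using Ck_on_compose by blast

lemma smooth_on_has_derivative:
  "smooth_on S f \<Longrightarrow> x \<in> S \<Longrightarrow> (f has_derivative frechet_derivative f (at x)) (at x)"
  using Ck_on_SucD(1) smooth_onD by blast

lemma smooth_on_isCont: "smooth_on S f \<Longrightarrow> x \<in> S \<Longrightarrow> isCont f x"
  by (rule has_derivative_continuous[OF smooth_on_has_derivative])

lemma smooth_on_vec:
  fixes f :: "'a::euclidean_space \<Rightarrow> 'b::euclidean_space ^ 'n"
  assumes "open S" "\<And>i. smooth_on S (\<lambda>x. f x $ i)"
  shows "smooth_on S f"
  unfolding smooth_on_def
proof
  fix k
  show "Ck_on k f S"
  proof (rule Ck_on_componentwise[OF assms(1)])
    fix b :: "'b ^ 'n" assume "b \<in> Basis"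
    then obtain i u where b: "b = axis i u" by (auto simp: Basis_vec_def)
    have "Ck_on k (\<lambda>x. inner (f x $ i) u) S"
      by (rule Ck_on_bilinear[OF bounded_bilinear_inner assms(1) smooth_onD[OF assms(2)] Ck_on_const[OF assms(1)]])
    then show "Ck_on k (\<lambda>x. inner (f x) b) S" by (simp add: b inner_axis)
  qed
qed

lemma smooth_on_linear: "open S \<Longrightarrow> linear f \<Longrightarrow> smooth_on S f"
  unfolding smooth_on_def using Ck_on_linear linear_conv_bounded_linear by blast

lemma smooth_on_const: "open S \<Longrightarrow> smooth_on S (\<lambda>x. c)"
  by (simp add: smooth_on_def Ck_on_const)

lemma smooth_on_add: "open S \<Longrightarrow> smooth_on S f \<Longrightarrow> smooth_on S g \<Longrightarrow> smooth_on S (\<lambda>x. f x + g x)"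
  by (simp add: smooth_on_def Ck_on_add)

lemma smooth_on_sum: "open S \<Longrightarrow> (\<And>i. i \<in> I \<Longrightarrow> smooth_on S (f i)) \<Longrightarrow> smooth_on S (\<lambda>x. \<Sum>i\<in>I. f i x)"
  by (simp add: smooth_on_def Ck_on_sum)

lemma smooth_on_mult:
  "open S \<Longrightarrow> smooth_on S f \<Longrightarrow> smooth_on S g \<Longrightarrow> smooth_on S (\<lambda>x. f x * g x :: real)"
  by (simp add: smooth_on_def Ck_on_mult)

lemma smooth_on_diff:
  "open S \<Longrightarrow> smooth_on S f \<Longrightarrow> smooth_on S g \<Longrightarrow> smooth_on S (\<lambda>x. f x - g x :: real)"
  using smooth_on_add[of S f "\<lambda>x. (-1) * g x"] smooth_on_mult[of S "\<lambda>x. -1" g] smooth_on_const[of S "-1::real"]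
  by simp

lemma smooth_on_divide: "open S \<Longrightarrow> smooth_on S f \<Longrightarrow> smooth_on S (\<lambda>x. f x / c :: real)"
  using smooth_on_mult[of S f "\<lambda>x. inverse c"] smooth_on_const[of S "inverse c"]
  by (simp add: divide_inverse)

lemma smooth_on_linear_image:
  fixes L :: "'b::euclidean_space \<Rightarrow> 'c::euclidean_space"
  shows "open S \<Longrightarrow> linear L \<Longrightarrow> smooth_on S f \<Longrightarrow> smooth_on S (\<lambda>x. L (f x))"
  using smooth_on_compose[of S UNIV f L] smooth_on_linear[of UNIV L] by simp

lemma smooth_on_vec_nth:
  fixes f :: "'a::euclidean_space \<Rightarrow> 'b::euclidean_space ^ 'n"
  shows "open S \<Longrightarrow> smooth_on S f \<Longrightarrow> smooth_on S (\<lambda>x. f x $ i)"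
  by (rule smooth_on_linear_image[where L="\<lambda>y. y $ i"]) (auto intro: linearI)

lemma smooth_on_bilinear:
  assumes "open S" "bilinear b" "smooth_on S f" "smooth_on S g"
  shows "smooth_on S (\<lambda>x. b (f x) (g x))"
  unfolding smooth_on_def
  by (intro allI Ck_on_bilinear[OF bilinear_conv_bounded_bilinear[THEN iffD1, OF assms(2)] assms(1)]
      smooth_onD[OF assms(3)] smooth_onD[OF assms(4)])

lemma has_derivative_along_line:
  assumes "(f has_derivative F) (at x)"
  shows "((\<lambda>t::real. f (x + t *\<^sub>R h)) has_vector_derivative F h) (at 0)"
proof -
  have "((\<lambda>t::real. x + t *\<^sub>R h) has_vector_derivative h) (at 0)"
    by (auto intro!: derivative_eq_intros)
  moreover have "(f has_derivative F) (at (x + 0 *\<^sub>R h))" using assms by simp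
  ultimately show ?thesis
    using vector_derivative_diff_chain_within[of "\<lambda>t::real. x + t *\<^sub>R h" h 0 UNIV f F] 
    by (simp add: o_def has_derivative_at_withinI)
qed

section \<open>Smooth inverse and implicit functions\<close>

text \<open>From \<open>E y - E x = E y (D x - D y) E x\<close>, first \<open>E\<close> is bounded near \<open>x\<close> by twice its norm at \<open>x\<close>,
  and then the difference tends to zero.\<close>

lemma continuous_at_inverse_operator:
  fixes D E :: "'a::real_normed_vector \<Rightarrow> 'b::real_normed_vector \<Rightarrow>\<^sub>L 'b"
  assumes "open S" "x \<in> S" "isCont D x"
    "\<And>y v. y \<in> S \<Longrightarrow> D y (E y v) = v" "\<And>y v. y \<in> S \<Longrightarrow> E y (D y v) = v"
  shows "isCont E x"
proof -
  have lim: "((\<lambda>y. norm (D x - D y) * norm (E x)) \<longlongrightarrow> norm (D x - D x) * norm (E x)) (at x)"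
    using assms(3) by (intro tendsto_intros) (auto simp: isCont_def)
  have "eventually (\<lambda>y. y \<in> S) (at x)"
    using assms(1,2) eventually_at_topological by blast
  moreover have "eventually (\<lambda>y. norm (D x - D y) * norm (E x) < 1/2) (at x)"
    by (rule order_tendstoD[OF lim]) simp
  ultimately have "eventually (\<lambda>y. norm (E y - E x) \<le> 2 * norm (E x) * (norm (D x - D y) * norm (E x))) (at x)"
  proof eventually_elim
    case (elim y)
    have eq: "E y - E x = E y o\<^sub>L ((D x - D y) o\<^sub>L E x)"
      by (rule blinfun_eqI) (simp add: assms elim blinfun.diff_left blinfun.diff_right)
    have le: "norm (E y - E x) \<le> norm (E y) * (norm (D x - D y) * norm (E x))"
      unfolding eq by (meson mult_left_mono norm_blinfun_compose norm_ge_zero order_trans)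
    also have "\<dots> \<le> norm (E y) * (1/2)"
      using elim by (intro mult_left_mono) auto
    finally have "norm (E y) \<le> 2 * norm (E x)"
      using norm_triangle_ineq2[of "E y" "E x"] by linarith
    then show ?case using le by (meson mult_right_mono mult_nonneg_nonneg norm_ge_zero order_trans)
  qed
  moreover have "((\<lambda>y. 2 * norm (E x) * (norm (D x - D y) * norm (E x))) \<longlongrightarrow> 2 * norm (E x) * (norm (D x - D x) * norm (E x))) (at x)"
    by (intro tendsto_mult_left lim)
  ultimately have "((\<lambda>y. E y - E x) \<longlongrightarrow> 0) (at x)"
    using Lim_null_comparison by force
  then show ?thesis using LIM_zero_iff isCont_def by blast
qed

text \<open>A product rule in which the operator factor need only be continuous, because the other factor
  vanishes at the point.\<close>

lemma has_derivative_blinfun_apply_zero: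
  fixes E :: "'a::real_normed_vector \<Rightarrow> 'b::real_normed_vector \<Rightarrow>\<^sub>L 'c::real_normed_vector"
  assumes "isCont E x" "(w has_derivative w') (at x)" "w x = 0"
  shows "((\<lambda>y. E y (w y)) has_derivative (\<lambda>h. E x (w' h))) (at x)"
  unfolding has_derivative_at_alt
proof (intro conjI allI impI)
  have w': "bounded_linear w'" using assms(2) by (rule has_derivative_bounded_linear)
  show "bounded_linear (\<lambda>h. E x (w' h))"
    by (rule bounded_linear_compose[OF blinfun.bounded_linear_right w'])
  obtain C where C: "C > 0" "\<And>h. norm (w' h) \<le> norm h * C"
    using bounded_linear.pos_bounded[OF w'] by blast
  fix e :: real assume e: "e > 0"
  define N where "N = norm (E x) + 1"
  have N: "N > 0" "norm (E x) \<le> N" by (simp_all add: N_def add_nonneg_pos)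
  define e1 where "e1 = min 1 (e / (2 * N))"
  define e2 where "e2 = e / (2 * (C + 1))"
  have e12: "e1 > 0" "e1 \<le> 1" "N * e1 \<le> e/2" "e2 > 0" "e2 * (C + 1) = e/2"
    using e N C by (auto simp: e1_def e2_def min_def field_simps)
  obtain d1 where d1: "d1 > 0" "\<And>y. norm (y - x) < d1 \<Longrightarrow> norm (w y - w x - w' (y - x)) \<le> e1 * norm (y - x)"
    using assms(2) e12(1) unfolding has_derivative_at_alt by blast
  obtain d2 where d2: "d2 > 0" "\<And>y. norm (y - x) < d2 \<Longrightarrow> norm (E y - E x) < e2"
    using assms(1) e12(4) unfolding continuous_at_eps_delta dist_norm by blast
  show "\<exists>d>0. \<forall>y. norm (y - x) < d \<longrightarrow>
      norm (blinfun_apply (E y) (w y) - blinfun_apply (E x) (w x) - blinfun_apply (E x) (w' (y - x))) \<le> e * norm (y - x)"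
  proof (intro exI[of _ "min d1 d2"] conjI allI impI)
    fix y assume y: "norm (y - x) < min d1 d2"
    define n where "n = norm (y - x)"
    have 1: "norm (w y - w' (y - x)) \<le> e1 * n" using d1(2)[of y] y assms(3) by (simp add: n_def)
    have "norm (w y) \<le> norm (w y - w' (y - x)) + norm (w' (y - x))"
      using norm_triangle_ineq[of "w y - w' (y - x)" "w' (y - x)"] by simp
    also have "\<dots> \<le> 1 * n + n * C"
      using 1 C(2)[of "y - x"] mult_right_mono[OF e12(2), of n] by (simp add: n_def)
    finally have 2: "norm (w y) \<le> (C + 1) * n" by (simp add: algebra_simps)
    have "E y (w y) - E x (w x) - E x (w' (y - x)) = E x (w y - w' (y - x)) + (E y - E x) (w y)"
      by (simp add: assms(3) blinfun.diff_left blinfun.diff_right)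
    also have "norm \<dots> \<le> norm (E x) * norm (w y - w' (y - x)) + norm (E y - E x) * norm (w y)"
      by (intro norm_triangle_le add_mono norm_blinfun)
    also have "\<dots> \<le> N * (e1 * n) + e2 * ((C + 1) * n)"
      using 1 2 N d2(2)[of y] y e12 C by (intro add_mono mult_mono) (auto simp: n_def)
    also have "\<dots> = (N * e1 + e2 * (C + 1)) * n" by (simp add: algebra_simps)
    also have "\<dots> \<le> e * n" using e12 by (intro mult_right_mono) (auto simp: n_def)
    finally show "norm (blinfun_apply (E y) (w y) - blinfun_apply (E x) (w x) - blinfun_apply (E x) (w' (y - x))) \<le> e * norm (y - x)"
      by (simp add: n_def)
  qed (use d1 d2 in auto)
qed

text \<open>Pointwise inversion of a smooth family of operators is smooth: the derivative of \<open>E v\<close> in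
  direction \<open>h\<close> is \<open>- E (D' h) (E v)\<close>, which is polynomial in the entries of \<open>E\<close> and of the
  derivative \<open>D' h\<close> of \<open>D\<close>, so that smoothness of \<open>E\<close> improves itself.\<close>

lemma Ck_on_inverse_operator:
  fixes D E :: "'a::euclidean_space \<Rightarrow> 'b::euclidean_space \<Rightarrow>\<^sub>L 'b"
  assumes S: "open S" and smooth: "\<And>v. smooth_on S (\<lambda>x. D x v)"
    and DE: "\<And>y v. y \<in> S \<Longrightarrow> D y (E y v) = v" and ED: "\<And>y v. y \<in> S \<Longrightarrow> E y (D y v) = v"
  shows "Ck_on k (\<lambda>x. E x v) S"
proof (induction k arbitrary: v)
  case 0
  have "isCont D x" if "x \<in> S" for x
    by (rule continuous_blinfun_componentwiseI1)
      (rule smooth_on_isCont[OF smooth that])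
  then have "isCont E x" if "x \<in> S" for x
    by (rule continuous_at_inverse_operator[OF S that _ DE ED]) (use that in auto)
  then show ?case
    by (auto intro!: continuous_at_imp_continuous_on continuous_intros)
next
  case (Suc k)
  define D' where "D' = (\<lambda>u x. frechet_derivative (\<lambda>y. D y u) (at x))"
  have D': "((\<lambda>y. D y u) has_derivative D' u x) (at x)" if "x \<in> S" for u x
    unfolding D'_def using smooth_on_has_derivative[OF smooth that] .
  have contE: "isCont E x" if "x \<in> S" for x
  proof (rule continuous_at_inverse_operator[OF S that _ DE ED])
    show "isCont D x"
      by (rule continuous_blinfun_componentwiseI1) (rule has_derivative_continuous[OF D'[OF that]])
  qed auto
  have D'exp: "D' (\<Sum>b\<in>Basis. c b *\<^sub>R b) x h = (\<Sum>b\<in>Basis. c b *\<^sub>R D' b x h)" if "x \<in> S" for c x h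
  proof -
    have "((\<lambda>y. \<Sum>b\<in>Basis. c b *\<^sub>R D y b) has_derivative (\<lambda>h. \<Sum>b\<in>Basis. c b *\<^sub>R D' b x h)) (at x)"
      by (intro has_derivative_sum has_derivative_scaleR_right D' that)
    then have "((\<lambda>y. D y (\<Sum>b\<in>Basis. c b *\<^sub>R b)) has_derivative (\<lambda>h. \<Sum>b\<in>Basis. c b *\<^sub>R D' b x h)) (at x)"
      by (simp add: blinfun.sum_right blinfun.scaleR_right)
    from fun_cong[OF has_derivative_unique[OF this D'[OF that]]] show ?thesis by simp
  qed
  have Eexp: "E x u = (\<Sum>b\<in>Basis. inner u b *\<^sub>R E x b)" for x u
  proof -
    have "E x u = E x (\<Sum>b\<in>Basis. inner u b *\<^sub>R b)" by (simp add: euclidean_representation)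
    also have "\<dots> = (\<Sum>b\<in>Basis. inner u b *\<^sub>R E x b)"
      by (simp add: blinfun.sum_right blinfun.scaleR_right)
    finally show ?thesis .
  qed
  define E' where "E' = (\<lambda>x h. \<Sum>b\<in>Basis. (\<Sum>c\<in>Basis. inner (E x v) c * inner (D' c x h) b) *\<^sub>R (- E x b))"
  have der: "((\<lambda>y. E y v) has_derivative E' x) (at x)" if x: "x \<in> S" for x
  proof -
    define u where "u = E x v"
    \<comment> \<open>Since \<open>E y v = u + E y (v - D y u)\<close>, the rule for a factor vanishing at \<open>x\<close> applies.\<close>
    define w where "w = (\<lambda>y. v - D y u)"
    have "w x = 0" by (simp add: w_def u_def DE x)
    moreover have "(w has_derivative (\<lambda>h. - D' u x h)) (at x)"
      unfolding w_def by (rule derivative_eq_intros D'[OF x] refl)+ simp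
    ultimately have "((\<lambda>y. E y (w y)) has_derivative (\<lambda>h. E x (- D' u x h))) (at x)"
      using contE[OF x] has_derivative_blinfun_apply_zero by blast
    then have "((\<lambda>y. u + E y (w y)) has_derivative (\<lambda>h. E x (- D' u x h))) (at x)"
      using has_derivative_add[OF has_derivative_const[of u]] by fastforce
    moreover have "u + E y (w y) = E y v" if "y \<in> S" for y
      using ED that by (simp add: w_def blinfun.diff_right)
    ultimately have "((\<lambda>y. E y v) has_derivative (\<lambda>h. E x (- D' u x h))) (at x)"
      using has_derivative_transform_within_open[OF _ S x] by force
    moreover have "E x (- D' u x h) = E' x h" for h
    proof -
      have "D' u x h = (\<Sum>c\<in>Basis. inner u c *\<^sub>R D' c x h)"
        using D'exp[OF x, of "\<lambda>c. inner u c" h] by (simp add: euclidean_representation)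
      then show ?thesis
        using Eexp[of x "D' u x h"]
        by (simp add: E'_def u_def blinfun.minus_right inner_sum_left sum_negf)
    qed
    ultimately show ?thesis by simp
  qed
  have sm: "Ck_on k (\<lambda>x. D' c x h) S" for c h
    unfolding D'_def using smooth Ck_on_SucD(2) smooth_onD by blast
  have "Ck_on k (\<lambda>x. \<Sum>b\<in>Basis. (\<Sum>c\<in>Basis. inner (E x v) c * inner (D' c x h) b) *\<^sub>R ((-1) *\<^sub>R E x b)) S" for h
    by (intro Ck_on_sum Ck_on_scaleR Ck_on_mult Ck_on_bilinear[OF bounded_bilinear_inner] Ck_on_const S Suc.IH sm)
  then have "Ck_on k (\<lambda>x. E' x h) S" for h by (simp add: E'_def)
  then show ?case by (intro Ck_on_SucI[OF S der])
qed

text \<open>The inverse function theorem gives a differentiable local inverse \<open>g\<close> whose derivative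
  at \<open>y\<close> inverts the derivative of \<open>f\<close> at \<open>g y\<close>. As inversion of operators is smooth, \<open>g\<close> gains one
  degree of smoothness at a time. The target is shrunk to a ball, which is convenient for lines
  through its centre.\<close>

theorem smooth_inverse_function:
  fixes f :: "'a::euclidean_space \<Rightarrow> 'a"
  assumes S: "open S" "x0 \<in> S" and f: "smooth_on S f"
    and der: "(f has_derivative f0) (at x0)" and inj: "\<And>h. f0 h = 0 \<Longrightarrow> h = 0"
  obtains U g e where "open U" "x0 \<in> U" "U \<subseteq> S" "e > 0"
    "homeomorphism U (ball (f x0) e) f g" "smooth_on (ball (f x0) e) g"
proof -
  define D where "D = (\<lambda>x. Blinfun (frechet_derivative f (at x)))"
  have Dapp: "blinfun_apply (D x) = frechet_derivative f (at x)" if "x \<in> S" for x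
    unfolding D_def using smooth_on_has_derivative[OF f that]
    by (simp add: bounded_linear_Blinfun_apply has_derivative_bounded_linear)
  have D: "(f has_derivative D x) (at x)" if "x \<in> S" for x
    using smooth_on_has_derivative[OF f that] Dapp[OF that] by simp
  have smoothD: "smooth_on S (\<lambda>x. D x v)" for v
    unfolding smooth_on_def
  proof
    fix k
    show "Ck_on k (\<lambda>x. D x v) S"
      by (rule Ck_on_cong[OF S(1) _ Ck_on_SucD(2)[OF smooth_onD[OF f, of "Suc k"]]]) (simp add: Dapp)
  qed
  have contD: "continuous_on S D"
    by (rule continuous_at_imp_continuous_on, rule ballI, rule continuous_blinfun_componentwiseI1)
      (rule smooth_on_isCont[OF smoothD])
  have D0: "blinfun_apply (D x0) = f0" using has_derivative_unique[OF D[OF S(2)] der] .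
  have lin0: "linear f0" by (rule has_derivative_linear[OF der])
  have "inj f0" using inj lin0 linear_injective_0 by blast
  then obtain g0 where g0: "linear g0" "\<And>x. g0 (f0 x) = x"
    using linear_injective_left_inverse[OF lin0] by (metis comp_apply id_apply)
  define invf where "invf = Blinfun g0"
  have "invf o\<^sub>L D x0 = id_blinfun"
    by (rule blinfun_eqI)
      (simp add: invf_def D0 g0(2) bounded_linear_Blinfun_apply linear_conv_bounded_linear[THEN iffD1, OF g0(1)])
  then obtain U' V g g' where U': "open U'" "U' \<subseteq> S" "x0 \<in> U'" and V: "open V" "f x0 \<in> V"
    and hom: "homeomorphism U' V f g"
    and g': "\<And>y. y \<in> V \<Longrightarrow> (g has_derivative (g' y)) (at y)"
      "\<And>y. y \<in> V \<Longrightarrow> g' y = inv (blinfun_apply (D (g y)))"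
      "\<And>y. y \<in> V \<Longrightarrow> bij (blinfun_apply (D (g y)))"
    using inverse_function_theorem[OF S(1) D contD S(2)] by blast
  have gV: "g y \<in> U'" "f (g y) = y" if "y \<in> V" for y
    using hom that by (auto simp: homeomorphism_def)
  have gf: "f x \<in> V" "g (f x) = x" if "x \<in> U'" for x
    using hom that by (auto simp: homeomorphism_def)
  define E where "E = (\<lambda>x. Blinfun (g' (f x)))"
  have Eapp: "blinfun_apply (E x) = g' (f x)" if "x \<in> U'" for x
    unfolding E_def
    by (rule bounded_linear_Blinfun_apply[OF has_derivative_bounded_linear[OF g'(1)[OF gf(1)[OF that]]]])
  have inv: "D x (E x v) = v" "E x (D x v) = v" if "x \<in> U'" for x v
    using g'(2,3)[OF gf(1)[OF that]] gf[OF that] Eapp[OF that]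
    by (simp_all add: bij_is_surj surj_f_inv_f bij_is_inj)
  have CE: "Ck_on k (\<lambda>x. E x v) U'" for k v
    by (rule Ck_on_inverse_operator[OF U'(1) smooth_on_subset[OF smoothD U'(2)] inv])
  have "Ck_on k g V" for k
  proof (induction k)
    case 0
    then show ?case using hom by (simp add: homeomorphism_def)
  next
    case (Suc k)
    show ?case
    proof (rule Ck_on_SucI[OF V(1) g'(1)])
      fix v
      show "Ck_on k (\<lambda>x. g' x v) V"
        by (rule Ck_on_cong[OF V(1) _ Ck_on_compose[OF V(1) U'(1) _ Suc CE]])
          (use gV Eapp in auto)
    qed
  qed
  then have smg: "smooth_on V g" by (simp add: smooth_on_def)
  obtain e where e: "e > 0" "ball (f x0) e \<subseteq> V" using V open_contains_ball by blast
  define U where "U = g ` ball (f x0) e"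
  have U_eq: "U = U' \<inter> f -` ball (f x0) e"
    unfolding U_def using gV gf e by (force simp: image_iff)
  have "continuous_on U' f" using hom by (simp add: homeomorphism_def)
  then have "open U" unfolding U_eq using U'(1) by (simp add: continuous_open_preimage)
  moreover have "x0 \<in> U" unfolding U_eq using U' e by simp
  moreover have "U \<subseteq> S" unfolding U_eq using U' by auto
  moreover have "homeomorphism U (ball (f x0) e) f g"
  proof (rule homeomorphism_of_subsets[OF hom])
    have "f (g y) = y" if "y \<in> ball (f x0) e" for y using gV(2) e(2) that by blast
    then show "f ` U = ball (f x0) e" unfolding U_def image_image by simp
  qed (use e U_eq in auto)
  moreover have "smooth_on (ball (f x0) e) g" using smg e(2) smooth_on_subset by blast
  ultimately show ?thesis using that e(1) by blast
qed

text \<open>Apply the inverse function theorem to \<open>(x, y) \<mapsto> (x, f (x, y))\<close>.\<close>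

theorem smooth_implicit_function:
  fixes f :: "'a::euclidean_space \<times> 'b::euclidean_space \<Rightarrow> 'b"
  assumes S: "open S" "(x0, y0) \<in> S" and f: "smooth_on S f"
    and der: "(f has_derivative f0) (at (x0, y0))" and inj: "\<And>h. f0 (0, h) = 0 \<Longrightarrow> h = 0"
  obtains W q where "open W" "x0 \<in> W" "smooth_on W q" "q x0 = y0"
    "\<And>x. x \<in> W \<Longrightarrow> (x, q x) \<in> S" "\<And>x. x \<in> W \<Longrightarrow> f (x, q x) = f (x0, y0)"
proof -
  define F where "F = (\<lambda>p. (fst p, f p))"
  have "Ck_on k F S" for k
  proof -
    have "Ck_on k (\<lambda>p. (fst p, 0) + (0, f p)) S"
    proof (intro Ck_on_add S(1))
      show "Ck_on k (\<lambda>p. (fst p, 0::'b)) S"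
        by (intro Ck_on_linear S(1) bounded_linear_intros)
      have "Ck_on k (\<lambda>y::'b. (0::'a, y)) UNIV"
        by (intro Ck_on_linear open_UNIV bounded_linear_intros)
      from Ck_on_compose[OF S(1) open_UNIV _ smooth_onD[OF f] this]
      show "Ck_on k (\<lambda>p. (0::'a, f p)) S" by simp
    qed
    then show ?thesis by (simp add: F_def)
  qed
  then have smF: "smooth_on S F" by (simp add: smooth_on_def)
  have derF: "(F has_derivative (\<lambda>h. (fst h, f0 h))) (at (x0, y0))"
    unfolding F_def by (intro derivative_intros der)
  have injF: "h = 0" if "(fst h, f0 h) = 0" for h
    using that inj[of "snd h"] by (cases h) (simp add: zero_prod_def)
  obtain U g e where U: "open U" "(x0, y0) \<in> U" "U \<subseteq> S" "e > 0"
    and hom: "homeomorphism U (ball (F (x0, y0)) e) F g" and smg: "smooth_on (ball (F (x0, y0)) e) g"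
    by (rule smooth_inverse_function[OF S smF derF injF])
  define c where "c = f (x0, y0)"
  have F0: "F (x0, y0) = (x0, c)" by (simp add: F_def c_def)
  have in_ball: "(x, c) \<in> ball (F (x0, y0)) e" if "x \<in> ball x0 e" for x
    using that by (simp add: F0 dist_Pair_Pair)
  define q where "q = (\<lambda>x. snd (g (x, c)))"
  have g: "g (x, c) \<in> U \<and> F (g (x, c)) = (x, c)" if "x \<in> ball x0 e" for x
    using in_ball[OF that] hom by (auto simp: homeomorphism_def)
  then have g_eq: "g (x, c) = (x, q x)" if "x \<in> ball x0 e" for x
    using that unfolding q_def F_def by (metis fst_conv prod.collapse)
  show ?thesis
  proof (rule that[of "ball x0 e" q])
    show "smooth_on (ball x0 e) q"
      unfolding smooth_on_def
    proof
      fix k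
      have 0: "Ck_on k (\<lambda>x. (x, 0::'b) + (0, c)) (ball x0 e)"
        by (intro Ck_on_add Ck_on_linear Ck_on_const bounded_linear_intros) auto
      have 1: "Ck_on k (\<lambda>x. g ((x, 0) + (0, c))) (ball x0 e)"
        by (rule Ck_on_compose[OF _ _ _ 0 smooth_onD[OF smg]]) (use in_ball in auto)
      have 2: "Ck_on k (snd :: 'a \<times> 'b \<Rightarrow> 'b) UNIV"
        by (intro Ck_on_linear open_UNIV bounded_linear_intros)
      have "Ck_on k (\<lambda>x. snd (g ((x, 0) + (0, c)))) (ball x0 e)"
        by (rule Ck_on_compose[OF _ open_UNIV _ 1 2]) auto
      then show "Ck_on k q (ball x0 e)" by (simp add: q_def)
    qed
    have "g (F (x0, y0)) = (x0, y0)" using hom U(2) by (auto simp: homeomorphism_def)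
    then show "q x0 = y0" by (simp add: q_def F0)
    show "(x, q x) \<in> S" if "x \<in> ball x0 e" for x using g[OF that] g_eq[OF that] U(3) by auto
    show "f (x, q x) = f (x0, y0)" if "x \<in> ball x0 e" for x
      using g[OF that] g_eq[OF that] by (auto simp: F_def c_def)
  qed (use U(4) in auto)
qed

section \<open>Submanifolds and curves in a chart\<close>

lemma smooth_submanifold_from_chart:
  fixes h g :: "'a::euclidean_space \<Rightarrow> 'a"
  assumes "open U" "open V" "homeomorphism U V h g" "smooth_on U h" "smooth_on V g"
    and L: "subspace L" "dim L = k" and M: "\<And>x. x \<in> U \<Longrightarrow> x \<in> M \<longleftrightarrow> h x \<in> L"
  shows "smooth_submanifold k (M \<inter> U)"
proof -
  have "h ` U = V" using assms(3) by (simp add: homeomorphism_def)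
  then have straight: "h ` (M \<inter> U \<inter> U) = L \<inter> V" using M by auto
  show ?thesis
    unfolding smooth_submanifold_def
    by (intro ballI, rule exI[of _ U], rule exI[of _ V], rule exI[of _ h], rule exI[of _ g],
        rule exI[of _ L]) (use assms straight in simp)
qed

text \<open>In a chart onto a ball, the part of the domain lying over a line through the centre is a regular
  curve.\<close>

lemma regular_curve_through_line:
  fixes h g :: "'a::euclidean_space \<Rightarrow> 'a"
  assumes U: "open U" and e: "e > 0" and hom: "homeomorphism U (ball 0 e) h g"
    and h: "smooth_on U h" and g: "smooth_on (ball 0 e) g" and d: "d \<noteq> 0"
  shows "regular_curve_through (g 0) {x \<in> U. \<exists>t. h x = t *\<^sub>R d}"
proof -
  \<comment> \<open>Rescaling the direction to length \<open>e\<close> makes the parameter interval \<open>(-1, 1)\<close>.\<close>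
  define d' where "d' = (e / norm d) *\<^sub>R d"
  have nd: "norm d' = e" "d' \<noteq> 0" using d e by (simp_all add: d'_def)
  define \<gamma> where "\<gamma> t = g (t *\<^sub>R d')" for t
  have ball: "t *\<^sub>R d' \<in> ball 0 e \<longleftrightarrow> t \<in> {-1<..<1}" for t
    using e by (simp add: nd abs_less_iff) linarith
  have hg: "g y \<in> U" "h (g y) = y" if "y \<in> ball 0 e" for y
    using hom that by (auto simp: homeomorphism_def)
  have gh: "h x \<in> ball 0 e" "g (h x) = x" if "x \<in> U" for x
    using hom that by (auto simp: homeomorphism_def)
  have lin: "linear (\<lambda>t. t *\<^sub>R d')" by (rule linearI) (simp_all add: scaleR_add_left)
  have smooth: "smooth_on {-1<..<1} \<gamma>"
    unfolding \<gamma>_def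
  proof (rule smooth_on_compose[OF _ _ _ _ g])
    show "(\<lambda>t. t *\<^sub>R d') ` {-1<..<1} \<subseteq> ball 0 e" using ball by blast
    show "smooth_on {-1<..<1} (\<lambda>t. t *\<^sub>R d')" by (rule smooth_on_linear[OF _ lin]) simp
  qed simp_all
  \<comment> \<open>The parameter is recovered from the chart by projecting to the line.\<close>
  define k where "k x = inner (h x) d' / e\<^sup>2" for x
  have k: "k (\<gamma> t) = t" if "t \<in> {-1<..<1}" for t
    using hg(2)[of "t *\<^sub>R d'"] ball[of t] that nd e
    by (simp add: k_def \<gamma>_def power2_norm_eq_inner[symmetric])
  have \<gamma>: "\<gamma> t \<in> U" "h (\<gamma> t) = t *\<^sub>R d'" if "t \<in> {-1<..<1}" for t
    using hg[of "t *\<^sub>R d'"] ball[of t] that by (simp_all add: \<gamma>_def)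
  have image: "\<gamma> ` {-1<..<1} = {x \<in> U. \<exists>t. h x = t *\<^sub>R d}"
  proof (intro equalityI subsetI)
    fix x assume "x \<in> \<gamma> ` {-1<..<1}"
    then obtain t where "t \<in> {-1<..<1}" "x = \<gamma> t" by blast
    then have "x \<in> U" "h x = (t * (e / norm d)) *\<^sub>R d" using \<gamma>[of t] by (simp_all add: d'_def)
    then show "x \<in> {x \<in> U. \<exists>t. h x = t *\<^sub>R d}" by blast
  next
    fix x assume "x \<in> {x \<in> U. \<exists>t. h x = t *\<^sub>R d}"
    then obtain t where x: "x \<in> U" "h x = t *\<^sub>R d" by blast
    define s where "s = t * norm d / e"
    have hx: "h x = s *\<^sub>R d'" using x(2) d e by (simp add: s_def d'_def)
    then have "s \<in> {-1<..<1}" using gh(1)[OF x(1)] ball[of s] by simp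
    moreover have "x = \<gamma> s" using gh(2)[OF x(1)] by (simp add: \<gamma>_def hx)
    ultimately show "x \<in> \<gamma> ` {-1<..<1}" by blast
  qed
  have conth: "continuous_on U h" using smooth_onD[OF h, of 0] by simp
  have "continuous_on U k"
    unfolding k_def
    by (intro continuous_on_divide continuous_on_inner continuous_on_const conth) (use e in auto)
  then have contk: "continuous_on (\<gamma> ` {-1<..<1}) k"
    by (rule continuous_on_subset) (auto simp: image)
  have "homeomorphism {-1<..<1} (\<gamma> ` {-1<..<1}) \<gamma> k"
    using smooth_onD[OF smooth, of 0] contk k by (auto simp: homeomorphism_def image_image)
  moreover have "vector_derivative \<gamma> (at t) \<noteq> 0" if t: "t \<in> {-1<..<1}" for t
  proof
    assume zero: "vector_derivative \<gamma> (at t) = 0"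
    have "\<gamma> differentiable (at t)"
      using smooth_onD[OF smooth, of 1] t by simp
    then have "(\<gamma> has_vector_derivative 0) (at t)"
      using zero vector_derivative_works by metis
    moreover have "(h has_derivative frechet_derivative h (at (\<gamma> t))) (at (\<gamma> t))"
      by (rule smooth_on_has_derivative[OF h \<gamma>(1)[OF t]])
    ultimately have "((\<lambda>t. h (\<gamma> t)) has_vector_derivative frechet_derivative h (at (\<gamma> t)) 0) (at t)"
      using vector_derivative_diff_chain_within[of \<gamma> 0 t UNIV h]
      by (simp add: o_def has_derivative_at_withinI)
    moreover have "frechet_derivative h (at (\<gamma> t)) 0 = 0"
      by (rule linear_0[OF has_derivative_linear[OF smooth_on_has_derivative[OF h \<gamma>(1)[OF t]]]])
    ultimately have "((\<lambda>t. h (\<gamma> t)) has_vector_derivative 0) (at t)" by simp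
    then have "((\<lambda>t. t *\<^sub>R d') has_vector_derivative 0) (at t)"
      by (rule has_vector_derivative_transform_within_open[of _ _ _ "{-1<..<1}"]) (use t \<gamma> in auto)
    moreover have "((\<lambda>t. t *\<^sub>R d') has_vector_derivative d') (at t)"
      by (auto intro!: derivative_eq_intros)
    ultimately show False using vector_derivative_unique_at nd(2) by blast
  qed
  ultimately show ?thesis
    unfolding regular_curve_through_def image[symmetric]
    using smooth by (intro exI[of _ \<gamma>] exI[of _ k]) (auto simp: \<gamma>_def)
qed

section \<open>One-parameter groups of isometries\<close>

lemma funpow_scaleR_linear:
  fixes F :: "'a::real_vector \<Rightarrow> 'a"
  assumes "linear F"
  shows "((\<lambda>v. t *\<^sub>R F v) ^^ n) y = t ^ n *\<^sub>R (F ^^ n) y"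
  by (induction n) (simp_all add: linear_cmul[OF assms])

lemma exp_endo_scaleR_summable:
  fixes F :: "'e::euclidean_space \<Rightarrow> 'e"
  assumes F: "linear F"
  shows "summable (\<lambda>n. (t ^ n *\<^sub>R (F ^^ n) y) /\<^sub>R fact n)"
proof (rule summable_comparison_test')
  define K where "K = onorm F"
  have bl: "bounded_linear F" using F linear_conv_bounded_linear by blast
  have K: "norm (F v) \<le> K * norm v" for v unfolding K_def by (rule onorm[OF bl])
  have K0: "K \<ge> 0" unfolding K_def by (rule onorm_pos_le[OF bl])
  have Fn: "norm ((F ^^ n) y) \<le> K ^ n * norm y" for n
  proof (induction n)
    case (Suc n)
    have "norm ((F ^^ Suc n) y) \<le> K * norm ((F ^^ n) y)" using K by simp
    also have "\<dots> \<le> K * (K ^ n * norm y)" by (intro mult_left_mono Suc K0)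
    finally show ?case by (simp add: mult_ac)
  qed simp
  show "summable (\<lambda>n. inverse (fact n) * (\<bar>t\<bar> * K) ^ n * norm y)"
    by (intro summable_mult2 summable_exp)
  show "norm ((t ^ n *\<^sub>R (F ^^ n) y) /\<^sub>R fact n) \<le> inverse (fact n) * (\<bar>t\<bar> * K) ^ n * norm y" if "n \<ge> 0" for n
  proof -
    have "norm ((t ^ n *\<^sub>R (F ^^ n) y) /\<^sub>R fact n) = inverse (fact n) * \<bar>t\<bar> ^ n * norm ((F ^^ n) y)"
      by (simp add: power_abs abs_mult)
    also have "\<dots> \<le> inverse (fact n) * \<bar>t\<bar> ^ n * (K ^ n * norm y)"
      by (intro mult_left_mono Fn) simp
    finally show ?thesis by (simp add: power_mult_distrib mult_ac)
  qed
qed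

lemma exp_endo_scaleR:
  assumes "linear F"
  shows "exp_endo (\<lambda>v. t *\<^sub>R F v) y = (\<Sum>n. (t ^ n *\<^sub>R (F ^^ n) y) /\<^sub>R fact n)"
  by (simp add: exp_endo_def funpow_scaleR_linear[OF assms])

lemma exp_endo_zero:
  assumes "linear F"
  shows "exp_endo (\<lambda>v. 0 *\<^sub>R F v) y = y"
proof -
  have "(\<lambda>n. (0 ^ n *\<^sub>R (F ^^ n) y) /\<^sub>R fact n) sums (\<Sum>n\<in>{0}. (0 ^ n *\<^sub>R (F ^^ n) y) /\<^sub>R fact n)"
    by (rule sums_finite) auto
  then have "(\<Sum>n. (0 ^ n *\<^sub>R (F ^^ n) y) /\<^sub>R fact n) = y" by (simp add: sums_iff)
  then show ?thesis by (simp only: exp_endo_scaleR[OF assms])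
qed

lemma linear_exp_endo_scaleR:
  fixes F :: "'e::euclidean_space \<Rightarrow> 'e"
  assumes F: "linear F"
  shows "linear (exp_endo (\<lambda>v. t *\<^sub>R F v))"
proof -
  have lin: "linear (F ^^ n)" for n
  proof (induction n)
    case 0
    show ?case by (simp add: linear_ident)
  next
    case (Suc n)
    show ?case unfolding funpow.simps(2) by (rule linear_compose[OF Suc F])
  qed
  note s = exp_endo_scaleR_summable[OF F]
  show ?thesis
  proof (rule linearI)
    fix x y c
    show "exp_endo (\<lambda>v. t *\<^sub>R F v) (x + y) = exp_endo (\<lambda>v. t *\<^sub>R F v) x + exp_endo (\<lambda>v. t *\<^sub>R F v) y"
      unfolding exp_endo_scaleR[OF F] suminf_add[OF s s]
      by (simp add: linear_add[OF lin] scaleR_add_right)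
    show "exp_endo (\<lambda>v. t *\<^sub>R F v) (c *\<^sub>R x) = c *\<^sub>R exp_endo (\<lambda>v. t *\<^sub>R F v) x"
      unfolding exp_endo_scaleR[OF F] suminf_scaleR_right[OF s]
      by (simp add: linear_cmul[OF lin] mult_ac)
  qed
qed

lemma exp_endo_commutes:
  fixes F :: "'e::euclidean_space \<Rightarrow> 'e"
  assumes F: "linear F"
  shows "F (exp_endo (\<lambda>v. t *\<^sub>R F v) y) = exp_endo (\<lambda>v. t *\<^sub>R F v) (F y)"
proof -
  have bl: "bounded_linear F" using F linear_conv_bounded_linear by blast
  show ?thesis
    unfolding exp_endo_scaleR[OF F] bounded_linear.suminf[OF bl exp_endo_scaleR_summable[OF F]]
    by (simp add: linear_cmul[OF F] funpow_swap1)
qed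

text \<open>Each component is a power series in \<open>t\<close>, which may be differentiated term by term.\<close>

lemma exp_endo_has_vector_derivative:
  fixes F :: "'e::euclidean_space \<Rightarrow> 'e"
  assumes F: "linear F"
  shows "((\<lambda>t. exp_endo (\<lambda>v. t *\<^sub>R F v) y) has_vector_derivative exp_endo (\<lambda>v. t *\<^sub>R F v) (F y)) (at t)"
proof -
  have comp: "inner (exp_endo (\<lambda>v. s *\<^sub>R F v) z) b = (\<Sum>n. inner ((F ^^ n) z) b / fact n * s ^ n)"
    and summ: "summable (\<lambda>n. inner ((F ^^ n) z) b / fact n * s ^ n)" for s z b
  proof -
    have eq: "inner ((s ^ n *\<^sub>R (F ^^ n) z) /\<^sub>R fact n) b = inner ((F ^^ n) z) b / fact n * s ^ n" for n
      by (simp add: field_simps)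
    show "inner (exp_endo (\<lambda>v. s *\<^sub>R F v) z) b = (\<Sum>n. inner ((F ^^ n) z) b / fact n * s ^ n)"
      unfolding exp_endo_scaleR[OF F]
        bounded_linear.suminf[OF bounded_linear_inner_left exp_endo_scaleR_summable[OF F]] eq ..
    show "summable (\<lambda>n. inner ((F ^^ n) z) b / fact n * s ^ n)"
      using bounded_linear.summable[OF bounded_linear_inner_left[of b] exp_endo_scaleR_summable[OF F, of s z]]
      unfolding eq .
  qed
  have "((\<lambda>s. inner (exp_endo (\<lambda>v. s *\<^sub>R F v) y) b) has_field_derivative
          inner (exp_endo (\<lambda>v. t *\<^sub>R F v) (F y)) b) (at t)" for b
  proof -
    have "diffs (\<lambda>n. inner ((F ^^ n) y) b / fact n) = (\<lambda>n. inner ((F ^^ n) (F y)) b / fact n)"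
      by (rule ext) (simp add: diffs_def funpow_swap1 field_simps del: of_nat_Suc)
    then show ?thesis
      using termdiffs_strong_converges_everywhere[OF summ, of y b t] by (simp add: comp)
  qed
  then show ?thesis
    unfolding has_vector_derivative_def has_field_derivative_def
    by (subst has_derivative_componentwise_within) (simp add: mult_commute_abs)
qed

lemma norm_exp_endo_antisymmetric:
  assumes "antisymmetric F"
  shows "norm (exp_endo (\<lambda>v. t *\<^sub>R F v) y) = norm y"
proof -
  have F: "linear F" and anti: "inner (F u) v = - inner u (F v)" for u v
    using assms by (auto simp: antisymmetric_def)
  define E where "E = (\<lambda>t. exp_endo (\<lambda>v. t *\<^sub>R F v) y)"
  have der: "(E has_vector_derivative F (E s)) (at s)" for s
    using exp_endo_has_vector_derivative[OF F] by (simp add: E_def exp_endo_commutes[OF F])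
  have "((\<lambda>s. inner (E s) (E s)) has_vector_derivative inner (E s) (F (E s)) + inner (F (E s)) (E s)) (at s)" for s
    by (rule bounded_bilinear.has_vector_derivative[OF bounded_bilinear_inner der der])
  then have "((\<lambda>s. inner (E s) (E s)) has_real_derivative 0) (at s)" for s
    by (simp add: anti has_real_derivative_iff_has_vector_derivative)
  then have "inner (E t) (E t) = inner (E 0) (E 0)"
    using DERIV_isconst_all[of "\<lambda>s. inner (E s) (E s)"] by blast
  then show ?thesis using exp_endo_zero[OF F, of y] by (simp add: E_def norm_eq_sqrt_inner)
qed

section \<open>Orthogonal families and simultaneous diagonalisation\<close>

text \<open>Simultaneous diagonalisation of a symmetric bilinear form with the inner product. The first basis
  vector \<open>x\<close> maximises \<open>q\<close> on the unit sphere of \<open>S\<close>; the first variation at a maximum vanishes, so that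
  \<open>x\<close> is \<open>q\<close>-orthogonal to its orthogonal complement in \<open>S\<close>, to which induction applies.\<close>

lemma simultaneous_orthonormal_basis:
  fixes q :: "'a::euclidean_space \<Rightarrow> 'a \<Rightarrow> real"
  assumes q: "bilinear q" and sym: "\<And>x y. q x y = q y x" and S: "subspace S"
  obtains B where "B \<subseteq> S" "finite B" "card B = dim S" "span B = S"
    "\<And>x. x \<in> B \<Longrightarrow> norm x = 1" "\<And>x y. x \<in> B \<Longrightarrow> y \<in> B \<Longrightarrow> x \<noteq> y \<Longrightarrow> inner x y = 0 \<and> q x y = 0"
proof -
  have "\<exists>B. B \<subseteq> S \<and> finite B \<and> card B = dim S \<and> span B = S \<and> (\<forall>x\<in>B. norm x = 1) \<and>
      (\<forall>x\<in>B. \<forall>y\<in>B. x \<noteq> y \<longrightarrow> inner x y = 0 \<and> q x y = 0)"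
    using S
  proof (induction "dim S" arbitrary: S)
    case 0
    then have "S = {0}" using subspace_0 by (metis dim_eq_0 subset_singletonD empty_iff)
    then show ?case using 0 by (intro exI[of _ "{}"]) auto
  next
    case (Suc n S)
    have "S \<noteq> {0}" using Suc.hyps(2) by (metis dim_eq_0 nat.distinct(1) order_refl)
    then obtain s where s: "s \<in> S" "s \<noteq> 0" using subspace_0[OF Suc.prems] by blast
    have "s /\<^sub>R norm s \<in> sphere 0 1 \<inter> S" using s subspace_scale[OF Suc.prems] by simp
    then have ne: "sphere 0 1 \<inter> S \<noteq> {}" by blast
    have comp: "compact (sphere 0 1 \<inter> S)"
      by (intro compact_Int_closed compact_sphere closed_subspace Suc.prems)
    have "continuous_on (sphere 0 1 \<inter> S) (\<lambda>x. q x x)"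
      using q by (intro bounded_bilinear.continuous_on[where prod=q] continuous_on_id)
        (simp add: bilinear_conv_bounded_bilinear)
    from continuous_attains_sup[OF comp ne this] obtain x
      where x: "norm x = 1" "x \<in> S" and max: "\<And>y. norm y = 1 \<Longrightarrow> y \<in> S \<Longrightarrow> q y y \<le> q x x" by auto
    have max': "q z z \<le> q x x * (norm z)\<^sup>2" if "z \<in> S" for z
    proof (cases "z = 0")
      case False
      have "q (z /\<^sub>R norm z) (z /\<^sub>R norm z) \<le> q x x"
        using False that subspace_scale[OF Suc.prems] by (intro max) auto
      then show ?thesis using False
        by (simp add: bilinear_lmul[OF q] bilinear_rmul[OF q] power2_eq_square field_simps)
    qed (simp add: bilinear_lzero[OF q])
    have orth: "q x y = 0" if y: "y \<in> S" "inner x y = 0" for y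
    proof -
      define a where "a = q x y"
      define c where "c = q x x * (norm y)\<^sup>2 - q y y"
      have c: "c \<ge> 0" using max'[OF y(1)] by (simp add: c_def)
      \<comment> \<open>A small enough multiple of \<open>y\<close>: adding it to \<open>x\<close> would increase \<open>q\<close> unless \<open>a = 0\<close>.\<close>
      define t where "t = a / (c + 1)"
      have "(norm (x + t *\<^sub>R y))\<^sup>2 = 1 + t\<^sup>2 * (norm y)\<^sup>2"
        using y(2) x(1) unfolding power2_norm_eq_inner norm_eq_1
        by (simp add: inner_add_left inner_add_right inner_commute[of y x] power2_eq_square)
      moreover have "q (x + t *\<^sub>R y) (x + t *\<^sub>R y) = q x x + 2 * t * a + t\<^sup>2 * q y y"
        using sym[of y x]
        by (simp add: bilinear_ladd[OF q] bilinear_radd[OF q] bilinear_lmul[OF q]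
            bilinear_rmul[OF q] a_def power2_eq_square algebra_simps)
      moreover have "x + t *\<^sub>R y \<in> S"
        using x y by (intro subspace_add subspace_scale Suc.prems)
      ultimately have "2 * t * a \<le> t\<^sup>2 * c" using max'[of "x + t *\<^sub>R y"] by (simp add: c_def algebra_simps)
      moreover have ta: "a = t * (c + 1)" using c by (simp add: t_def)
      ultimately have "2 * t\<^sup>2 * (c + 1) \<le> t\<^sup>2 * c" by (simp add: power2_eq_square mult_ac)
      then have "t\<^sup>2 * (c + 2) \<le> 0" by (simp add: algebra_simps)
      then have "t = 0" using c by (simp add: mult_le_0_iff)
      then show ?thesis using ta a_def by simp
    qed
    define T where "T = {y \<in> S. \<forall>z\<in>span {x}. orthogonal z y}"
    have sT: "subspace T"
      unfolding T_def subspace_def using Suc.prems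
      by (auto simp: subspace_0 subspace_add subspace_scale orthogonal_def inner_add_right)
    have T: "y \<in> T \<longleftrightarrow> y \<in> S \<and> inner x y = 0" for y
      by (auto simp: T_def span_singleton orthogonal_def)
    have "dim T + dim (span {x}) = dim S"
      unfolding T_def
      by (rule dim_subspace_orthogonal_to_vectors)
        (use x Suc.prems in \<open>auto simp: span_minimal\<close>)
    moreover have "x \<noteq> 0" using x by auto
    ultimately have "n = dim T" using Suc.hyps(2) by (simp add: dim_singleton)
    from Suc.hyps(1)[OF this sT] obtain B where B: "B \<subseteq> T" "finite B" "card B = dim T" "span B = T"
      "\<forall>x\<in>B. norm x = 1" "\<forall>x\<in>B. \<forall>y\<in>B. x \<noteq> y \<longrightarrow> inner x y = 0 \<and> q x y = 0" by blast
    have "x \<notin> T" using x by (simp add: T norm_eq_1)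
    have "span (insert x B) = S"
    proof
      show "span (insert x B) \<subseteq> S" using x B T by (intro span_minimal Suc.prems) auto
      show "S \<subseteq> span (insert x B)"
      proof
        fix y assume "y \<in> S"
        then have "y - inner x y *\<^sub>R x \<in> T"
          using x Suc.prems by (simp add: T subspace_diff subspace_scale inner_diff_right norm_eq_1)
        then have "y - inner x y *\<^sub>R x \<in> span (insert x B)" using B(4) span_mono[of B "insert x B"] by auto
        from span_add[OF this span_scale[OF span_base[of x "insert x B"], of "inner x y"]]
        show "y \<in> span (insert x B)" by simp
      qed
    qed
    moreover have "card (insert x B) = dim S"
      using B \<open>x \<notin> T\<close> \<open>n = dim T\<close> Suc.hyps(2) by (subst card_insert_disjoint) auto
    ultimately show ?case
      using B x T orth sym by (intro exI[of _ "insert x B"]) (auto simp: inner_commute subset_iff)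
  qed
  then show ?thesis using that by blast
qed

lemma orthogonal_family_card_le:
  fixes f :: "'i::finite \<Rightarrow> 'a::euclidean_space"
  assumes "\<And>i. f i \<noteq> 0" "\<And>i j. i \<noteq> j \<Longrightarrow> inner (f i) (f j) = 0"
  shows "CARD('i) \<le> DIM('a)"
proof -
  have inj: "inj f"
    by (rule injI) (metis assms inner_eq_zero_iff)
  have "pairwise orthogonal (range f)"
    by (auto simp: pairwise_def orthogonal_def intro!: assms(2))
  moreover have "0 \<notin> range f" using assms(1) by (metis imageE)
  ultimately have "independent (range f)" by (rule pairwise_orthogonal_independent)
  then show ?thesis using independent_card_le card_image[OF inj] by metis
qed

lemma orthonormal_expansion:
  fixes f :: "'i::finite \<Rightarrow> 'a::euclidean_space"
  assumes f: "\<And>i j. inner (f i) (f j) = of_bool (i = j)" and card: "CARD('i) = DIM('a)"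
  shows "y = (\<Sum>i\<in>UNIV. inner (f i) y *\<^sub>R f i)"
proof (rule ccontr)
  define d where "d = y - (\<Sum>i\<in>UNIV. inner (f i) y *\<^sub>R f i)"
  assume "\<not> ?thesis"
  then have d0: "d \<noteq> 0" by (simp add: d_def)
  have d: "inner (f i) d = 0" for i
    by (simp add: d_def inner_diff_right inner_sum_right f)
  then have d': "inner d (f i) = 0" for i by (simp add: inner_commute)
  define g where "g = case_option d f"
  have f0: "f i \<noteq> 0" for i using f[of i i] by auto
  have "CARD('i option) \<le> DIM('a)"
  proof (rule orthogonal_family_card_le[of g])
    show "g i \<noteq> 0" for i by (cases i) (simp_all add: g_def d0 f0)
    show "inner (g i) (g j) = 0" if "i \<noteq> j" for i j
      using that by (cases i; cases j) (simp_all add: g_def d d' f)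
  qed
  then show False using card by (simp add: card_UNIV_option)
qed

section \<open>Bilinear forms on dispositions\<close>

text \<open>The bilinear form that the squared distances \<open>s\<close> induce on dispositions. For an actual
  configuration it is the Gram form of the configuration map (\<open>config_inner\<close>), that is, the form of the
  inertia endomorphism.\<close>

definition dist_form :: "(4 \<Rightarrow> 4 \<Rightarrow> real) \<Rightarrow> real ^ 4 \<Rightarrow> real ^ 4 \<Rightarrow> real" where
  "dist_form s \<xi> \<eta> = - (\<Sum>i\<in>UNIV. \<Sum>j\<in>UNIV. s i j * (\<xi> $ i * \<eta> $ j)) / 2"

text \<open>The bilinear form of the Wintner--Conley endomorphism with arbitrary coefficients \<open>w i j\<close> in place
  of \<open>\<Phi>'(s\<^bsub>ij\<^esub>)\<close>. The sum runs over ordered pairs and is halved; the diagonal coefficients do not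
  matter.\<close>

definition interaction_form :: "real ^ 4 \<Rightarrow> (4 \<Rightarrow> 4 \<Rightarrow> real) \<Rightarrow> real ^ 4 \<Rightarrow> real ^ 4 \<Rightarrow> real" where
  "interaction_form m w \<xi> \<eta> = (\<Sum>i\<in>UNIV. \<Sum>j\<in>UNIV. w i j *
     (m $ i * m $ j * ((\<xi> $ i / m $ i - \<xi> $ j / m $ j) * (\<eta> $ i / m $ i - \<eta> $ j / m $ j)))) / 2"

text \<open>A basis of the space of dispositions which is orthonormal for the mass inner product.\<close>

definition mass_frame :: "real ^ 4 \<Rightarrow> (3 \<Rightarrow> real ^ 4) \<Rightarrow> bool" where
  "mass_frame m v \<longleftrightarrow> (\<forall>i. v i \<in> dispositions) \<and>
     (\<forall>i j. mass_inner m (v i) (v j) = of_bool (i = j))"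

lemma bilinear_mass_inner: "bilinear (mass_inner m)"
  unfolding bilinear_def mass_inner_def
  by (auto intro!: linearI simp: algebra_simps add_divide_distrib sum.distrib sum_distrib_left)

lemma bilinear_dist_form: "bilinear (dist_form s)"
  unfolding bilinear_def dist_form_def
  by (auto intro!: linearI simp: algebra_simps add_divide_distrib sum.distrib sum_distrib_left)

lemma mass_inner_commute: "mass_inner m \<xi> \<eta> = mass_inner m \<eta> \<xi>"
  by (simp add: mass_inner_def mult.commute)

lemma interaction_form_commute: "interaction_form m w \<xi> \<eta> = interaction_form m w \<eta> \<xi>"
  by (simp add: interaction_form_def mult_ac)

lemma subspace_dispositions: "subspace dispositions"
  by (auto simp: subspace_def dispositions_def sum.distrib sum_distrib_left[symmetric])

lemma mass_inner_eqI:
  assumes m: "\<And>i. m $ i > 0" and "\<xi> \<in> dispositions" "\<xi>' \<in> dispositions"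
    and eq: "\<And>\<eta>. \<eta> \<in> dispositions \<Longrightarrow> mass_inner m \<xi> \<eta> = mass_inner m \<xi>' \<eta>"
  shows "\<xi> = \<xi>'"
proof -
  define d where "d = \<xi> - \<xi>'"
  have "d \<in> dispositions" using assms subspace_diff[OF subspace_dispositions] by (simp add: d_def)
  then have "mass_inner m d d = 0"
    using eq by (simp add: d_def bilinear_lsub[OF bilinear_mass_inner])
  then have "\<forall>i\<in>UNIV. d $ i * d $ i / m $ i = 0"
    unfolding mass_inner_def using m by (subst (asm) sum_nonneg_eq_0_iff) (auto simp: less_imp_le)
  then have "d = 0" using m by (auto simp: vec_eq_iff less_imp_neq[symmetric])
  then show ?thesis by (simp add: d_def)
qed

text \<open>After division of the coordinates by the square roots of the masses, the mass inner product becomes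
  the standard one, and the frame is completed to an orthonormal basis by the normalised vector of
  these roots, which is orthogonal to all dispositions.\<close>

lemma mass_frame_expansion:
  assumes m: "\<And>i. m $ i > 0" and v: "mass_frame m v" and \<xi>: "\<xi> \<in> dispositions"
  shows "\<xi> = (\<Sum>i\<in>UNIV. mass_inner m \<xi> (v i) *\<^sub>R v i)"
proof -
  define M where "M = (\<Sum>i\<in>UNIV. m $ i)"
  have M: "M > 0" unfolding M_def by (rule sum_pos) (auto simp: m)
  define sc where "sc = (\<lambda>x::real^4. \<chi> k. x $ k / sqrt (m $ k))"
  define \<mu> where "\<mu> = (\<chi> k. sqrt (m $ k) / sqrt M)"
  have m0: "m $ k \<noteq> 0" "sqrt (m $ k) * sqrt (m $ k) = m $ k" for k using m[of k] by auto
  have sc: "inner (sc x) (sc y) = mass_inner m x y" for x y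
    by (simp add: sc_def mass_inner_def inner_vec_def m0 abs_of_pos[OF m])
  have mu_sc: "inner \<mu> (sc x) = 0" if "x \<in> dispositions" for x
  proof -
    have "inner \<mu> (sc x) = (\<Sum>k\<in>UNIV. x $ k / sqrt M)"
      by (simp add: \<mu>_def sc_def inner_vec_def m0)
    then show ?thesis using that by (simp add: dispositions_def sum_divide_distrib[symmetric])
  qed
  then have mu_sc': "inner (sc x) \<mu> = 0" if "x \<in> dispositions" for x
    using that by (simp add: inner_commute)
  have mu: "inner \<mu> \<mu> = 1"
  proof -
    have "inner \<mu> \<mu> = (\<Sum>k\<in>UNIV. m $ k / M)"
      using M by (simp add: \<mu>_def inner_vec_def m0 abs_of_pos[OF m])
    then show ?thesis using M by (simp add: M_def sum_divide_distrib[symmetric])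
  qed
  define f where "f = case_option \<mu> (\<lambda>i. sc (v i))"
  have "inner (f i) (f j) = of_bool (i = j)" for i j
    using v by (cases i; cases j)
      (simp_all add: f_def mass_frame_def sc mu mu_sc mu_sc')
  then have "sc \<xi> = (\<Sum>i\<in>UNIV. inner (f i) (sc \<xi>) *\<^sub>R f i)"
    by (rule orthonormal_expansion) (simp add: card_UNIV_option)
  also have "\<dots> = (\<Sum>i\<in>UNIV. mass_inner m (v i) \<xi> *\<^sub>R sc (v i))"
    by (simp add: UNIV_option_conv sum.reindex f_def mu_sc[OF \<xi>] sc)
  finally have "sc \<xi> $ k = (\<Sum>i\<in>UNIV. mass_inner m (v i) \<xi> *\<^sub>R sc (v i)) $ k" for k by simp
  then have "\<xi> $ k / sqrt (m $ k) = (\<Sum>i\<in>UNIV. mass_inner m (v i) \<xi> * v i $ k) / sqrt (m $ k)" for k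
    by (simp add: sc_def sum_divide_distrib)
  then show ?thesis using m0
    by (simp add: vec_eq_iff mass_inner_commute[of m \<xi>])
qed

lemma bilinear_eq_zero_on_frame:
  fixes b :: "real ^ 4 \<Rightarrow> real ^ 4 \<Rightarrow> real"
  assumes m: "\<And>i. m $ i > 0" and v: "mass_frame m v" and b: "bilinear b"
    and D: "\<xi> \<in> dispositions" "\<eta> \<in> dispositions" and z: "\<And>i j. b (v i) (v j) = 0"
  shows "b \<xi> \<eta> = 0"
proof -
  have "b \<xi> \<eta> = b (\<Sum>i\<in>UNIV. mass_inner m \<xi> (v i) *\<^sub>R v i) (\<Sum>i\<in>UNIV. mass_inner m \<eta> (v i) *\<^sub>R v i)"
    by (rule arg_cong2[where f=b,
          OF mass_frame_expansion[OF m v D(1)] mass_frame_expansion[OF m v D(2)]])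
  also have "\<dots> = 0"
    by (subst bilinear_sum[OF b]) (simp add: split_def bilinear_lmul[OF b] bilinear_rmul[OF b] z)
  finally show ?thesis .
qed

lemma interaction_form_cong:
  assumes "\<And>i j. i \<noteq> j \<Longrightarrow> w i j = w' i j"
  shows "interaction_form m w \<xi> \<eta> = interaction_form m w' \<xi> \<eta>"
proof -
  have "w i j * (m $ i * m $ j * ((\<xi> $ i / m $ i - \<xi> $ j / m $ j) * (\<eta> $ i / m $ i - \<eta> $ j / m $ j))) =
        w' i j * (m $ i * m $ j * ((\<xi> $ i / m $ i - \<xi> $ j / m $ j) * (\<eta> $ i / m $ i - \<eta> $ j / m $ j)))" for i j
    using assms[of i j] by (cases "i = j") auto
  then show ?thesis by (simp only: interaction_form_def)
qed

lemma interaction_form_cmult: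
  "interaction_form m (\<lambda>i j. c * w i j) \<xi> \<eta> = c * interaction_form m w \<xi> \<eta>"
  by (simp add: interaction_form_def sum_distrib_left mult.assoc)

lemma interaction_form_diff:
  "interaction_form m (\<lambda>i j. w i j - w' i j) \<xi> \<eta> = interaction_form m w \<xi> \<eta> - interaction_form m w' \<xi> \<eta>"
  by (simp add: interaction_form_def left_diff_distrib sum_subtractf diff_divide_distrib)

text \<open>With equal coefficients the Wintner--Conley endomorphism is a multiple of the identity.\<close>

lemma interaction_form_const:
  assumes m: "\<And>i. m $ i > 0" and D: "\<xi> \<in> dispositions" "\<eta> \<in> dispositions"
  shows "interaction_form m (\<lambda>i j. c) \<xi> \<eta> = c * (\<Sum>i\<in>UNIV. m $ i) * mass_inner m \<xi> \<eta>"
proof -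
  define M where "M = (\<Sum>i\<in>UNIV. m $ i)"
  define p where "p i = \<xi> $ i * \<eta> $ i / m $ i" for i
  have m0: "m $ i \<noteq> 0" for i using m[of i] by auto
  have *: "c * (m $ i * m $ j * ((\<xi> $ i / m $ i - \<xi> $ j / m $ j) * (\<eta> $ i / m $ i - \<eta> $ j / m $ j))) =
      c * (p i * m $ j) + c * (m $ i * p j) - c * (\<xi> $ i * \<eta> $ j) - c * (\<eta> $ i * \<xi> $ j)" for i j
    using m0 by (simp add: p_def field_simps)
  have z: "(\<Sum>i\<in>UNIV. \<xi> $ i) = 0" "(\<Sum>i\<in>UNIV. \<eta> $ i) = 0" using D by (auto simp: dispositions_def)
  have "interaction_form m (\<lambda>i j. c) \<xi> \<eta> = (c * ((\<Sum>i\<in>UNIV. p i) * M) + c * (M * (\<Sum>i\<in>UNIV. p i))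
      - c * ((\<Sum>i\<in>UNIV. \<xi> $ i) * (\<Sum>i\<in>UNIV. \<eta> $ i)) - c * ((\<Sum>i\<in>UNIV. \<eta> $ i) * (\<Sum>i\<in>UNIV. \<xi> $ i))) / 2"
    unfolding interaction_form_def * M_def sum_product
    by (simp add: sum.distrib sum_subtractf sum_distrib_left)
  then show ?thesis by (simp add: z M_def p_def mass_inner_def)
qed

lemma bilinear_interaction_form: "bilinear (interaction_form m w)"
proof -
  have add: "w * (c * (((x + x') - (y + y')) * d)) = w * (c * ((x - y) * d)) + w * (c * ((x' - y') * d))"
    and scale: "w * (c * ((e * x - e * y) * d)) = e * (w * (c * ((x - y) * d)))" for w c x x' y y' d e :: real
    by (simp_all add: algebra_simps)
  have lin: "linear (\<lambda>\<xi>. interaction_form m w \<xi> \<eta>)" for \<eta>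
    by (rule linearI)
      (simp_all only: interaction_form_def vector_add_component add_divide_distrib add sum.distrib
        vector_scaleR_component real_scaleR_def times_divide_eq_right[symmetric] scale sum_distrib_left[symmetric])
  then show ?thesis
    unfolding bilinear_def by (simp add: interaction_form_commute[of m w _ "_ :: real ^ 4"])
qed

text \<open>The coefficients are determined by the form. The form does not change when multiples of \<open>m\<close>
  are added to its arguments, hence it vanishes on all vectors, and on two standard basis vectors it is
  minus their coefficient.\<close>

lemma interaction_form_zero_imp:
  assumes m: "\<And>i. m $ i > 0" and sym: "\<And>i j. w i j = w j i"
    and z: "\<And>\<xi> \<eta>. \<xi> \<in> dispositions \<Longrightarrow> \<eta> \<in> dispositions \<Longrightarrow> interaction_form m w \<xi> \<eta> = 0"
    and pq: "p \<noteq> q"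
  shows "w p q = 0"
proof -
  define M where "M = (\<Sum>i\<in>UNIV. m $ i)"
  have M: "M > 0" unfolding M_def by (rule sum_pos) (auto simp: m)
  have m0: "m $ i \<noteq> 0" for i using m[of i] by auto
  have inv: "interaction_form m w (\<xi> - c *\<^sub>R m) (\<eta> - d *\<^sub>R m) = interaction_form m w \<xi> \<eta>" for \<xi> \<eta> c d
    using m0 by (simp add: interaction_form_def diff_divide_distrib)
  have proj: "axis p 1 - (1 / M) *\<^sub>R m \<in> dispositions" for p
    using M by (simp add: dispositions_def sum_subtractf sum_divide_distrib[symmetric] M_def[symmetric] axis_def)
  have *: "w k l * (m $ k * m $ l * ((axis p 1 $ k / m $ k - axis p 1 $ l / m $ l) * (axis q 1 $ k / m $ k - axis q 1 $ l / m $ l))) =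
     (if l = q then if k = p then - w p q else 0 else 0) + (if l = p then if k = q then - w q p else 0 else 0)" for k l
    using pq m0 by (auto simp: axis_def)
  have "interaction_form m w (axis p 1) (axis q 1) = (- w p q - w q p) / 2"
    unfolding interaction_form_def * by (simp add: sum.distrib)
  moreover have "interaction_form m w (axis p 1) (axis q 1) = 0"
    using z[OF proj proj] unfolding inv .
  ultimately show ?thesis using sym[of q p] by simp
qed

section \<open>Balanced configurations in an adapted frame\<close>

lemma config_inner:
  fixes r :: "'e::euclidean_space ^ 4"
  assumes "\<xi> \<in> dispositions" "\<eta> \<in> dispositions"
  shows "inner (config_map r \<xi>) (config_map r \<eta>) = dist_form (sq_dist r) \<xi> \<eta>"
proof -
  have s: "sq_dist r i j = inner (r $ i) (r $ i) + inner (r $ j) (r $ j) - 2 * inner (r $ i) (r $ j)" for i j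
    by (simp add: sq_dist_def dist_norm power2_norm_eq_inner inner_diff_left inner_diff_right inner_commute)
  define a where "a = (\<lambda>i. inner (r $ i) (r $ i))"
  have "(\<Sum>i\<in>UNIV. \<Sum>j\<in>UNIV. sq_dist r i j * (\<xi> $ i * \<eta> $ j)) =
     (\<Sum>i\<in>UNIV. \<Sum>j\<in>UNIV. (a i * \<xi> $ i) * \<eta> $ j) + (\<Sum>i\<in>UNIV. \<Sum>j\<in>UNIV. \<xi> $ i * (a j * \<eta> $ j))
      - 2 * (\<Sum>i\<in>UNIV. \<Sum>j\<in>UNIV. inner (r $ i) (r $ j) * (\<xi> $ i * \<eta> $ j))"
    by (simp add: s a_def algebra_simps sum.distrib sum_subtractf sum_distrib_left)
  also have "(\<Sum>i\<in>UNIV. \<Sum>j\<in>UNIV. (a i * \<xi> $ i) * \<eta> $ j) = 0"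
    using assms(2) by (simp add: sum_product[symmetric] dispositions_def)
  also have "(\<Sum>i\<in>UNIV. \<Sum>j\<in>UNIV. \<xi> $ i * (a j * \<eta> $ j)) = 0"
    using assms(1) by (simp add: sum_product[symmetric] dispositions_def)
  also have "(\<Sum>i\<in>UNIV. \<Sum>j\<in>UNIV. inner (r $ i) (r $ j) * (\<xi> $ i * \<eta> $ j)) =
      inner (config_map r \<xi>) (config_map r \<eta>)"
    unfolding config_map_def inner_sum_left inner_sum_right
    by (subst sum.swap) (simp add: mult_ac inner_commute)
  finally show ?thesis by (simp add: dist_form_def)
qed

lemma linear_config_map: "linear (config_map r)"
  unfolding config_map_def
  by (rule linearI) (auto simp: algebra_simps sum.distrib scaleR_sum_right)

lemma config_map_linear_image:
  assumes "linear f"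
  shows "config_map (\<chi> i. f (r $ i)) \<xi> = f (config_map r \<xi>)"
  by (simp add: config_map_def linear_sum[OF assms] linear_cmul[OF assms])

text \<open>Stated for an arbitrary linear order, so that it does not matter how the indices are ordered.\<close>

lemma sum_less_pairs:
  fixes f :: "'i::{finite,linorder} \<Rightarrow> 'i \<Rightarrow> real"
  assumes sym: "\<And>i j. f i j = f j i" and diag: "\<And>i. f i i = 0"
  shows "(\<Sum>(i, j)\<in>{(i, j). i < j}. f i j) = (\<Sum>i\<in>UNIV. \<Sum>j\<in>UNIV. f i j) / 2"
proof -
  let ?L = "{(i::'i, j::'i). i < j}" and ?G = "{(i::'i, j::'i). j < i}" and ?E = "{(i::'i, j::'i). i = j}"
  have "(\<Sum>i\<in>UNIV. \<Sum>j\<in>UNIV. f i j) = (\<Sum>(i, j)\<in>UNIV. f i j)"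
    by (simp add: sum.cartesian_product)
  also have "UNIV = ?L \<union> (?G \<union> ?E)" by auto
  also have "(\<Sum>(i, j)\<in>?L \<union> (?G \<union> ?E). f i j) = (\<Sum>(i, j)\<in>?L. f i j) + (\<Sum>(i, j)\<in>?G \<union> ?E. f i j)"
    by (rule sum.union_disjoint) auto
  also have "(\<Sum>(i, j)\<in>?G \<union> ?E. f i j) = (\<Sum>(i, j)\<in>?G. f i j) + (\<Sum>(i, j)\<in>?E. f i j)"
    by (rule sum.union_disjoint) auto
  also have "(\<Sum>(i, j)\<in>?E. f i j) = 0"
    by (rule sum.neutral) (auto simp: diag)
  also have "(\<Sum>(i, j)\<in>?G. f i j) = (\<Sum>(i, j)\<in>?L. f i j)"
    by (rule sum.reindex_bij_witness[where i=prod.swap and j=prod.swap]) (auto simp: sym)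
  finally show ?thesis by simp
qed

lemma linear_wintner_conley: "linear (wintner_conley G m r)"
proof -
  have "linear (\<lambda>\<xi>::real^4. (c * (m $ j * \<xi> $ i - m $ i * \<xi> $ j)) *\<^sub>R (axis i 1 - axis j 1))" for c i j
    by (rule linearI) (simp_all add: vec_eq_iff algebra_simps)
  then have "linear (\<lambda>\<xi>. wintner_conley G m r \<xi>)"
    unfolding wintner_conley_def split_def by (intro linear_compose_sum) blast
  then show ?thesis .
qed

lemma wintner_conley_in_dispositions: "wintner_conley G m r \<xi> \<in> dispositions"
proof -
  have "axis i 1 - axis j 1 \<in> dispositions" for i j
    by (simp add: dispositions_def sum_subtractf axis_def)
  then show ?thesis
    unfolding wintner_conley_def split_def
    by (intro subspace_sum subspace_scale subspace_dispositions)
qed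

lemma mass_inner_wintner_conley:
  assumes m: "\<And>i. m $ i > 0"
  shows "mass_inner m (wintner_conley G m r \<xi>) \<eta> =
    interaction_form m (\<lambda>i j. deriv (potential G) (sq_dist r i j)) \<xi> \<eta>"
proof -
  define w where "w = (\<lambda>i j. deriv (potential G) (sq_dist r i j))"
  define f where "f = (\<lambda>i j. w i j *
     (m $ i * m $ j * ((\<xi> $ i / m $ i - \<xi> $ j / m $ j) * (\<eta> $ i / m $ i - \<eta> $ j / m $ j))))"
  have m0: "m $ k \<noteq> 0" for k using m[of k] by auto
  have wsym: "w i j = w j i" for i j by (simp add: w_def sq_dist_def dist_commute)
  have ax: "mass_inner m (axis i 1 - axis j 1) \<eta> = \<eta> $ i / m $ i - \<eta> $ j / m $ j" for i j
    by (simp add: bilinear_lsub[OF bilinear_mass_inner])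
      (simp add: mass_inner_def axis_def if_distrib[of "\<lambda>x. x * _"] if_distrib[of "\<lambda>x. x / _"] cong: if_cong)
  have lin: "linear (\<lambda>x. mass_inner m x \<eta>)"
    using bilinear_mass_inner by (simp add: bilinear_def)
  have "mass_inner m (wintner_conley G m r \<xi>) \<eta> = (\<Sum>(i, j)\<in>{(i, j). i < j}.
      mass_inner m ((w i j * (m $ j * \<xi> $ i - m $ i * \<xi> $ j)) *\<^sub>R (axis i 1 - axis j 1)) \<eta>)"
    by (simp add: wintner_conley_def w_def split_def linear_sum[OF lin])
  also have "\<dots> = (\<Sum>(i, j)\<in>{(i, j). i < j}. f i j)"
  proof (intro sum.cong refl, clarify)
    fix i j :: 4
    have "m $ j * \<xi> $ i - m $ i * \<xi> $ j = m $ i * m $ j * (\<xi> $ i / m $ i - \<xi> $ j / m $ j)"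
      using m0 by (simp add: field_simps)
    then show "mass_inner m ((w i j * (m $ j * \<xi> $ i - m $ i * \<xi> $ j)) *\<^sub>R (axis i 1 - axis j 1)) \<eta> = f i j"
      by (simp add: bilinear_lmul[OF bilinear_mass_inner] ax f_def mult_ac)
  qed
  also have "\<dots> = (\<Sum>i\<in>UNIV. \<Sum>j\<in>UNIV. f i j) / 2"
    by (rule sum_less_pairs) (auto simp: f_def wsym algebra_simps)
  finally show ?thesis by (simp add: interaction_form_def f_def w_def)
qed

text \<open>The commutation of \<open>A\<close> and \<open>B\<close>, tested against dispositions, says that \<open>A\<close> is symmetric for the
  Gram form; this removes \<open>B\<close> from the condition.\<close>

lemma balanced_iff_dist_form:
  fixes r :: "'e::euclidean_space ^ 4"
  assumes m: "\<And>i. m $ i > 0"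
  shows "balanced G m r \<longleftrightarrow> (\<forall>\<xi>\<in>dispositions. \<forall>\<eta>\<in>dispositions.
     dist_form (sq_dist r) (wintner_conley G m r \<xi>) \<eta> = dist_form (sq_dist r) \<xi> (wintner_conley G m r \<eta>))"
proof -
  let ?A = "wintner_conley G m r"
  note A = wintner_conley_in_dispositions
  have "(\<forall>\<xi>\<in>dispositions. ?A (B \<xi>) = B (?A \<xi>)) \<longleftrightarrow> (\<forall>\<xi>\<in>dispositions. \<forall>\<eta>\<in>dispositions.
     dist_form (sq_dist r) (?A \<xi>) \<eta> = dist_form (sq_dist r) \<xi> (?A \<eta>))" if B: "is_inertia_endo m r B" for B
  proof -
    have BD: "B \<xi> \<in> dispositions" if "\<xi> \<in> dispositions" for \<xi>
      using B that by (auto simp: is_inertia_endo_def symmetric_endo_def)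
    have Bf: "mass_inner m (B \<xi>) \<eta> = dist_form (sq_dist r) \<xi> \<eta>"
      if "\<xi> \<in> dispositions" "\<eta> \<in> dispositions" for \<xi> \<eta>
      using B that by (simp add: is_inertia_endo_def config_inner)
    have 1: "mass_inner m (?A (B \<xi>)) \<eta> = dist_form (sq_dist r) \<xi> (?A \<eta>)"
      if "\<xi> \<in> dispositions" "\<eta> \<in> dispositions" for \<xi> \<eta>
    proof -
      have "mass_inner m (?A (B \<xi>)) \<eta> = mass_inner m (B \<xi>) (?A \<eta>)"
        by (metis mass_inner_wintner_conley[OF m] interaction_form_commute mass_inner_commute)
      then show ?thesis using Bf[OF that(1) A] by simp
    qed
    have 2: "mass_inner m (B (?A \<xi>)) \<eta> = dist_form (sq_dist r) (?A \<xi>) \<eta>"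
      if "\<eta> \<in> dispositions" for \<xi> \<eta>
      using Bf[OF A that] .
    show ?thesis
    proof (intro ball_cong refl)
      fix \<xi> :: "real ^ 4" assume \<xi>: "\<xi> \<in> dispositions"
      show "?A (B \<xi>) = B (?A \<xi>) \<longleftrightarrow> (\<forall>\<eta>\<in>dispositions.
         dist_form (sq_dist r) (?A \<xi>) \<eta> = dist_form (sq_dist r) \<xi> (?A \<eta>))"
        using 1[OF \<xi>] 2[of _ \<xi>] mass_inner_eqI[OF m A BD[OF A]] by metis
    qed
  qed
  then show ?thesis
    unfolding balanced_def using inertia_endo_exists[OF m, of r] by blast
qed

lemma wintner_conley_frame:
  assumes m: "\<And>i. m $ i > 0" and v: "mass_frame m v"
  shows "wintner_conley G m r (v i) = (\<Sum>k\<in>UNIV. mass_inner m (wintner_conley G m r (v i)) (v k) *\<^sub>R v k)"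
  by (rule mass_frame_expansion[OF m v wintner_conley_in_dispositions])

lemma dist_form_commute:
  assumes "\<And>i j. s i j = s j i"
  shows "dist_form s \<xi> \<eta> = dist_form s \<eta> \<xi>"
  unfolding dist_form_def by (subst sum.swap) (simp add: assms mult_ac)

lemma sq_dist_commute: "sq_dist r i j = sq_dist r j i"
  by (simp add: sq_dist_def dist_commute)

lemma dist_form_frame_diagonal:
  assumes m: "\<And>i. m $ i > 0" and v: "mass_frame m v" and D: "\<xi> \<in> dispositions" "\<eta> \<in> dispositions"
    and orth: "\<And>i j. i \<noteq> j \<Longrightarrow> dist_form s (v i) (v j) = 0"
  shows "dist_form s \<xi> \<eta> = (\<Sum>i\<in>UNIV. mass_inner m \<xi> (v i) * mass_inner m \<eta> (v i) * dist_form s (v i) (v i))"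
proof -
  let ?x = "\<lambda>i. mass_inner m \<xi> (v i)" and ?y = "\<lambda>i. mass_inner m \<eta> (v i)"
  have "dist_form s \<xi> \<eta> = dist_form s (\<Sum>i\<in>UNIV. ?x i *\<^sub>R v i) (\<Sum>i\<in>UNIV. ?y i *\<^sub>R v i)"
    by (rule arg_cong2[where f="dist_form s",
          OF mass_frame_expansion[OF m v D(1)] mass_frame_expansion[OF m v D(2)]])
  also have "\<dots> = (\<Sum>i\<in>UNIV. \<Sum>j\<in>UNIV. ?x i * (?y j * dist_form s (v i) (v j)))"
    by (subst bilinear_sum[OF bilinear_dist_form])
      (simp add: sum.cartesian_product split_def bilinear_lmul[OF bilinear_dist_form] bilinear_rmul[OF bilinear_dist_form] mult_ac)
  also have "\<dots> = (\<Sum>i\<in>UNIV. \<Sum>j\<in>UNIV. if j = i then ?x i * (?y i * dist_form s (v i) (v i)) else 0)"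
    by (intro sum.cong refl) (use orth in auto)
  finally show ?thesis by (simp add: mult_ac)
qed

text \<open>If \<open>\<kappa> i\<close> are the eigenvalues of \<open>B\<close> and \<open>a i j\<close> the entries of \<open>A\<close> in the frame, the entries of the
  commutator are \<open>a i j * (\<kappa> j - \<kappa> i)\<close> up to sign.\<close>

lemma balanced_iff_frame:
  fixes r :: "'e::euclidean_space ^ 4"
  assumes m: "\<And>i. m $ i > 0" and v: "mass_frame m v"
    and orth: "\<And>i j. i \<noteq> j \<Longrightarrow> dist_form (sq_dist r) (v i) (v j) = 0"
    and simple: "\<And>i j. i \<noteq> j \<Longrightarrow> dist_form (sq_dist r) (v i) (v i) \<noteq> dist_form (sq_dist r) (v j) (v j)"
  shows "balanced G m r \<longleftrightarrow> (\<forall>i j. i \<noteq> j \<longrightarrow> mass_inner m (wintner_conley G m r (v i)) (v j) = 0)"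
proof -
  let ?A = "wintner_conley G m r"
  define a where "a i j = mass_inner m (?A (v i)) (v j)" for i j
  define \<kappa> where "\<kappa> i = dist_form (sq_dist r) (v i) (v i)" for i
  note A = wintner_conley_in_dispositions
  have vD: "v i \<in> dispositions" and vv: "mass_inner m (v i) (v j) = of_bool (i = j)" for i j
    using v by (auto simp: mass_frame_def)
  have Asym: "mass_inner m (?A \<xi>) \<eta> = mass_inner m (?A \<eta>) \<xi>" for \<xi> \<eta>
    by (metis mass_inner_wintner_conley[OF m] interaction_form_commute)
  note diag = dist_form_frame_diagonal[OF m v _ _ orth, folded \<kappa>_def]
  show ?thesis
  proof
    assume bal: "balanced G m r"
    show "\<forall>i j. i \<noteq> j \<longrightarrow> mass_inner m (?A (v i)) (v j) = 0"
    proof (intro allI impI)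
      fix i j :: 3 assume ij: "i \<noteq> j"
      have 1: "dist_form (sq_dist r) (?A (v i)) (v j) = a i j * \<kappa> j" for i j
      proof -
        have "dist_form (sq_dist r) (?A (v i)) (v j) =
            (\<Sum>k\<in>UNIV. mass_inner m (?A (v i)) (v k) * mass_inner m (v j) (v k) * \<kappa> k)"
          by (rule diag[OF A vD])
        also have "\<dots> = (\<Sum>k\<in>UNIV. if k = j then a i j * \<kappa> j else 0)"
          by (intro sum.cong refl) (auto simp: vv a_def)
        finally show ?thesis by simp
      qed
      have "dist_form (sq_dist r) (v i) (?A (v j)) = a j i * \<kappa> i"
        unfolding dist_form_commute[of "sq_dist r" "v i" "?A (v j)", OF sq_dist_commute] by (rule 1)
      moreover have "a j i = a i j" by (simp add: a_def Asym)
      ultimately have "a i j * (\<kappa> j - \<kappa> i) = 0"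
        using bal vD 1[of i j] by (auto simp: balanced_iff_dist_form[OF m] algebra_simps)
      then show "mass_inner m (?A (v i)) (v j) = 0"
        using simple[OF ij] by (simp add: a_def \<kappa>_def)
    qed
  next
    assume off: "\<forall>i j. i \<noteq> j \<longrightarrow> mass_inner m (?A (v i)) (v j) = 0"
    have Av: "?A (v i) = a i i *\<^sub>R v i" for i
    proof -
      have "?A (v i) = (\<Sum>k\<in>UNIV. a i k *\<^sub>R v k)"
        unfolding a_def by (rule wintner_conley_frame[OF m v])
      also have "\<dots> = (\<Sum>k\<in>UNIV. if k = i then a i i *\<^sub>R v i else 0)"
        by (intro sum.cong refl) (use off in \<open>auto simp: a_def\<close>)
      finally show ?thesis by simp
    qed
    have coeff: "mass_inner m (?A \<xi>) (v i) = a i i * mass_inner m \<xi> (v i)" for \<xi> i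
      using Asym[of \<xi> "v i"] by (simp add: Av bilinear_lmul[OF bilinear_mass_inner] mass_inner_commute[of m "v i" \<xi>])
    show "balanced G m r"
      unfolding balanced_iff_dist_form[OF m]
      by (auto simp: diag[OF A] diag[OF _ A] coeff mult_ac)
  qed
qed

text \<open>A positive definite Gram form is realised in dimension three. The coordinates of the \<open>j\<close>-th body
  are the frame components of the \<open>j\<close>-th standard basis vector, scaled by the square roots of the
  eigenvalues.\<close>

lemma configuration_with_distances:
  assumes m: "\<And>i. m $ i > 0" and v: "mass_frame m v"
    and s: "\<And>i j. s i j = s j i" "\<And>i. s i i = 0"
    and orth: "\<And>i j. i \<noteq> j \<Longrightarrow> dist_form s (v i) (v j) = 0"
    and pos: "\<And>i. dist_form s (v i) (v i) > 0"
  obtains r :: "(real ^ 3) ^ 4" where "sq_dist r = s"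
proof -
  define \<kappa> where "\<kappa> = (\<lambda>i. dist_form s (v i) (v i))"
  define r :: "(real ^ 3) ^ 4" where "r = (\<chi> j. \<chi> i. sqrt (\<kappa> i) * (v i $ j / m $ j))"
  have "sq_dist r j k = s j k" for j k
  proof -
    define \<xi> :: "real ^ 4" where "\<xi> = axis j 1 - axis k 1"
    have \<xi>: "\<xi> \<in> dispositions" by (simp add: \<xi>_def dispositions_def sum_subtractf axis_def)
    have ax: "mass_inner m \<xi> \<eta> = \<eta> $ j / m $ j - \<eta> $ k / m $ k" for \<eta>
      by (simp add: \<xi>_def bilinear_lsub[OF bilinear_mass_inner])
        (simp add: mass_inner_def axis_def if_distrib[of "\<lambda>x. x * _"] if_distrib[of "\<lambda>x. x / _"] cong: if_cong)
    have "sq_dist r j k = (\<Sum>i\<in>UNIV. (sqrt (\<kappa> i) * (v i $ j / m $ j - v i $ k / m $ k))\<^sup>2)"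
      unfolding sq_dist_def dist_norm power2_norm_eq_inner r_def
      by (simp add: inner_vec_def power2_eq_square algebra_simps)
    also have "\<dots> = (\<Sum>i\<in>UNIV. mass_inner m \<xi> (v i) * mass_inner m \<xi> (v i) * \<kappa> i)"
      using pos by (simp add: ax power_mult_distrib \<kappa>_def less_imp_le)
        (simp add: power2_eq_square mult_ac)
    also have "\<dots> = dist_form s \<xi> \<xi>"
      unfolding \<kappa>_def by (rule dist_form_frame_diagonal[OF m v \<xi> \<xi> orth, symmetric])
    also have "\<dots> = s j k"
    proof -
      have "s i j * (axis p 1 $ i * axis q 1 $ j) = (if j = q then if i = p then s p q else 0 else 0)" for i j p q
        by (simp add: axis_def)
      then have ee: "dist_form s (axis p 1) (axis q 1) = - s p q / 2" for p q
        by (simp add: dist_form_def)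
      show ?thesis
        using s by (simp add: \<xi>_def bilinear_lsub[OF bilinear_dist_form] bilinear_rsub[OF bilinear_dist_form] ee)
    qed
    finally show ?thesis .
  qed
  then show ?thesis using that[of r] by blast
qed

section \<open>Relative equilibria and double eigenvalues\<close>

text \<open>The flow of \<open>\<Omega>\<close> consists of isometries, so that distances and hence \<open>A\<close> are constant in time, and
  Newton's equations reduce to their value at time zero.\<close>

lemma newton_solution_exp_endo_iff:
  fixes r :: "(real ^ 3) ^ 4" and \<iota> :: "real ^ 3 \<Rightarrow> real ^ 4"
  assumes nc: "non_collision r" and \<iota>: "linear \<iota>" "\<And>v. norm (\<iota> v) = norm v" and \<Omega>: "antisymmetric \<Omega>"
  shows "newton_solution G m (\<lambda>t. \<chi> i. exp_endo (\<lambda>v. t *\<^sub>R \<Omega> v) (\<iota> (r $ i))) \<longleftrightarrow>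
    (\<forall>\<xi>\<in>dispositions. \<Omega> (\<Omega> (\<iota> (config_map r \<xi>))) = 2 *\<^sub>R \<iota> (config_map r (wintner_conley G m r \<xi>)))"
proof -
  have lin: "linear \<Omega>" using \<Omega> by (simp add: antisymmetric_def)
  define E where "E t = exp_endo (\<lambda>v. t *\<^sub>R \<Omega> v)" for t
  have linE: "linear (E t)" for t unfolding E_def by (rule linear_exp_endo_scaleR[OF lin])
  have normE: "norm (E t y) = norm y" for t y unfolding E_def by (rule norm_exp_endo_antisymmetric[OF \<Omega>])
  have E0: "E 0 y = y" for y unfolding E_def by (rule exp_endo_zero[OF lin])
  have derE: "((\<lambda>t. E t y) has_vector_derivative E t (\<Omega> y)) (at t)" for t y
    unfolding E_def by (rule exp_endo_has_vector_derivative[OF lin])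
  define x where "x t = (\<chi> i. E t (\<iota> (r $ i)))" for t
  have lin\<iota>E: "linear (\<lambda>v. E t (\<iota> v))" for t
    using linear_compose[OF \<iota>(1) linE[of t]] by (simp add: o_def)
  have dist: "dist (x t $ i) (x t $ j) = dist (r $ i) (r $ j)" for t i j
    using linear_diff[OF lin\<iota>E[of t], of "r $ i" "r $ j"] normE[of t "\<iota> (r $ i - r $ j)"]
    by (simp add: x_def dist_norm \<iota>(2))
  have nct: "non_collision (x t)" for t using nc by (simp only: non_collision_def dist)
  have "sq_dist (x t) = sq_dist r" for t by (intro ext) (simp add: sq_dist_def dist)
  then have wc: "wintner_conley G m (x t) = wintner_conley G m r" for t
    by (intro ext) (simp add: wintner_conley_def)
  have config: "config_map (x t) \<xi> = E t (\<iota> (config_map r \<xi>))" for t \<xi>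
    unfolding x_def by (rule config_map_linear_image[OF lin\<iota>E])
  have "newton_solution G m x \<longleftrightarrow>
    (\<forall>\<xi>\<in>dispositions. \<Omega> (\<Omega> (\<iota> (config_map r \<xi>))) = 2 *\<^sub>R \<iota> (config_map r (wintner_conley G m r \<xi>)))"
    (is "?L \<longleftrightarrow> ?R")
  proof
    assume ?L
    show ?R
    proof
      fix \<xi> :: "real ^ 4" assume "\<xi> \<in> dispositions"
      then obtain v where v: "\<And>t. ((\<lambda>t. config_map (x t) \<xi>) has_vector_derivative v t) (at t)"
        "\<And>t. (v has_vector_derivative 2 *\<^sub>R config_map (x t) (wintner_conley G m (x t) \<xi>)) (at t)"
        using \<open>?L\<close> unfolding newton_solution_def by blast
      have "v t = E t (\<Omega> (\<iota> (config_map r \<xi>)))" for t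
        using v(1)[of t] derE[of "\<iota> (config_map r \<xi>)" t] unfolding config
        by (rule vector_derivative_unique_at)
      then have "v = (\<lambda>t. E t (\<Omega> (\<iota> (config_map r \<xi>))))" by (rule ext)
      with v(2)[of 0] derE[of "\<Omega> (\<iota> (config_map r \<xi>))" 0]
      show "\<Omega> (\<Omega> (\<iota> (config_map r \<xi>))) = 2 *\<^sub>R \<iota> (config_map r (wintner_conley G m r \<xi>))"
        using vector_derivative_unique_at by (fastforce simp: config wc E0)
    qed
  next
    assume R: ?R
    show ?L
      unfolding newton_solution_def
    proof (intro conjI allI ballI nct)
      fix \<xi> :: "real ^ 4" assume \<xi>: "\<xi> \<in> dispositions"
      let ?v = "\<lambda>t. E t (\<Omega> (\<iota> (config_map r \<xi>)))"
      have eq: "2 *\<^sub>R config_map (x t) (wintner_conley G m (x t) \<xi>) = E t (\<Omega> (\<Omega> (\<iota> (config_map r \<xi>))))" for t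
        using R \<xi> by (simp add: config wc linear_cmul[OF linE])
      show "\<exists>v. \<forall>t. ((\<lambda>t. config_map (x t) \<xi>) has_vector_derivative v t) (at t) \<and>
          (v has_vector_derivative 2 *\<^sub>R config_map (x t) (wintner_conley G m (x t) \<xi>)) (at t)"
        unfolding eq unfolding config using derE by (intro exI[of _ ?v]) blast
    qed
  qed
  then show ?thesis unfolding x_def E_def .
qed

lemma norm_preserving_inner:
  assumes "linear f" "\<And>v. norm (f v) = norm v"
  shows "inner (f u) (f v) = inner u v"
  using assms(2)[of "u + v"] by (simp add: dot_norm linear_add[OF assms(1)] assms(2))

text \<open>Necessity: for distinct \<open>\<alpha> i\<close> the images \<open>w i\<close> of the frame vectors and the vectors \<open>\<Omega> (w i)\<close> would
  be six pairwise orthogonal non-zero vectors in \<open>\<real>\<^sup>4\<close>. Sufficiency: send the directions \<open>p\<close>, \<open>q\<close> of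
  the double eigenvalue and the third direction \<open>s\<close> to the first three axes, and let \<open>\<Omega>\<close> rotate the
  planes of axes \<open>1, 2\<close> and \<open>3, 4\<close> with the frequencies \<open>sqrt (- 2 * \<alpha> p)\<close> and
  \<open>sqrt (- 2 * \<alpha> s)\<close>.\<close>

lemma relative_equilibrium_iff_double_eigenvalue:
  fixes r :: "(real ^ 3) ^ 4"
  assumes m: "\<And>i. m $ i > 0" and v: "mass_frame m v" and nc: "non_collision r"
    and orth: "\<And>i j. i \<noteq> j \<Longrightarrow> dist_form (sq_dist r) (v i) (v j) = 0"
    and pos: "\<And>i. dist_form (sq_dist r) (v i) (v i) > 0"
    and eig: "\<And>i. wintner_conley G m r (v i) = \<alpha> i *\<^sub>R v i" and neg: "\<And>i. \<alpha> i < 0"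
  shows "admits_relative_equilibrium_R4 G m r \<longleftrightarrow> (\<exists>i j. i \<noteq> j \<and> \<alpha> i = \<alpha> j)"
proof
  have vD: "v i \<in> dispositions" for i using v by (auto simp: mass_frame_def)
  have x_orth: "inner (config_map r (v i)) (config_map r (v j)) = 0" if "i \<noteq> j" for i j
    using that orth by (simp add: config_inner vD)
  have x_nz: "config_map r (v i) \<noteq> 0" for i
    using pos[of i] config_inner[OF vD vD, of r i i] by auto
  {
    assume "admits_relative_equilibrium_R4 G m r"
    then obtain \<iota> :: "real ^ 3 \<Rightarrow> real ^ 4" and \<Omega> where \<iota>1: "linear \<iota>" "\<forall>v. norm (\<iota> v) = norm v" and \<Omega>: "antisymmetric \<Omega>"
      and newton: "newton_solution G m (\<lambda>t. \<chi> i. exp_endo (\<lambda>v. t *\<^sub>R \<Omega> v) (\<iota> (r $ i)))"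
      unfolding admits_relative_equilibrium_R4_def by blast
    have \<iota>: "linear \<iota>" "\<And>v. norm (\<iota> v) = norm v" using \<iota>1 by auto
    have eq: "\<Omega> (\<Omega> (\<iota> (config_map r \<xi>))) = 2 *\<^sub>R \<iota> (config_map r (wintner_conley G m r \<xi>))"
      if "\<xi> \<in> dispositions" for \<xi>
      using newton_solution_exp_endo_iff[OF nc \<iota> \<Omega>] newton that by blast
    have lin: "linear \<Omega>" and anti: "inner (\<Omega> x) y = - inner x (\<Omega> y)" for x y
      using \<Omega> by (auto simp: antisymmetric_def)
    define w where "w i = \<iota> (config_map r (v i))" for i
    have w2: "\<Omega> (\<Omega> (w i)) = (2 * \<alpha> i) *\<^sub>R w i" for i
      unfolding w_def eq[OF vD] eig linear_cmul[OF linear_config_map] linear_cmul[OF \<iota>(1)] by simp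
    have w_orth: "inner (w i) (w j) = 0" if "i \<noteq> j" for i j
      unfolding w_def norm_preserving_inner[OF \<iota>] by (rule x_orth[OF that])
    have w_nz: "w i \<noteq> 0" for i
      using x_nz[of i] \<iota>(2)[of "config_map r (v i)"] by (auto simp: w_def)
    show "\<exists>i j. i \<noteq> j \<and> \<alpha> i = \<alpha> j"
    proof (rule ccontr)
      assume "\<not> ?thesis"
      then have dist: "\<alpha> i \<noteq> \<alpha> j" if "i \<noteq> j" for i j using that by blast
      have mixed: "inner (w i) (\<Omega> (w j)) = 0" for i j
      proof (cases "i = j")
        case True
        then show ?thesis using anti[of "w i" "w i"] by (simp add: inner_commute)
      next
        case False
        \<comment> \<open>The vectors \<open>w i\<close> and \<open>\<Omega> (w j)\<close> are eigenvectors of the symmetric map \<open>\<Omega>\<^sup>2\<close> for different eigenvalues.\<close>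
        have "2 * \<alpha> i * inner (w i) (\<Omega> (w j)) = inner (\<Omega> (\<Omega> (w i))) (\<Omega> (w j))" by (simp add: w2)
        also have "\<dots> = inner (w i) (\<Omega> (\<Omega> (\<Omega> (w j))))" by (simp only: anti minus_minus)
        also have "\<dots> = 2 * \<alpha> j * inner (w i) (\<Omega> (w j))" by (simp add: w2 linear_cmul[OF lin])
        finally show ?thesis using dist[OF False] by simp
      qed
      have Omega_orth: "inner (\<Omega> (w i)) (\<Omega> (w j)) = 0" if "i \<noteq> j" for i j
        by (simp add: anti w2 w_orth[OF that])
      have Omega_nz: "\<Omega> (w i) \<noteq> 0" for i
        using w2[of i] w_nz[of i] neg[of i] linear_0[OF lin] by auto
      define f where "f = case_sum w (\<lambda>i. \<Omega> (w i))"
      have "CARD(3 + 3) \<le> DIM(real ^ 4)"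
      proof (rule orthogonal_family_card_le[of f])
        show "f i \<noteq> 0" for i by (cases i) (simp_all add: f_def w_nz Omega_nz)
        have mixed': "inner (\<Omega> (w j)) (w i) = 0" for i j using mixed[of i j] by (simp add: inner_commute)
        show "inner (f i) (f j) = 0" if "i \<noteq> j" for i j
          using that by (cases i; cases j) (simp_all add: f_def w_orth Omega_orth mixed mixed')
      qed
      then show False by simp
    qed
  next
    assume "\<exists>i j. i \<noteq> j \<and> \<alpha> i = \<alpha> j"
    then obtain p q where pq: "p \<noteq> q" "\<alpha> p = \<alpha> q" by blast
    obtain s :: 3 where s: "s \<noteq> p" "s \<noteq> q"
    proof -
      have "card {p, q} < CARD(3)" using pq(1) by simp
      then have "{p, q} \<noteq> UNIV" by (metis less_irrefl)
      then show ?thesis using that by blast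
    qed
    have cases3: "i = p \<or> i = q \<or> i = s" for i
    proof -
      have "card {p, q, s} = CARD(3)" using pq s by simp
      then have "{p, q, s} = UNIV" by (intro card_subset_eq) auto
      then show ?thesis by blast
    qed
    define f where "f i = config_map r (v i) /\<^sub>R norm (config_map r (v i))" for i
    have f: "inner (f i) (f j) = of_bool (i = j)" for i j
      using x_nz x_orth by (auto simp: f_def power2_norm_eq_inner[symmetric] power2_eq_square field_simps)
    define e :: "3 \<Rightarrow> real ^ 4" where "e i = axis (if i = p then 1 else if i = q then 2 else 3) 1" for i
    have e: "inner (e i) (e j) = of_bool (i = j)" for i j
      using cases3[of i] cases3[of j] pq s by (auto simp: e_def inner_axis_axis)
    define \<iota> where "\<iota> y = (\<Sum>i\<in>UNIV. inner (f i) y *\<^sub>R e i)" for y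
    have lin\<iota>: "linear \<iota>"
      unfolding \<iota>_def by (rule linearI) (simp_all add: inner_add_right scaleR_add_left sum.distrib scaleR_sum_right)
    have norm\<iota>: "norm (\<iota> y) = norm y" for y
    proof -
      have "inner (\<iota> y) (\<iota> y) = (\<Sum>i\<in>UNIV. inner (f i) y * inner (f i) y)"
        by (simp add: \<iota>_def inner_sum_left inner_sum_right e)
      also have "\<dots> = inner (\<Sum>i\<in>UNIV. inner (f i) y *\<^sub>R f i) y"
        by (simp add: inner_sum_left)
      also have "\<dots> = inner y y"
        using orthonormal_expansion[of f, OF f, of y] by simp
      finally show ?thesis by (simp add: norm_eq_sqrt_inner)
    qed
    have \<iota>f: "\<iota> (config_map r (v i)) = norm (config_map r (v i)) *\<^sub>R e i" for i
    proof -
      have "config_map r (v i) = norm (config_map r (v i)) *\<^sub>R f i" using x_nz by (simp add: f_def)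
      then have "\<iota> (config_map r (v i)) = norm (config_map r (v i)) *\<^sub>R \<iota> (f i)"
        using linear_cmul[OF lin\<iota>] by metis
      also have "\<iota> (f i) = (\<Sum>j\<in>UNIV. if j = i then e i else 0)"
        unfolding \<iota>_def by (intro sum.cong refl) (auto simp: f)
      also have "\<dots> = e i" by simp
      finally show ?thesis .
    qed
    define a where "a = sqrt (- 2 * \<alpha> p)"
    define b where "b = sqrt (- 2 * \<alpha> s)"
    have ab: "a * a = - 2 * \<alpha> p" "b * b = - 2 * \<alpha> s"
      using neg[of p] neg[of s] by (simp_all add: a_def b_def)
    define \<Omega> :: "real ^ 4 \<Rightarrow> real ^ 4" where
      "\<Omega> z = (a * z $ 1) *\<^sub>R axis 2 1 - (a * z $ 2) *\<^sub>R axis 1 1 + (b * z $ 3) *\<^sub>R axis 4 1 - (b * z $ 4) *\<^sub>R axis 3 1" for z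
    have lin: "linear \<Omega>"
      unfolding \<Omega>_def by (rule linearI) (simp_all add: algebra_simps)
    have anti: "antisymmetric \<Omega>"
      unfolding antisymmetric_def
      by (intro conjI allI lin) (simp add: \<Omega>_def inner_vec_def sum_4 axis_def)
    have \<Omega>e: "\<Omega> (\<Omega> (e i)) = (2 * \<alpha> i) *\<^sub>R e i" for i
      using cases3[of i] pq s
      by (auto simp: \<Omega>_def e_def vec_eq_iff forall_4 axis_def ab mult.assoc[symmetric])
    have "\<Omega> (\<Omega> (\<iota> (config_map r \<xi>))) = 2 *\<^sub>R \<iota> (config_map r (wintner_conley G m r \<xi>))"
      if \<xi>: "\<xi> \<in> dispositions" for \<xi>
    proof -
      define h where "h i = mass_inner m \<xi> (v i)" for i
      have \<xi>_eq: "\<xi> = (\<Sum>i\<in>UNIV. h i *\<^sub>R v i)" unfolding h_def by (rule mass_frame_expansion[OF m v \<xi>])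
      show ?thesis
        unfolding \<xi>_eq
        by (simp add: linear_sum[OF linear_wintner_conley] linear_cmul[OF linear_wintner_conley] eig
            linear_sum[OF linear_config_map] linear_cmul[OF linear_config_map]
            linear_sum[OF lin\<iota>] linear_cmul[OF lin\<iota>] linear_sum[OF lin] linear_cmul[OF lin] \<iota>f \<Omega>e
            scaleR_sum_right mult_ac)
    qed
    then have "newton_solution G m (\<lambda>t. \<chi> i. exp_endo (\<lambda>v. t *\<^sub>R \<Omega> v) (\<iota> (r $ i)))"
      using newton_solution_exp_endo_iff[OF nc lin\<iota> norm\<iota> anti] by blast
    then show "admits_relative_equilibrium_R4 G m r"
      unfolding admits_relative_equilibrium_R4_def using lin\<iota> norm\<iota> anti by blast
  }
qed

section \<open>Shapes\<close>

text \<open>The derivative of the potential at positive arguments.\<close>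

definition force :: "real \<Rightarrow> real \<Rightarrow> real" where
  "force G s = - G / 2 * s powr (- 3 / 2)"

lemma deriv_potential:
  assumes "s > 0"
  shows "deriv (potential G) s = force G s"
proof -
  have "((\<lambda>s. s powr (- 1 / 2)) has_real_derivative (- 1 / 2) * s powr (- 1 / 2 - 1)) (at s)"
    by (rule has_real_derivative_powr[OF assms])
  then have "((\<lambda>s. G * s powr (- 1 / 2)) has_real_derivative G * ((- 1 / 2) * s powr (- 1 / 2 - 1))) (at s)"
    by (rule DERIV_cmult)
  then have "deriv (\<lambda>s. G * s powr (- 1 / 2)) s = G * ((- 1 / 2) * s powr (- 1 / 2 - 1))"
    by (rule DERIV_imp_deriv)
  moreover have "potential G = (\<lambda>s. G * s powr (- 1 / 2))" by (rule ext) (simp add: potential_def)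
  ultimately show ?thesis by (simp add: force_def)
qed

lemma force_has_derivative:
  assumes "s > 0"
  shows "(force G has_real_derivative - G / 2 * ((- 3 / 2) * s powr (- 3 / 2 - 1))) (at s)"
  unfolding force_def[abs_def] by (intro DERIV_cmult has_real_derivative_powr assms)

lemma force_scale:
  assumes "c > 0" "s > 0"
  shows "force G (c * s) = c powr (- 3 / 2) * force G s"
  using assms by (simp add: force_def powr_mult)

text \<open>The linear conditions on a matrix that hold for all shapes.\<close>

definition normalised_shape :: "real ^ 4 ^ 4 \<Rightarrow> bool" where
  "normalised_shape X \<longleftrightarrow> (\<forall>i. X $ i $ i = 0) \<and> (\<forall>i j. X $ i $ j = X $ j $ i) \<and>
     (\<Sum>i\<in>UNIV. \<Sum>j\<in>UNIV. X $ i $ j) = 1"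

lemma sum_sq_dist_pos:
  assumes "non_collision r"
  shows "(\<Sum>k\<in>UNIV. \<Sum>l\<in>UNIV. sq_dist r k l) > 0"
proof -
  have "sq_dist r 1 2 > 0" using assms by (simp add: sq_dist_def non_collision_def)
  then show ?thesis
    by (intro sum_pos2[of _ 1] sum_pos2[of _ 2] sum_nonneg) (auto simp: sq_dist_def)
qed

lemma sq_dist_eq_shape:
  assumes "non_collision r"
  obtains c where "c > 0" "\<And>i j. sq_dist r i j = c * shape r $ i $ j"
proof (rule that)
  show "(\<Sum>k\<in>UNIV. \<Sum>l\<in>UNIV. sq_dist r k l) > 0" by (rule sum_sq_dist_pos[OF assms])
  then show "sq_dist r i j = (\<Sum>k\<in>UNIV. \<Sum>l\<in>UNIV. sq_dist r k l) * shape r $ i $ j" for i j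
    by (simp add: shape_def)
qed

lemma normalised_shape_shape:
  assumes "non_collision r"
  shows "normalised_shape (shape r)"
proof -
  have "(\<Sum>i\<in>UNIV. \<Sum>j\<in>UNIV. shape r $ i $ j) = 1"
    using sum_sq_dist_pos[OF assms] by (simp add: shape_def sum_divide_distrib[symmetric])
  moreover have "shape r $ i $ i = 0" "shape r $ i $ j = shape r $ j $ i" for i j
    by (simp_all add: shape_def sq_dist_def dist_commute)
  ultimately show ?thesis by (simp add: normalised_shape_def)
qed

text \<open>A configuration with shape \<open>X\<close> has squared distances \<open>c X\<close> for some \<open>c > 0\<close>; the forces then only
  change by the positive factor \<open>c powr (- 3 / 2)\<close>, which affects neither condition. Orthogonality of the
  frame is required only below the diagonal, since this is all that can be achieved for matrices
  \<open>X\<close> that are not symmetric; those with \<open>sq_dist r = c X\<close> are.\<close>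

lemma balanced_and_relative_equilibrium_of_shape:
  fixes r :: "(real ^ 3) ^ 4" and X :: "real ^ 4 ^ 4" and G :: real
  assumes m: "\<And>i. m $ i > 0" and v: "mass_frame m v"
    and c: "c > 0" "\<And>i j. sq_dist r i j = c * X $ i $ j"
    and nc: "\<And>i j. i \<noteq> j \<Longrightarrow> X $ i $ j > 0"
    and orth: "\<And>i j. j < i \<Longrightarrow> dist_form (\<lambda>k l. X $ k $ l) (v i) (v j) = 0"
    and pos: "\<And>i. dist_form (\<lambda>k l. X $ k $ l) (v i) (v i) > 0"
    and simple: "\<And>i j. i \<noteq> j \<Longrightarrow> dist_form (\<lambda>k l. X $ k $ l) (v i) (v i) \<noteq> dist_form (\<lambda>k l. X $ k $ l) (v j) (v j)"
    and a_def: "\<And>i j. a i j = interaction_form m (\<lambda>k l. force G (X $ k $ l)) (v i) (v j)"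
    and neg: "\<And>i. a i i < 0"
  shows "balanced G m r \<longleftrightarrow> (\<forall>i j. i \<noteq> j \<longrightarrow> a i j = 0)"
    and "(\<And>i j. i \<noteq> j \<Longrightarrow> a i j = 0) \<Longrightarrow>
      admits_relative_equilibrium_R4 G m r \<longleftrightarrow> (\<exists>i j. i \<noteq> j \<and> a i i = a j j)"
proof -
  define C where "C = c powr (- 3 / 2)"
  have C: "C > 0" using c(1) by (simp add: C_def)
  have ncr: "non_collision r"
    unfolding non_collision_def
  proof (intro allI impI)
    fix i j :: 4 assume "i \<noteq> j"
    then have "sq_dist r i j > 0" using c nc by simp
    then show "dist (r $ i) (r $ j) > 0" by (auto simp: sq_dist_def)
  qed
  have df: "dist_form (sq_dist r) \<xi> \<eta> = c * dist_form (\<lambda>k l. X $ k $ l) \<xi> \<eta>" for \<xi> \<eta>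
    by (simp add: dist_form_def c(2) sum_distrib_left mult.assoc)
  have orth': "dist_form (sq_dist r) (v i) (v j) = 0" if "i \<noteq> j" for i j
  proof (cases "j < i")
    case True
    then show ?thesis using orth by (simp add: df)
  next
    case False
    then have "i < j" using that by simp
    then have "dist_form (sq_dist r) (v j) (v i) = 0" using orth by (simp add: df)
    then show ?thesis
      using dist_form_commute[of "sq_dist r" "v i" "v j", OF sq_dist_commute] by simp
  qed
  have pos': "dist_form (sq_dist r) (v i) (v i) > 0" for i using pos c(1) by (simp add: df)
  have simple': "dist_form (sq_dist r) (v i) (v i) \<noteq> dist_form (sq_dist r) (v j) (v j)" if "i \<noteq> j" for i j
    using simple[OF that] c(1) by (simp add: df)
  have A: "mass_inner m (wintner_conley G m r (v i)) (v j) = C * a i j" for i j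
  proof -
    have "deriv (potential G) (sq_dist r k l) = C * force G (X $ k $ l)" if "k \<noteq> l" for k l
      using nc[OF that] c by (simp add: C_def deriv_potential force_scale)
    then show ?thesis
      unfolding mass_inner_wintner_conley[OF m] a_def interaction_form_cmult[symmetric]
      by (intro interaction_form_cong) auto
  qed
  have "balanced G m r \<longleftrightarrow> (\<forall>i j. i \<noteq> j \<longrightarrow> mass_inner m (wintner_conley G m r (v i)) (v j) = 0)"
    by (rule balanced_iff_frame[OF m v]) (simp_all add: orth' simple')
  then show "balanced G m r \<longleftrightarrow> (\<forall>i j. i \<noteq> j \<longrightarrow> a i j = 0)"
    using C by (simp add: A)
  assume off: "\<And>i j. i \<noteq> j \<Longrightarrow> a i j = 0"
  have eig: "wintner_conley G m r (v i) = (C * a i i) *\<^sub>R v i" for i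
  proof -
    have "wintner_conley G m r (v i) = (\<Sum>k\<in>UNIV. (C * a i k) *\<^sub>R v k)"
      unfolding A[symmetric] by (rule wintner_conley_frame[OF m v])
    also have "\<dots> = (\<Sum>k\<in>UNIV. if k = i then (C * a i i) *\<^sub>R v i else 0)"
      by (intro sum.cong refl) (use off in auto)
    finally show ?thesis by simp
  qed
  have "C * a i i < 0" for i using C neg by (simp add: mult_pos_neg)
  then have "admits_relative_equilibrium_R4 G m r \<longleftrightarrow> (\<exists>i j. i \<noteq> j \<and> C * a i i = C * a j j)"
    by (intro relative_equilibrium_iff_double_eigenvalue[OF m v ncr _ pos' eig]) (simp_all add: orth')
  then show "admits_relative_equilibrium_R4 G m r \<longleftrightarrow> (\<exists>i j. i \<noteq> j \<and> a i i = a j j)"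
    using C by simp
qed

lemma mem_shapes_iff:
  fixes X :: "real ^ 4 ^ 4" and G :: real
  assumes m: "\<And>i. m $ i > 0" and v: "mass_frame m v"
    and nc: "\<And>i j. i \<noteq> j \<Longrightarrow> X $ i $ j > 0"
    and orth: "\<And>i j. j < i \<Longrightarrow> dist_form (\<lambda>k l. X $ k $ l) (v i) (v j) = 0"
    and pos: "\<And>i. dist_form (\<lambda>k l. X $ k $ l) (v i) (v i) > 0"
    and simple: "\<And>i j. i \<noteq> j \<Longrightarrow> dist_form (\<lambda>k l. X $ k $ l) (v i) (v i) \<noteq> dist_form (\<lambda>k l. X $ k $ l) (v j) (v j)"
    and a_def: "\<And>i j. a i j = interaction_form m (\<lambda>k l. force G (X $ k $ l)) (v i) (v j)"
    and neg: "\<And>i. a i i < 0"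
  shows "X \<in> balanced_shapes G m \<longleftrightarrow> normalised_shape X \<and> (\<forall>i j. i \<noteq> j \<longrightarrow> a i j = 0)" (is "?B \<longleftrightarrow> ?b")
    and "X \<in> relative_equilibrium_shapes_R4 G m \<longleftrightarrow>
      normalised_shape X \<and> (\<forall>i j. i \<noteq> j \<longrightarrow> a i j = 0) \<and> (\<exists>i j. i \<noteq> j \<and> a i i = a j j)" (is "?E \<longleftrightarrow> ?e")
proof -
  note main = balanced_and_relative_equilibrium_of_shape[OF m v _ _ nc orth pos simple a_def neg]
  have imp: "normalised_shape X" "balanced G m r \<longleftrightarrow> (\<forall>i j. i \<noteq> j \<longrightarrow> a i j = 0)"
    "(\<And>i j. i \<noteq> j \<Longrightarrow> a i j = 0) \<Longrightarrow>
      admits_relative_equilibrium_R4 G m r \<longleftrightarrow> (\<exists>i j. i \<noteq> j \<and> a i i = a j j)"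
    if r: "non_collision r" "X = shape r" for r :: "(real ^ 3) ^ 4"
  proof -
    obtain c where c: "c > 0" "\<And>i j. sq_dist r i j = c * X $ i $ j"
      using sq_dist_eq_shape[OF r(1)] unfolding r(2) by blast
    show "normalised_shape X" using normalised_shape_shape[OF r(1)] r(2) by simp
    show "balanced G m r \<longleftrightarrow> (\<forall>i j. i \<noteq> j \<longrightarrow> a i j = 0)"
      by (rule main(1)[OF c]) simp_all
    show "(\<And>i j. i \<noteq> j \<Longrightarrow> a i j = 0) \<Longrightarrow>
      admits_relative_equilibrium_R4 G m r \<longleftrightarrow> (\<exists>i j. i \<noteq> j \<and> a i i = a j j)"
      by (rule main(2)[OF c]) simp_all
  qed
  have ex: "\<exists>r :: (real ^ 3) ^ 4. non_collision r \<and> X = shape r" if X: "normalised_shape X"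
  proof -
    have sym: "X $ i $ j = X $ j $ i" and diag: "X $ i $ i = 0" for i j
      using X by (auto simp: normalised_shape_def)
    have orth': "dist_form (\<lambda>k l. X $ k $ l) (v i) (v j) = 0" if "i \<noteq> j" for i j
    proof (cases "j < i")
      case True
      then show ?thesis by (rule orth)
    next
      case False
      then have "i < j" using that by simp
      then have "dist_form (\<lambda>k l. X $ k $ l) (v j) (v i) = 0" by (rule orth)
      then show ?thesis
        using dist_form_commute[of "\<lambda>k l. X $ k $ l" "v i" "v j", OF sym] by simp
    qed
    obtain r :: "(real ^ 3) ^ 4" where r: "sq_dist r = (\<lambda>k l. X $ k $ l)"
      by (rule configuration_with_distances[OF m v sym diag orth' pos])
    have "non_collision r"
      unfolding non_collision_def
    proof (intro allI impI)
      fix i j :: 4 assume "i \<noteq> j"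
      then have "sq_dist r i j > 0" using nc by (simp add: r)
      then show "dist (r $ i) (r $ j) > 0" by (auto simp: sq_dist_def)
    qed
    moreover have "X = shape r" using X by (simp add: shape_def r normalised_shape_def vec_eq_iff)
    ultimately show ?thesis by blast
  qed
  show "?B \<longleftrightarrow> ?b"
  proof
    assume ?B
    then obtain r :: "(real ^ 3) ^ 4" where r: "non_collision r" "balanced G m r" "X = shape r"
      by (auto simp: balanced_shapes_def)
    show ?b using imp(1,2)[OF r(1,3)] r(2) by simp
  next
    assume b: ?b
    then obtain r :: "(real ^ 3) ^ 4" where r: "non_collision r" "X = shape r" using ex by auto
    then have "balanced G m r" using imp(2)[OF r] b by simp
    then show ?B using r by (auto simp: balanced_shapes_def)
  qed
  show "?E \<longleftrightarrow> ?e"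
  proof
    assume ?E
    then obtain r :: "(real ^ 3) ^ 4" where r: "non_collision r" "balanced G m r"
      "admits_relative_equilibrium_R4 G m r" "X = shape r"
      by (auto simp: relative_equilibrium_shapes_R4_def)
    show ?e using imp[OF r(1,4)] r(2,3) by simp
  next
    assume e: ?e
    then obtain r :: "(real ^ 3) ^ 4" where r: "non_collision r" "X = shape r" using ex by auto
    have "balanced G m r" "admits_relative_equilibrium_R4 G m r"
      using imp(2,3)[OF r] e by simp_all
    then show ?E using r by (auto simp: relative_equilibrium_shapes_R4_def)
  qed
qed

section \<open>Adapted frames near the regular tetrahedron\<close>

text \<open>At the regular tetrahedron the Gram form is a multiple of the Euclidean inner product. Diagonalise
  the latter with respect to the mass inner product, in the coordinates divided by the square roots
  \<open>\<mu>\<close> of the masses: there the Euclidean inner product becomes \<open>q\<close>, with diagonal matrix \<open>m\<close>, and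
  the dispositions become the orthogonal complement of \<open>\<mu>\<close>. An eigenvector \<open>x\<close> for \<open>\<kappa>\<close> satisfies
  \<open>(m\<^sub>k - \<kappa>) x\<^sub>k = c \<mu>\<^sub>k\<close>. If no mass equals \<open>\<kappa>\<close>, this determines \<open>x\<close> up to a factor; otherwise \<open>c = 0\<close>
  and \<open>x\<close> is supported on the at most two bodies of mass \<open>\<kappa>\<close>, which again leaves one direction
  orthogonal to \<open>\<mu>\<close>. So two orthonormal eigenvectors cannot share an eigenvalue.\<close>

lemma mass_frame_distinct_euclidean_norms:
  fixes m :: "real ^ 4"
  assumes m: "\<And>i. m $ i > 0"
    and no3: "\<not> (\<exists>i j k. i \<noteq> j \<and> j \<noteq> k \<and> i \<noteq> k \<and> m $ i = m $ j \<and> m $ j = m $ k)"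
  obtains u where "mass_frame m u" "\<And>i j. i \<noteq> j \<Longrightarrow> inner (u i) (u j) = 0"
    "\<And>i j. i \<noteq> j \<Longrightarrow> inner (u i) (u i) \<noteq> inner (u j) (u j)"
proof -
  define \<mu> :: "real ^ 4" where "\<mu> = (\<chi> k. sqrt (m $ k))"
  have mu: "\<mu> $ k > 0" "\<mu> $ k * \<mu> $ k = m $ k" for k using m[of k] by (simp_all add: \<mu>_def)
  have "\<mu> \<noteq> 0" using mu(1)[of 1] by auto
  define S where "S = {x. inner \<mu> x = 0}"
  define q :: "real ^ 4 \<Rightarrow> real ^ 4 \<Rightarrow> real" where "q x y = (\<Sum>k\<in>UNIV. m $ k * (x $ k * y $ k))" for x y
  have q: "bilinear q"
    unfolding bilinear_def q_def
    by (auto intro!: linearI simp: algebra_simps sum.distrib sum_distrib_left)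
  have qsym: "q x y = q y x" for x y by (simp add: q_def mult_ac)
  obtain B where B: "B \<subseteq> S" "finite B" "card B = dim S" "span B = S" "\<And>x. x \<in> B \<Longrightarrow> norm x = 1"
    "\<And>x y. x \<in> B \<Longrightarrow> y \<in> B \<Longrightarrow> x \<noteq> y \<Longrightarrow> inner x y = 0 \<and> q x y = 0"
    by (rule simultaneous_orthonormal_basis[OF q qsym, of S]) (auto simp: S_def subspace_hyperplane)
  have "card B = card (UNIV :: 3 set)"
    using dim_hyperplane[OF \<open>\<mu> \<noteq> 0\<close>] by (simp add: B(3) S_def)
  then obtain b :: "3 \<Rightarrow> real ^ 4" where b: "bij_betw b UNIV B"
    using finite_same_card_bij[of "UNIV :: 3 set" B] B(2) by auto
  have bB: "b i \<in> B" for i using b by (auto simp: bij_betw_def)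
  have bne: "b i \<noteq> b j" if "i \<noteq> j" for i j using b that by (auto simp: bij_betw_def inj_on_def)
  have b_S: "inner \<mu> (b i) = 0" for i using bB[of i] B(1) by (auto simp: S_def)
  have b_inner: "inner (b i) (b j) = of_bool (i = j)" for i j
    using B(5,6) bB bne by (cases "i = j") (auto simp: norm_eq_1)
  have b_q: "q (b i) (b j) = 0" if "i \<noteq> j" for i j using B(6)[OF bB bB bne[OF that]] by simp
  have eigen: "\<exists>c. \<forall>k. (m $ k - q (b i) (b i)) * b i $ k = c * \<mu> $ k" for i
  proof -
    define \<kappa> where "\<kappa> = q (b i) (b i)"
    define w :: "real ^ 4" where "w = (\<chi> k. (m $ k - \<kappa>) * b i $ k)"
    have w_inner: "inner w y = q (b i) y - \<kappa> * inner (b i) y" for y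
      by (simp add: w_def q_def inner_vec_def sum_distrib_left sum_subtractf[symmetric] algebra_simps)
    have "inner w y = 0" if "y \<in> B" for y
    proof (cases "y = b i")
      case True
      then show ?thesis using b_inner[of i i] by (simp add: w_inner \<kappa>_def)
    next
      case False
      then show ?thesis using B(6)[OF bB[of i] that] by (simp add: w_inner)
    qed
    then have wS: "inner w y = 0" if "y \<in> S" for y
      using that orthogonal_to_span[of y B w] B(4) by (auto simp: orthogonal_def)
    define c where "c = inner \<mu> w / inner \<mu> \<mu>"
    define z where "z = w - c *\<^sub>R \<mu>"
    have "z \<in> S" using \<open>\<mu> \<noteq> 0\<close> by (simp add: S_def z_def c_def inner_diff_right)
    then have "inner z z = 0"
      using wS[of z] by (simp add: z_def inner_diff_left S_def)
    then have "w = c *\<^sub>R \<mu>" by (simp add: z_def)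
    then have "(m $ k - \<kappa>) * b i $ k = c * \<mu> $ k" for k
      by (metis (no_types) w_def vec_lambda_beta vector_scaleR_component real_scaleR_def)
    then show ?thesis unfolding \<kappa>_def by blast
  qed
  have distinct: "q (b i) (b i) \<noteq> q (b j) (b j)" if ij: "i \<noteq> j" for i j
  proof
    assume eq: "q (b i) (b i) = q (b j) (b j)"
    define \<kappa> where "\<kappa> = q (b i) (b i)"
    obtain c d where cd: "\<And>k. (m $ k - \<kappa>) * b i $ k = c * \<mu> $ k" "\<And>k. (m $ k - \<kappa>) * b j $ k = d * \<mu> $ k"
      using eigen[of i] eigen[of j] eq by (auto simp: \<kappa>_def)
    have nz: "b i \<noteq> 0" "b j \<noteq> 0" using b_inner[of i i] b_inner[of j j] by auto
    show False
    proof (cases "\<exists>k. m $ k = \<kappa>")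
      case True
      then obtain k where k: "m $ k = \<kappa>" by blast
      then have "c = 0" "d = 0" using cd[of k] mu(1)[of k] by auto
      then have supp: "b i $ p = 0 \<and> b j $ p = 0" if "m $ p \<noteq> \<kappa>" for p using cd[of p] that by auto
      show False
      proof (cases "\<exists>l. l \<noteq> k \<and> m $ l = \<kappa>")
        case True
        then obtain l where l: "l \<noteq> k" "m $ l = \<kappa>" by blast
        have out: "b i $ p = 0 \<and> b j $ p = 0" if "p \<noteq> k" "p \<noteq> l" for p
          using supp no3 k l that by metis
        have two: "inner x y = x $ k * y $ k + x $ l * y $ l"
          if "\<And>p. p \<noteq> k \<Longrightarrow> p \<noteq> l \<Longrightarrow> y $ p = 0" for x y :: "real ^ 4"
        proof -
          have "inner x y = (\<Sum>p\<in>{k, l}. x $ p * y $ p)"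
            unfolding inner_vec_def inner_real_def by (rule sum.mono_neutral_right) (use that in auto)
          then show ?thesis using l by simp
        qed
        have "\<mu> $ l = \<mu> $ k" using k l by (simp add: \<mu>_def)
        then have "\<mu> $ k * (b i $ k + b i $ l) = 0" "\<mu> $ k * (b j $ k + b j $ l) = 0"
          using b_S[of i] b_S[of j] two[of "b i" \<mu>] two[of "b j" \<mu>] out by (auto simp: algebra_simps)
        then have "b i $ l = - b i $ k" "b j $ l = - b j $ k" using mu(1)[of k] by auto
        moreover have "inner (b i) (b j) = 0" "inner (b i) (b i) = 1" "inner (b j) (b j) = 1"
          using b_inner ij by auto
        ultimately show False
          using two[of "b j" "b i"] two[of "b i" "b i"] two[of "b j" "b j"] out by auto
      next
        case False
        then have out: "b i $ p = 0" if "p \<noteq> k" for p using supp that by blast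
        have "inner \<mu> (b i) = (\<Sum>p\<in>{k}. \<mu> $ p * b i $ p)"
          unfolding inner_vec_def inner_real_def by (rule sum.mono_neutral_right) (use out in auto)
        then have "b i $ k = 0" using b_S[of i] mu(1)[of k] by simp
        then show False using nz(1) out by (metis vec_eq_iff zero_index)
      qed
    next
      case False
      then have ne: "m $ k - \<kappa> \<noteq> 0" for k by auto
      define g where "g = (\<Sum>k\<in>UNIV. (\<mu> $ k / (m $ k - \<kappa>))\<^sup>2)"
      have g: "g > 0"
        unfolding g_def using ne mu(1) by (intro sum_pos) (auto simp: less_imp_neq[symmetric])
      have "b i $ k = c * (\<mu> $ k / (m $ k - \<kappa>))" "b j $ k = d * (\<mu> $ k / (m $ k - \<kappa>))" for k
        using cd[of k] ne[of k] by (auto simp: field_simps)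
      then have bb: "b i = c *\<^sub>R (\<chi> k. \<mu> $ k / (m $ k - \<kappa>))" "b j = d *\<^sub>R (\<chi> k. \<mu> $ k / (m $ k - \<kappa>))"
        by (simp_all add: vec_eq_iff)
      have "inner (b i) (b j) = c * d * g"
        by (simp add: bb inner_vec_def g_def power2_eq_square sum_distrib_left mult_ac)
      then have "c * d * g = 0" using b_inner[of i j] ij by simp
      then have "c = 0 \<or> d = 0" using g by auto
      then show False using nz bb by auto
    qed
  qed
  define u where "u i = (\<chi> k. \<mu> $ k * b i $ k)" for i
  have uu: "inner (u i) (u j) = q (b i) (b j)" for i j
  proof -
    have "\<mu> $ k * b i $ k * (\<mu> $ k * b j $ k) = m $ k * (b i $ k * b j $ k)" for k
      by (simp add: mu(2)[symmetric])
    then show ?thesis by (simp only: u_def q_def inner_vec_def inner_real_def vec_lambda_beta)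
  qed
  have "mass_inner m (u i) (u j) = inner (b i) (b j)" for i j
  proof -
    have "\<mu> $ k * b i $ k * (\<mu> $ k * b j $ k) / m $ k = b i $ k * b j $ k" for k
      using mu(1)[of k] by (simp add: mu(2)[symmetric])
    then show ?thesis by (simp add: u_def mass_inner_def inner_vec_def)
  qed
  moreover have "u i \<in> dispositions" for i
    using b_S[of i] by (simp add: dispositions_def u_def inner_vec_def)
  ultimately have "mass_frame m u" by (simp add: mass_frame_def b_inner)
  then show ?thesis using that uu b_q distinct by metis
qed

text \<open>The diagonal entries of a shape are zero, where the force is not smooth; all uses below keep away
  from them.\<close>

lemma smooth_on_force: "smooth_on {0<..} (force G)"
  unfolding force_def smooth_on_def
  by (intro allI Ck_on_mult open_greaterThan Ck_on_const Ck_on_powr)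

lemma smooth_on_dist_form:
  assumes "open S" "\<And>k l. smooth_on S (\<lambda>x. s x k l)" "smooth_on S f" "smooth_on S g"
  shows "smooth_on S (\<lambda>x. dist_form (s x) (f x) (g x))"
proof -
  have "smooth_on S (\<lambda>x. (\<Sum>i\<in>UNIV. \<Sum>j\<in>UNIV. s x i j * (f x $ i * g x $ j)) / (- 2))"
    by (intro smooth_on_divide smooth_on_sum smooth_on_mult smooth_on_vec_nth assms)
  then show ?thesis by (simp add: dist_form_def)
qed

lemma smooth_on_interaction_form:
  assumes "open S" "\<And>k l. smooth_on S (\<lambda>x. w x k l)" "smooth_on S f" "smooth_on S g"
  shows "smooth_on S (\<lambda>x. interaction_form m (w x) (f x) (g x))"
  unfolding interaction_form_def
  by (intro smooth_on_divide smooth_on_sum smooth_on_mult smooth_on_diff smooth_on_vec_nth smooth_on_const assms)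

lemma bilinear_along_line:
  assumes "bilinear b"
  shows "((\<lambda>t::real. b (p + t *\<^sub>R p') (q + t *\<^sub>R q')) has_real_derivative b p' q + b p q') (at 0)"
proof -
  have "b (p + t *\<^sub>R p') (q + t *\<^sub>R q') = b p q + t * (b p' q + b p q') + t * t * b p' q'" for t
    by (simp add: bilinear_ladd[OF assms] bilinear_radd[OF assms] bilinear_lmul[OF assms]
        bilinear_rmul[OF assms] algebra_simps)
  then show ?thesis by (auto intro!: derivative_eq_intros)
qed

text \<open>The shape of the regular tetrahedron. There are twelve ordered pairs of distinct bodies.\<close>

definition regular_shape :: "real ^ 4 ^ 4" where
  "regular_shape = (\<chi> i j. if i = j then 0 else 1 / 12)"

lemma dist_form_regular_shape:
  assumes "\<xi> \<in> dispositions" "\<eta> \<in> dispositions"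
  shows "dist_form (\<lambda>k l. regular_shape $ k $ l) \<xi> \<eta> = inner \<xi> \<eta> / 24"
proof -
  have *: "regular_shape $ i $ j * (\<xi> $ i * \<eta> $ j) = (\<xi> $ i * \<eta> $ j) / 12 - (if j = i then \<xi> $ i * \<eta> $ i / 12 else 0)" for i j
    by (simp add: regular_shape_def)
  have "(\<Sum>i\<in>UNIV. \<Sum>j\<in>UNIV. regular_shape $ i $ j * (\<xi> $ i * \<eta> $ j)) =
     (\<Sum>i\<in>UNIV. \<xi> $ i) * (\<Sum>j\<in>UNIV. \<eta> $ j) / 12 - inner \<xi> \<eta> / 12"
    unfolding * by (simp add: sum_subtractf sum_product sum_divide_distrib inner_vec_def)
  then show ?thesis using assms by (simp add: dist_form_def dispositions_def)
qed

text \<open>The frame is sought as \<open>T Q\<close>, with the unknown matrix \<open>Q\<close> of its coefficients in the frame \<open>u\<close>. On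
  and above the diagonal, the nine equations express mass orthonormality, and below the diagonal
  orthogonality for the Gram form. Their derivative with respect to \<open>Q\<close> in direction \<open>c\<close> is
  \<open>c\<^bsub>ij\<^esub> + c\<^bsub>ji\<^esub>\<close>, respectively a multiple of \<open>c\<^bsub>ij\<^esub> \<kappa>\<^sub>j + c\<^bsub>ji\<^esub> \<kappa>\<^sub>i\<close> with
  \<open>\<kappa>\<^sub>i = inner (u i) (u i)\<close>, so it is injective when the \<open>\<kappa>\<^sub>i\<close> are distinct.\<close>

lemma smooth_frame_near_regular_shape:
  assumes m: "\<And>i. m $ i > 0" and u: "mass_frame m u"
    and orth: "\<And>i j. i \<noteq> j \<Longrightarrow> inner (u i) (u j) = 0"
    and simple: "\<And>i j. i \<noteq> j \<Longrightarrow> inner (u i) (u i) \<noteq> inner (u j) (u j)"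
  obtains W V where "open W" "regular_shape \<in> W" "\<And>i. smooth_on W (\<lambda>X. V X i)" "V regular_shape = u"
    "\<And>X. X \<in> W \<Longrightarrow> mass_frame m (V X)"
    "\<And>X i j. X \<in> W \<Longrightarrow> j < i \<Longrightarrow> dist_form (\<lambda>k l. X $ k $ l) (V X i) (V X j) = 0"
proof -
  have uD: "u i \<in> dispositions" and uu: "mass_inner m (u i) (u j) = of_bool (i = j)" for i j
    using u by (auto simp: mass_frame_def)
  define T :: "real ^ 3 ^ 3 \<Rightarrow> 3 \<Rightarrow> real ^ 4" where "T Q i = (\<Sum>k\<in>UNIV. Q $ i $ k *\<^sub>R u k)" for Q i
  define I :: "real ^ 3 ^ 3" where "I = mat 1"
  have T_lin: "linear (\<lambda>Q. T Q i)" for i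
    unfolding T_def by (rule linearI) (simp_all add: scaleR_add_left sum.distrib scaleR_sum_right)
  have T_D: "T Q i \<in> dispositions" for Q i
    unfolding T_def by (intro subspace_sum subspace_scale subspace_dispositions uD)
  have T_I: "T I = u"
    by (rule ext) (simp add: T_def I_def mat_def if_distrib[of "\<lambda>c. c *\<^sub>R _"] cong: if_cong)
  have T_coeff: "mass_inner m (T Q i) (u j) = Q $ i $ j" for Q i j
  proof -
    have lin: "linear (\<lambda>x. mass_inner m x (u j))" using bilinear_mass_inner by (simp add: bilinear_def)
    show ?thesis by (simp add: T_def linear_sum[OF lin] linear_cmul[OF lin] uu)
  qed
  define f :: "(real ^ 4 ^ 4) \<times> (real ^ 3 ^ 3) \<Rightarrow> real ^ 3 ^ 3" where
    "f p = (\<chi> i j. if i \<le> j then mass_inner m (T (snd p) i) (T (snd p) j)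
       else dist_form (\<lambda>k l. fst p $ k $ l) (T (snd p) i) (T (snd p) j))" for p
  have smT: "smooth_on UNIV (\<lambda>p::(real ^ 4 ^ 4) \<times> (real ^ 3 ^ 3). T (snd p) i)" for i
    by (rule smooth_on_linear_image[OF open_UNIV T_lin]) (intro smooth_on_linear open_UNIV linear_snd)
  have smX: "smooth_on UNIV (\<lambda>p::(real ^ 4 ^ 4) \<times> (real ^ 3 ^ 3). fst p $ k $ l)" for k l
    by (intro smooth_on_vec_nth smooth_on_linear open_UNIV linear_fst)
  have smf: "smooth_on UNIV f"
  proof (intro smooth_on_vec open_UNIV)
    fix i j
    show "smooth_on UNIV (\<lambda>p. f p $ i $ j)"
      by (cases "i \<le> j") (simp_all add: f_def smooth_on_bilinear[OF open_UNIV bilinear_mass_inner smT smT]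
          smooth_on_dist_form[OF open_UNIV smX smT smT])
  qed
  define F where "F = frechet_derivative f (at (regular_shape, I))"
  have derF: "(f has_derivative F) (at (regular_shape, I))"
    unfolding F_def by (rule smooth_on_has_derivative[OF smf]) simp
  have inj: "c = 0" if F0: "F (0, c) = 0" for c
  proof -
    have "((\<lambda>t::real. f ((regular_shape, I) + t *\<^sub>R (0, c))) has_vector_derivative 0) (at 0)"
      using has_derivative_along_line[OF derF, of "(0, c)"] F0 by simp
    then have "((\<lambda>t::real. f ((regular_shape, I) + t *\<^sub>R (0, c)) $ i $ j) has_vector_derivative (0 $ i $ j)) (at 0)" for i j
      by (intro bounded_linear.has_vector_derivative[OF bounded_linear_vec_nth])
    then have comp: "((\<lambda>t. f (regular_shape, I + t *\<^sub>R c) $ i $ j) has_real_derivative 0) (at 0)" for i j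
      by (simp add: has_real_derivative_iff_has_vector_derivative)
    have TI: "T (I + t *\<^sub>R c) i = u i + t *\<^sub>R T c i" for t i
      by (simp add: linear_add[OF T_lin] linear_cmul[OF T_lin] T_I)
    have le: "c $ i $ j + c $ j $ i = 0" if "i \<le> j" for i j
    proof -
      have eq: "f (regular_shape, I + t *\<^sub>R c) $ i $ j =
          mass_inner m (u i + t *\<^sub>R T c i) (u j + t *\<^sub>R T c j)" for t
        using that by (simp add: f_def TI)
      have "((\<lambda>t. mass_inner m (u i + t *\<^sub>R T c i) (u j + t *\<^sub>R T c j)) has_real_derivative 0) (at 0)"
        using comp[of i j] by (simp only: eq)
      from DERIV_unique[OF this bilinear_along_line[OF bilinear_mass_inner]]
      show ?thesis by (simp add: T_coeff mass_inner_commute[of m "u i" "T c j"])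
    qed
    have coeff: "inner (T c i) (u j) = c $ i $ j * inner (u j) (u j)" for i j
    proof -
      have "inner (T c i) (u j) = (\<Sum>k\<in>UNIV. if k = j then c $ i $ j * inner (u j) (u j) else 0)"
        unfolding T_def inner_sum_left by (intro sum.cong refl) (use orth in auto)
      then show ?thesis by simp
    qed
    have lt: "c $ i $ j * inner (u j) (u j) + c $ j $ i * inner (u i) (u i) = 0" if "j < i" for i j
    proof -
      have eq: "f (regular_shape, I + t *\<^sub>R c) $ i $ j =
          dist_form (\<lambda>k l. regular_shape $ k $ l) (u i + t *\<^sub>R T c i) (u j + t *\<^sub>R T c j)" for t
        using that by (simp add: f_def TI flip: not_less)
      have "((\<lambda>t. dist_form (\<lambda>k l. regular_shape $ k $ l) (u i + t *\<^sub>R T c i) (u j + t *\<^sub>R T c j)) has_real_derivative 0) (at 0)"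
        using comp[of i j] by (simp only: eq)
      from DERIV_unique[OF this bilinear_along_line[OF bilinear_dist_form]]
      show ?thesis
        using coeff[of i j] coeff[of j i]
        by (simp add: dist_form_regular_shape uD T_D inner_commute[of "u i" "T c j"])
    qed
    have zero: "c $ i $ j = 0 \<and> c $ j $ i = 0" if "j < i" for i j
    proof -
      have s: "c $ j $ i = - c $ i $ j" using le[OF less_imp_le[OF that]] by linarith
      then have "c $ i $ j * (inner (u j) (u j) - inner (u i) (u i)) = 0"
        using lt[OF that] by (simp add: algebra_simps)
      then show ?thesis using s simple[of j i] that by auto
    qed
    have "c $ i $ j = 0" for i j
    proof (cases i j rule: linorder_cases)
      case equal
      then show ?thesis using le[of i i] by simp
    qed (use zero in auto)
    then show "c = 0" by (simp add: vec_eq_iff)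
  qed
  obtain W q where W: "open W" "regular_shape \<in> W" and q: "smooth_on W q" "q regular_shape = I"
    "\<And>X. X \<in> W \<Longrightarrow> f (X, q X) = f (regular_shape, I)"
    using smooth_implicit_function[OF open_UNIV UNIV_I smf derF inj, where thesis=thesis] by blast
  have f0: "f (regular_shape, I) $ i $ j = of_bool (i = j)" for i j
    using orth[of i j] by (auto simp: f_def T_I uu dist_form_regular_shape[OF uD uD])
  show ?thesis
  proof (rule that[of W "\<lambda>X. T (q X)"])
    show "smooth_on W (\<lambda>X. T (q X) i)" for i
      by (rule smooth_on_linear_image[OF W(1) T_lin q(1)])
    show "T (q regular_shape) = u" by (simp add: q T_I)
    fix X assume X: "X \<in> W"
    have fX: "f (X, q X) $ i $ j = of_bool (i = j)" for i j using q(3)[OF X] f0 by simp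
    have le: "mass_inner m (T (q X) i) (T (q X) j) = of_bool (i = j)" if "i \<le> j" for i j
      using fX[of i j] that by (simp add: f_def)
    have "mass_inner m (T (q X) i) (T (q X) j) = of_bool (i = j)" for i j
    proof (cases "i \<le> j")
      case False
      then have "mass_inner m (T (q X) j) (T (q X) i) = of_bool (j = i)" by (intro le) simp
      then show ?thesis by (simp add: mass_inner_commute[of m "T (q X) i"] eq_commute)
    qed (rule le)
    then show "mass_frame m (T (q X))" by (simp add: mass_frame_def T_D)
    show "dist_form (\<lambda>k l. X $ k $ l) (T (q X) i) (T (q X) j) = 0" if "j < i" for i j
      using fX[of i j] that by (simp add: f_def flip: not_less)
  qed (use W in auto)
qed

section \<open>The Wintner--Conley endomorphism in the adapted frame\<close>

text \<open>The coefficients of the Wintner--Conley endomorphism relative to their common value at the regular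
  tetrahedron. The irrelevant diagonal coefficients are set to zero, which keeps the functions smooth.\<close>

definition reduced_force :: "real \<Rightarrow> real ^ 4 ^ 4 \<Rightarrow> 4 \<Rightarrow> 4 \<Rightarrow> real" where
  "reduced_force G X k l = (if k = l then 0 else force G (X $ k $ l) - force G (1 / 12))"

text \<open>The entries, in the frame \<open>V X\<close>, of the Wintner--Conley endomorphism for the squared distances \<open>X\<close>
  minus its scalar value at the regular tetrahedron.\<close>

definition reduced_entry ::
  "real \<Rightarrow> real ^ 4 \<Rightarrow> (real ^ 4 ^ 4 \<Rightarrow> 3 \<Rightarrow> real ^ 4) \<Rightarrow> real ^ 4 ^ 4 \<Rightarrow> 3 \<Rightarrow> 3 \<Rightarrow> real" where
  "reduced_entry G m V X i j = interaction_form m (reduced_force G X) (V X i) (V X j)"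

lemma reduced_force_regular_shape: "reduced_force G regular_shape k l = 0"
  by (simp add: reduced_force_def regular_shape_def)

lemma reduced_entry_regular_shape: "reduced_entry G m V regular_shape i j = 0"
  by (simp add: reduced_entry_def interaction_form_def reduced_force_regular_shape)

lemma reduced_entry_commute: "reduced_entry G m V X i j = reduced_entry G m V X j i"
  unfolding reduced_entry_def by (rule interaction_form_commute)

lemma interaction_form_eq_reduced_entry:
  assumes m: "\<And>i. m $ i > 0" and v: "mass_frame m (V X)"
  shows "interaction_form m (\<lambda>k l. force G (X $ k $ l)) (V X i) (V X j) =
    reduced_entry G m V X i j + force G (1 / 12) * (\<Sum>k\<in>UNIV. m $ k) * of_bool (i = j)"
proof -
  have "V X i \<in> dispositions" "mass_inner m (V X i) (V X j) = of_bool (i = j)" for i j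
    using v by (auto simp: mass_frame_def)
  moreover have "reduced_entry G m V X i j =
      interaction_form m (\<lambda>k l. force G (X $ k $ l) - force G (1 / 12)) (V X i) (V X j)"
    unfolding reduced_entry_def by (rule interaction_form_cong) (simp add: reduced_force_def)
  ultimately show ?thesis
    by (simp add: interaction_form_diff interaction_form_const[OF m])
qed

lemma smooth_on_entry:
  assumes "open S"
  shows "smooth_on S (\<lambda>X::real ^ 4 ^ 4. X $ k $ l)"
  by (intro smooth_on_vec_nth assms smooth_on_linear linear_ident)

lemma smooth_on_reduced_entry:
  assumes S: "open S" and pos: "\<And>X k l. X \<in> S \<Longrightarrow> k \<noteq> l \<Longrightarrow> X $ k $ l > 0"
    and V: "\<And>i. smooth_on S (\<lambda>X. V X i)"
  shows "smooth_on S (\<lambda>X. reduced_entry G m V X i j)"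
proof -
  have "smooth_on S (\<lambda>X. reduced_force G X k l)" for k l
  proof (cases "k = l")
    case True
    then show ?thesis by (simp add: reduced_force_def smooth_on_const S)
  next
    case False
    have "smooth_on S (\<lambda>X. force G (X $ k $ l))"
      by (rule smooth_on_compose[OF S _ _ smooth_on_entry[OF S] smooth_on_force]) (use False pos in auto)
    then have "smooth_on S (\<lambda>X. force G (X $ k $ l) - force G (1 / 12))"
      by (intro smooth_on_diff smooth_on_const S)
    then show ?thesis using False by (simp add: reduced_force_def)
  qed
  then show ?thesis
    unfolding reduced_entry_def by (intro smooth_on_interaction_form S V)
qed

text \<open>The reduced coefficients vanish at the regular tetrahedron, so that the derivative of the frame
  does not enter.\<close>

lemma reduced_entry_derivative:
  assumes S: "open S" "regular_shape \<in> S" and V: "\<And>i. smooth_on S (\<lambda>X. V X i)"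
  shows "((\<lambda>t. reduced_entry G m V (regular_shape + t *\<^sub>R h) i j) has_real_derivative
    deriv (force G) (1 / 12) * interaction_form m (\<lambda>k l. h $ k $ l) (V regular_shape i) (V regular_shape j)) (at 0)"
proof -
  define \<phi>1 where "\<phi>1 = deriv (force G) (1 / 12)"
  define c where "c X k l = m $ k * m $ l * ((V X i $ k / m $ k - V X i $ l / m $ l) *
      (V X j $ k / m $ k - V X j $ l / m $ l))" for X k l
  have smc: "smooth_on S (\<lambda>X. c X k l)" for k l
    unfolding c_def
    by (intro smooth_on_mult smooth_on_diff smooth_on_divide smooth_on_vec_nth smooth_on_const S V)
  have summand: "((\<lambda>t. reduced_force G (regular_shape + t *\<^sub>R h) k l * c (regular_shape + t *\<^sub>R h) k l)
      has_real_derivative \<phi>1 * (h $ k $ l * c regular_shape k l)) (at 0)" for k l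
  proof (cases "k = l")
    case True
    then show ?thesis by (simp add: c_def)
  next
    case False
    obtain c' where c': "((\<lambda>t. c (regular_shape + t *\<^sub>R h) k l) has_real_derivative c') (at 0)"
      using has_derivative_along_line[OF smooth_on_has_derivative[OF smc[of k l] S(2)], of h]
      by (auto simp: has_real_derivative_iff_has_vector_derivative)
    have lin: "((\<lambda>t. 1 / 12 + t * h $ k $ l) has_real_derivative h $ k $ l) (at 0)"
      by (auto intro!: derivative_eq_intros)
    have "(force G has_real_derivative \<phi>1) (at (1 / 12))"
      using force_has_derivative[of "1 / 12" G] by (simp add: \<phi>1_def DERIV_imp_deriv)
    then have "(force G has_real_derivative \<phi>1) (at (1 / 12 + 0 * h $ k $ l))"
      by simp
    from DERIV_chain2[OF this lin]
    have "((\<lambda>t. force G (1 / 12 + t * h $ k $ l) - force G (1 / 12)) has_real_derivative \<phi>1 * h $ k $ l) (at 0)"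
      by (auto intro!: derivative_eq_intros)
    then have "((\<lambda>t. reduced_force G (regular_shape + t *\<^sub>R h) k l) has_real_derivative \<phi>1 * h $ k $ l) (at 0)"
      using False by (simp add: reduced_force_def regular_shape_def)
    from DERIV_mult[OF this c'] show ?thesis by (simp add: reduced_force_regular_shape mult_ac)
  qed
  have "((\<lambda>t. (\<Sum>k\<in>UNIV. \<Sum>l\<in>UNIV. reduced_force G (regular_shape + t *\<^sub>R h) k l * c (regular_shape + t *\<^sub>R h) k l) / 2)
      has_real_derivative (\<Sum>k\<in>UNIV. \<Sum>l\<in>UNIV. \<phi>1 * (h $ k $ l * c regular_shape k l)) / 2) (at 0)"
    by (intro DERIV_cdivide DERIV_sum summand)
  then show ?thesis
    by (simp add: reduced_entry_def interaction_form_def c_def sum_distrib_left \<phi>1_def)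
qed

text \<open>A Wintner--Conley endomorphism that is a multiple of the identity has equal coefficients. At
  the infinitesimal level this is what makes the shape chart invertible.\<close>

lemma interaction_form_scalar_imp_constant:
  assumes m: "\<And>i. m $ i > 0" and u: "mass_frame m u" and sym: "\<And>k l. w k l = w l k"
    and scalar: "\<And>i j. interaction_form m w (u i) (u j) = \<nu> * of_bool (i = j)" and kl: "k \<noteq> l"
  shows "w k l = \<nu> / (\<Sum>i\<in>UNIV. m $ i)"
proof -
  define M where "M = (\<Sum>i\<in>UNIV. m $ i)"
  have M: "M > 0" unfolding M_def by (rule sum_pos) (auto simp: m)
  have uD: "u i \<in> dispositions" and uu: "mass_inner m (u i) (u j) = of_bool (i = j)" for i j
    using u by (auto simp: mass_frame_def)
  have "w k l - \<nu> / M = 0"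
  proof (rule interaction_form_zero_imp[OF m _ _ kl, where w="\<lambda>k l. w k l - \<nu> / M"])
    show "w i j - \<nu> / M = w j i - \<nu> / M" for i j using sym[of i j] by simp
    fix \<xi> \<eta> :: "real ^ 4" assume "\<xi> \<in> dispositions" "\<eta> \<in> dispositions"
    then show "interaction_form m (\<lambda>k l. w k l - \<nu> / M) \<xi> \<eta> = 0"
    proof (rule bilinear_eq_zero_on_frame[OF m u bilinear_interaction_form])
      show "interaction_form m (\<lambda>k l. w k l - \<nu> / M) (u i) (u j) = 0" for i j
        using M by (simp add: interaction_form_diff interaction_form_const[OF m uD uD] uu scalar M_def[symmetric])
    qed
  qed
  then show ?thesis by (simp add: M_def)
qed

text \<open>The hypotheses of \<open>mem_shapes_iff\<close> are open conditions which hold at the regular tetrahedron. The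
  constant \<open>\<phi>0 * M < 0\<close> is the threefold eigenvalue of \<open>A\<close> there.\<close>

lemma adapted_frame_near_regular_shape:
  fixes G :: real and m :: "real ^ 4"
  assumes G: "G > 0" and m: "\<And>i. m $ i > 0"
    and no3: "\<not> (\<exists>i j k. i \<noteq> j \<and> j \<noteq> k \<and> i \<noteq> k \<and> m $ i = m $ j \<and> m $ j = m $ k)"
  obtains S V where "open S" "regular_shape \<in> S" "\<And>X k l. X \<in> S \<Longrightarrow> k \<noteq> l \<Longrightarrow> X $ k $ l > 0"
    "\<And>i. smooth_on S (\<lambda>X. V X i)" "mass_frame m (V regular_shape)"
    "\<And>X. X \<in> S \<Longrightarrow> X \<in> balanced_shapes G m \<longleftrightarrow>
      normalised_shape X \<and> (\<forall>i j. i \<noteq> j \<longrightarrow> reduced_entry G m V X i j = 0)"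
    "\<And>X. X \<in> S \<Longrightarrow> X \<in> relative_equilibrium_shapes_R4 G m \<longleftrightarrow>
      normalised_shape X \<and> (\<forall>i j. i \<noteq> j \<longrightarrow> reduced_entry G m V X i j = 0) \<and>
      (\<exists>i j. i \<noteq> j \<and> reduced_entry G m V X i i = reduced_entry G m V X j j)"
proof -
  define M where "M = (\<Sum>i\<in>UNIV. m $ i)"
  have M: "M > 0" unfolding M_def by (rule sum_pos) (auto simp: m)
  define \<phi>0 where "\<phi>0 = force G (1 / 12)"
  have \<phi>0: "\<phi>0 < 0" using G by (simp add: \<phi>0_def force_def)
  obtain u where u: "mass_frame m u" "\<And>i j. i \<noteq> j \<Longrightarrow> inner (u i) (u j) = 0"
    "\<And>i j. i \<noteq> j \<Longrightarrow> inner (u i) (u i) \<noteq> inner (u j) (u j)"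
    using mass_frame_distinct_euclidean_norms[OF m no3] by blast
  have uD: "u i \<in> dispositions" and uu: "mass_inner m (u i) (u j) = of_bool (i = j)" for i j
    using u(1) by (auto simp: mass_frame_def)
  obtain W V where W: "open W" "regular_shape \<in> W" and smV: "\<And>i. smooth_on W (\<lambda>X. V X i)"
    and V0: "V regular_shape = u" and VF: "\<And>X. X \<in> W \<Longrightarrow> mass_frame m (V X)"
    and Vorth: "\<And>X i j. X \<in> W \<Longrightarrow> j < i \<Longrightarrow> dist_form (\<lambda>k l. X $ k $ l) (V X i) (V X j) = 0"
    using smooth_frame_near_regular_shape[OF m u] by blast
  define W1 where "W1 = W \<inter> {X. \<forall>k l. k \<noteq> l \<longrightarrow> X $ k $ l > 0}"
  have "open {X :: real ^ 4 ^ 4. \<forall>k l. k \<noteq> l \<longrightarrow> X $ k $ l > 0}"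
  proof -
    have "{X :: real ^ 4 ^ 4. \<forall>k l. k \<noteq> l \<longrightarrow> X $ k $ l > 0} =
        (\<Inter>k. \<Inter>l. {X. k \<noteq> l \<longrightarrow> X $ k $ l > 0})" by auto
    moreover have "open {X :: real ^ 4 ^ 4. k \<noteq> l \<longrightarrow> X $ k $ l > 0}" for k l
      by (cases "k = l") (simp_all, intro open_Collect_less continuous_intros)
    ultimately show ?thesis by (simp add: open_INT)
  qed
  then have W1: "open W1" "regular_shape \<in> W1" "W1 \<subseteq> W"
    using W by (auto simp: W1_def regular_shape_def)
  then have W1_pos: "X $ k $ l > 0" if "X \<in> W1" "k \<noteq> l" for X k l
    using that by (auto simp: W1_def)
  define a where "a = reduced_entry G m V"
  have smV1: "smooth_on W1 (\<lambda>X. V X i)" for i using smV W1(3) smooth_on_subset by blast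
  have sma: "smooth_on W1 (\<lambda>X. a X i j)" for i j
    unfolding a_def by (rule smooth_on_reduced_entry[OF W1(1) W1_pos smV1])
  have a0: "a regular_shape i j = 0" for i j
    by (simp add: a_def reduced_entry_regular_shape)
  define \<kappa> where "\<kappa> X i = dist_form (\<lambda>k l. X $ k $ l) (V X i) (V X i)" for X i
  have sm\<kappa>: "smooth_on W1 (\<lambda>X. \<kappa> X i)" for i
    unfolding \<kappa>_def by (rule smooth_on_dist_form[OF W1(1) smooth_on_entry[OF W1(1)] smV1 smV1])
  have \<kappa>0: "\<kappa> regular_shape i = inner (u i) (u i) / 24" for i
    by (simp add: \<kappa>_def V0 dist_form_regular_shape uD)
  have lim: "((\<lambda>X. f X) \<longlongrightarrow> f regular_shape) (nhds regular_shape)" if "smooth_on W1 f" for f :: "real ^ 4 ^ 4 \<Rightarrow> real"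
    using smooth_on_isCont[OF that W1(2)] by (simp add: isCont_def tendsto_at_iff_tendsto_nhds)
  define P where "P X \<longleftrightarrow> X \<in> W1 \<and> (\<forall>i. \<kappa> X i > 0) \<and>
      (\<forall>i j. i \<noteq> j \<longrightarrow> \<kappa> X i \<noteq> \<kappa> X j) \<and> (\<forall>i. a X i i < - (\<phi>0 * M))" for X
  have "eventually (\<lambda>X. X \<in> W1) (nhds regular_shape)"
    by (rule eventually_nhds_in_open[OF W1(1,2)])
  moreover have "eventually (\<lambda>X. \<forall>i. \<kappa> X i > 0) (nhds regular_shape)"
  proof (intro eventually_all_finite order_tendstoD(1)[OF lim[OF sm\<kappa>]])
    fix i
    have "u i \<noteq> 0" using uu[of i i] by (auto simp: mass_inner_def)
    then show "0 < \<kappa> regular_shape i" by (simp add: \<kappa>0)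
  qed
  moreover have "eventually (\<lambda>X. \<forall>i j. i \<noteq> j \<longrightarrow> \<kappa> X i \<noteq> \<kappa> X j) (nhds regular_shape)"
  proof (intro eventually_all_finite)
    fix i j
    show "eventually (\<lambda>X. i \<noteq> j \<longrightarrow> \<kappa> X i \<noteq> \<kappa> X j) (nhds regular_shape)"
    proof (cases "i = j")
      case False
      have "((\<lambda>X. \<kappa> X i - \<kappa> X j) \<longlongrightarrow> \<kappa> regular_shape i - \<kappa> regular_shape j) (nhds regular_shape)"
        by (intro tendsto_diff lim sm\<kappa>)
      moreover have "\<kappa> regular_shape i - \<kappa> regular_shape j \<noteq> 0" using u(3)[OF False] by (simp add: \<kappa>0)
      ultimately have "eventually (\<lambda>X. \<kappa> X i - \<kappa> X j \<noteq> 0) (nhds regular_shape)"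
        by (rule tendsto_imp_eventually_ne)
      then show ?thesis by eventually_elim auto
    qed simp
  qed
  moreover have "eventually (\<lambda>X. \<forall>i. a X i i < - (\<phi>0 * M)) (nhds regular_shape)"
    by (intro eventually_all_finite order_tendstoD(2)[OF lim[OF sma]])
      (simp add: a0 mult_neg_pos \<phi>0 M)
  ultimately have "eventually P (nhds regular_shape)"
    unfolding P_def by eventually_elim simp
  then obtain S where S: "open S" "regular_shape \<in> S" and SP: "\<forall>X\<in>S. P X"
    unfolding eventually_nhds by blast
  have good: "X \<in> W1 \<and> (\<forall>i. \<kappa> X i > 0) \<and> (\<forall>i j. i \<noteq> j \<longrightarrow> \<kappa> X i \<noteq> \<kappa> X j) \<and>
      (\<forall>i. a X i i < - (\<phi>0 * M))"
    if "X \<in> S" for X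
    using bspec[OF SP that] unfolding P_def .
  have mem: "(X \<in> balanced_shapes G m \<longleftrightarrow> normalised_shape X \<and> (\<forall>i j. i \<noteq> j \<longrightarrow> a X i j = 0)) \<and>
     (X \<in> relative_equilibrium_shapes_R4 G m \<longleftrightarrow>
        normalised_shape X \<and> (\<forall>i j. i \<noteq> j \<longrightarrow> a X i j = 0) \<and> (\<exists>i j. i \<noteq> j \<and> a X i i = a X j j))"
    if X: "X \<in> S" for X
  proof -
    note g = good[OF X]
    have XW: "X \<in> W" using g W1(3) by blast
    define b where "b i j = interaction_form m (\<lambda>k l. force G (X $ k $ l)) (V X i) (V X j)" for i j
    have ab: "b i j = a X i j + \<phi>0 * M * of_bool (i = j)" for i j
      unfolding b_def a_def \<phi>0_def M_def by (rule interaction_form_eq_reduced_entry[where V=V and X=X, OF m VF[OF XW]])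
    have "b i i < 0" for i
    proof -
      have "a X i i < - (\<phi>0 * M)" using g by blast
      then show ?thesis using ab[of i i] by simp
    qed
    from mem_shapes_iff[OF m VF[OF XW] _ Vorth[OF XW] _ _ b_def this]
    have 1: "X \<in> balanced_shapes G m \<longleftrightarrow> normalised_shape X \<and> (\<forall>i j. i \<noteq> j \<longrightarrow> b i j = 0)"
      "X \<in> relative_equilibrium_shapes_R4 G m \<longleftrightarrow>
        normalised_shape X \<and> (\<forall>i j. i \<noteq> j \<longrightarrow> b i j = 0) \<and> (\<exists>i j. i \<noteq> j \<and> b i i = b j j)"
      using g W1_pos by (auto simp: \<kappa>_def)
    show ?thesis unfolding 1 by (simp add: ab)
  qed
  have SW1: "S \<subseteq> W1" using good by blast
  show ?thesis
  proof (rule that[of S V])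
    show "open S" "regular_shape \<in> S" by (rule S)+
    show "X $ k $ l > 0" if "X \<in> S" "k \<noteq> l" for X k l using W1_pos SW1 that by blast
    show "smooth_on S (\<lambda>X. V X i)" for i using smV1 SW1 smooth_on_subset by blast
    show "mass_frame m (V regular_shape)" using u(1) V0 by simp
  qed (use mem in \<open>simp_all add: a_def\<close>)
qed

section \<open>A chart of the space of shapes at the regular tetrahedron\<close>

text \<open>Coordinates on the space of all matrices, with \<open>a\<close> standing for the entries of \<open>A\<close>. On and below
  the diagonal they measure the failure of zero diagonal and symmetry; the six positions above the
  diagonal hold the normalisation of the sum, the three off-diagonal entries of \<open>A\<close> and two differences
  of its diagonal entries.\<close>

definition shape_chart :: "(real ^ 4 ^ 4 \<Rightarrow> 3 \<Rightarrow> 3 \<Rightarrow> real) \<Rightarrow> real ^ 4 ^ 4 \<Rightarrow> real ^ 4 ^ 4" where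
  "shape_chart a X = (\<chi> i j.
     if i = j then X $ i $ i
     else if i = 1 \<and> j = 2 then (\<Sum>k\<in>UNIV. \<Sum>l\<in>UNIV. X $ k $ l) - 1
     else if i = 1 \<and> j = 3 then a X 1 2
     else if i = 1 \<and> j = 4 then a X 1 3
     else if i = 2 \<and> j = 3 then a X 2 3
     else if i = 2 \<and> j = 4 then a X 1 1 - a X 2 2
     else if i = 3 \<and> j = 4 then a X 2 2 - a X 3 3
     else X $ i $ j - X $ j $ i)"

text \<open>The two directions of the coordinate plane of balanced shapes: \<open>a X 1 1 - a X 2 2\<close> and
  \<open>a X 2 2 - a X 3 3\<close>.\<close>

abbreviation chart_axis1 :: "real ^ 4 ^ 4" where "chart_axis1 \<equiv> axis 2 (axis 4 1)"
abbreviation chart_axis2 :: "real ^ 4 ^ 4" where "chart_axis2 \<equiv> axis 3 (axis 4 1)"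

lemma mat4_eq_iff:
  fixes X Y :: "real ^ 4 ^ 4"
  shows "X = Y \<longleftrightarrow>
    (X $ 1 $ 1 = Y $ 1 $ 1 \<and> X $ 1 $ 2 = Y $ 1 $ 2 \<and> X $ 1 $ 3 = Y $ 1 $ 3 \<and> X $ 1 $ 4 = Y $ 1 $ 4) \<and>
    (X $ 2 $ 1 = Y $ 2 $ 1 \<and> X $ 2 $ 2 = Y $ 2 $ 2 \<and> X $ 2 $ 3 = Y $ 2 $ 3 \<and> X $ 2 $ 4 = Y $ 2 $ 4) \<and>
    (X $ 3 $ 1 = Y $ 3 $ 1 \<and> X $ 3 $ 2 = Y $ 3 $ 2 \<and> X $ 3 $ 3 = Y $ 3 $ 3 \<and> X $ 3 $ 4 = Y $ 3 $ 4) \<and>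
    (X $ 4 $ 1 = Y $ 4 $ 1 \<and> X $ 4 $ 2 = Y $ 4 $ 2 \<and> X $ 4 $ 3 = Y $ 4 $ 3 \<and> X $ 4 $ 4 = Y $ 4 $ 4)"
  by (simp add: vec_eq_iff forall_4)

lemma shape_chart_plane:
  "shape_chart a X = s *\<^sub>R chart_axis1 + t *\<^sub>R chart_axis2 \<longleftrightarrow>
     normalised_shape X \<and> a X 1 2 = 0 \<and> a X 1 3 = 0 \<and> a X 2 3 = 0 \<and>
     a X 1 1 - a X 2 2 = s \<and> a X 2 2 - a X 3 3 = t"
  by (auto simp: mat4_eq_iff shape_chart_def normalised_shape_def forall_4 axis_def)

lemma dim_chart_plane: "dim (span {chart_axis1, chart_axis2}) = 2"
proof -
  have "chart_axis1 \<in> Basis" "chart_axis2 \<in> Basis" by (simp_all add: axis_in_Basis_iff)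
  moreover have "chart_axis1 \<noteq> chart_axis2" by (simp add: mat4_eq_iff axis_def)
  ultimately show ?thesis
    by (simp add: dim_span dim_eq_card_independent independent_mono[OF independent_Basis])
qed

lemma smooth_on_shape_chart:
  assumes "open S" "\<And>i j. smooth_on S (\<lambda>X. a X i j)"
  shows "smooth_on S (shape_chart a)"
proof (intro smooth_on_vec assms(1))
  fix i j :: 4
  have X: "smooth_on S (\<lambda>X. X $ k $ l)" for k l :: 4
    by (intro smooth_on_vec_nth assms(1) smooth_on_linear linear_ident)
  note sm = assms(1) smooth_on_diff smooth_on_sum smooth_on_const X assms(2)
  show "smooth_on S (\<lambda>X. shape_chart a X $ i $ j)"
    unfolding shape_chart_def vec_lambda_beta
    by (cases "i = j"; cases "i = 1 \<and> j = 2"; cases "i = 1 \<and> j = 3"; cases "i = 1 \<and> j = 4";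
        cases "i = 2 \<and> j = 3"; cases "i = 2 \<and> j = 4"; cases "i = 3 \<and> j = 4")
      (simp_all only: if_True if_False, auto intro!: sm)
qed

text \<open>A direction \<open>h\<close> killed by the derivative is symmetric with zero diagonal and zero sum, and varies
  \<open>A\<close> by a multiple of the identity. So its off-diagonal entries are all equal, and twelve times their
  common value is zero.\<close>

lemma shape_chart_derivative_injective:
  assumes m: "\<And>i. m $ i > 0" and u: "mass_frame m u"
    and der: "(shape_chart a has_derivative DH) (at p)" and DH0: "DH h = 0" and \<phi>1: "\<phi>1 \<noteq> 0"
    and dera: "\<And>i j. ((\<lambda>t. a (p + t *\<^sub>R h) i j) has_real_derivative
      \<phi>1 * interaction_form m (\<lambda>k l. h $ k $ l) (u i) (u j)) (at 0)"
  shows "h = 0"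
proof -
  define q where "q i j = interaction_form m (\<lambda>k l. h $ k $ l) (u i) (u j)" for i j
  note dera = dera[folded q_def]
  define H where "H = shape_chart a"
  have "((\<lambda>t::real. H (p + t *\<^sub>R h)) has_vector_derivative 0) (at 0)"
    using has_derivative_along_line[OF der, of h] DH0 by (simp add: H_def)
  then have "((\<lambda>t::real. H (p + t *\<^sub>R h) $ i $ j) has_vector_derivative (0 $ i $ j)) (at 0)" for i j
    by (intro bounded_linear.has_vector_derivative[OF bounded_linear_vec_nth])
  then have comp: "((\<lambda>t. H (p + t *\<^sub>R h) $ i $ j) has_real_derivative 0) (at 0)" for i j
    by (simp add: has_real_derivative_iff_has_vector_derivative)
  have D: "d = 0" if "((\<lambda>t. H (p + t *\<^sub>R h) $ i $ j) has_real_derivative d) (at 0)" for d i j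
    using DERIV_unique[OF that comp] .
  have lin: "((\<lambda>t. (p + t *\<^sub>R h) $ i $ j) has_real_derivative h $ i $ j) (at 0)" for i j
    by (auto intro!: derivative_eq_intros)
  have diag: "h $ i $ i = 0" for i
    using lin[of i i] by (intro D[of i i]) (simp add: H_def shape_chart_def)
  have asym: "h $ i $ j = h $ j $ i" if "\<And>X. H X $ i $ j = X $ i $ j - X $ j $ i" for i j
  proof -
    have "h $ i $ j - h $ j $ i = 0"
      by (rule D[of i j]) (simp only: that DERIV_diff[OF lin[of i j] lin[of j i]])
    then show ?thesis by simp
  qed
  have "h $ 2 $ 1 = h $ 1 $ 2" "h $ 3 $ 1 = h $ 1 $ 3" "h $ 4 $ 1 = h $ 1 $ 4"
    "h $ 3 $ 2 = h $ 2 $ 3" "h $ 4 $ 2 = h $ 2 $ 4" "h $ 4 $ 3 = h $ 3 $ 4"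
    by (rule asym, simp add: H_def shape_chart_def)+
  then have sym: "h $ k $ l = h $ l $ k" for k l
    using exhaust_4[of k] exhaust_4[of l] by auto
  have "((\<lambda>t. (\<Sum>k\<in>UNIV. \<Sum>l\<in>UNIV. (p + t *\<^sub>R h) $ k $ l) - 1) has_real_derivative
      (\<Sum>k\<in>UNIV. \<Sum>l\<in>UNIV. h $ k $ l) - 0) (at 0)"
    by (intro DERIV_diff DERIV_sum lin DERIV_const)
  then have total: "(\<Sum>k\<in>UNIV. \<Sum>l\<in>UNIV. h $ k $ l) = 0"
    by (intro D[of 1 2]) (simp add: H_def shape_chart_def)
  have q_zero: "q i j = 0" if "\<And>X. H X $ k $ l = a X i j" for i j k l
  proof -
    have "\<phi>1 * q i j = 0" by (rule D[of k l]) (simp only: that dera)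
    then show ?thesis using \<phi>1 by simp
  qed
  have q_eq: "q i i = q j j" if "\<And>X. H X $ k $ l = a X i i - a X j j" for i j k l
  proof -
    have "\<phi>1 * q i i - \<phi>1 * q j j = 0"
      by (rule D[of k l]) (simp only: that DERIV_diff[OF dera[of i i] dera[of j j]])
    then show ?thesis using \<phi>1 by simp
  qed
  have "q 1 2 = 0" by (rule q_zero[of 1 3]) (simp add: H_def shape_chart_def)
  moreover have "q 1 3 = 0" by (rule q_zero[of 1 4]) (simp add: H_def shape_chart_def)
  moreover have "q 2 3 = 0" by (rule q_zero[of 2 3]) (simp add: H_def shape_chart_def)
  moreover have "q 1 1 = q 2 2" by (rule q_eq[of 2 4]) (simp add: H_def shape_chart_def)
  moreover have "q 2 2 = q 3 3" by (rule q_eq[of 3 4]) (simp add: H_def shape_chart_def)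
  ultimately have q0: "q 1 2 = 0" "q 1 3 = 0" "q 2 3 = 0" "q 2 2 = q 1 1" "q 3 3 = q 1 1"
    by simp_all
  have qsym: "q i j = q j i" for i j unfolding q_def by (rule interaction_form_commute)
  have q: "q i j = q 1 1 * of_bool (i = j)" for i j
    using exhaust_3[of i] exhaust_3[of j] q0 qsym[of 2 1] qsym[of 3 1] qsym[of 3 2] by auto
  define c where "c = q 1 1 / (\<Sum>i\<in>UNIV. m $ i)"
  have hc: "h $ k $ l = c" if "k \<noteq> l" for k l
    unfolding c_def
    by (rule interaction_form_scalar_imp_constant[OF m u sym _ that]) (unfold q_def[symmetric], rule q)
  have "12 * c = 0"
    using total hc[of 1 2] hc[of 1 3] hc[of 1 4] hc[of 2 1] hc[of 2 3] hc[of 2 4] hc[of 3 1]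
      hc[of 3 2] hc[of 3 4] hc[of 4 1] hc[of 4 2] hc[of 4 3] diag
    by (simp add: sum_4)
  then have "h $ k $ l = 0" for k l using hc[of k l] diag[of k] by (cases "k = l") auto
  then show "h = 0" by (simp add: vec_eq_iff)
qed

section \<open>The balanced manifold and its three curves\<close>

lemma exists_equal_pair_3:
  fixes f :: "3 \<Rightarrow> 'b"
  shows "(\<exists>i j. i \<noteq> j \<and> f i = f j) \<longleftrightarrow> f 1 = f 2 \<or> f 2 = f 3 \<or> f 1 = f 3"
proof
  assume "\<exists>i j. i \<noteq> j \<and> f i = f j"
  then obtain i j where "i \<noteq> j" "f i = f j" by blast
  then show "f 1 = f 2 \<or> f 2 = f 3 \<or> f 1 = f 3"
    using exhaust_3[of i] exhaust_3[of j] by auto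
next
  have "(1::3) \<noteq> 2" "(2::3) \<noteq> 3" "(1::3) \<noteq> 3" by simp_all
  moreover assume "f 1 = f 2 \<or> f 2 = f 3 \<or> f 1 = f 3"
  ultimately show "\<exists>i j. i \<noteq> j \<and> f i = f j" by blast
qed

theorem corollary11:
  fixes G :: real and m :: "real ^ 4" and r0 :: "(real ^ 3) ^ 4"
  assumes "G > 0"
    and "\<forall>i. m $ i > 0"
    and "\<not> (\<exists>i j k. i \<noteq> j \<and> j \<noteq> k \<and> i \<noteq> k \<and> m $ i = m $ j \<and> m $ j = m $ k)"
    and "regular_tetrahedron r0"
  shows "\<exists>U. open U \<and> shape r0 \<in> U \<and>
      smooth_submanifold 2 (balanced_shapes G m \<inter> U) \<and>
      (\<exists>C1 C2 C3.
         regular_curve_through (shape r0) C1 \<and>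
         regular_curve_through (shape r0) C2 \<and>
         regular_curve_through (shape r0) C3 \<and>
         C1 \<inter> C2 = {shape r0} \<and> C2 \<inter> C3 = {shape r0} \<and> C1 \<inter> C3 = {shape r0} \<and>
         relative_equilibrium_shapes_R4 G m \<inter> U = C1 \<union> C2 \<union> C3)"
proof -
  have m: "\<And>i. m $ i > 0" using assms(2) by blast
  obtain d where d: "d > 0" "\<And>i j. i \<noteq> j \<Longrightarrow> dist (r0 $ i) (r0 $ j) = d"
    using assms(4) unfolding regular_tetrahedron_def by blast
  have sq0: "sq_dist r0 i j = (if i = j then 0 else d\<^sup>2)" for i j
    by (simp add: sq_dist_def d)
  have "(\<Sum>k\<in>UNIV. \<Sum>l\<in>UNIV. sq_dist r0 k l) = 12 * d\<^sup>2"
    by (simp add: sq0 sum_4)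
  then have shape0: "shape r0 = regular_shape"
    using d(1) by (simp add: shape_def regular_shape_def vec_eq_iff sq0)
  obtain S V where S: "open S" "regular_shape \<in> S"
    and pos: "\<And>X k l. X \<in> S \<Longrightarrow> k \<noteq> l \<Longrightarrow> X $ k $ l > 0"
    and V: "\<And>i. smooth_on S (\<lambda>X. V X i)" "mass_frame m (V regular_shape)"
    and balanced: "\<And>X. X \<in> S \<Longrightarrow> X \<in> balanced_shapes G m \<longleftrightarrow>
      normalised_shape X \<and> (\<forall>i j. i \<noteq> j \<longrightarrow> reduced_entry G m V X i j = 0)"
    and equilibrium: "\<And>X. X \<in> S \<Longrightarrow> X \<in> relative_equilibrium_shapes_R4 G m \<longleftrightarrow>
      normalised_shape X \<and> (\<forall>i j. i \<noteq> j \<longrightarrow> reduced_entry G m V X i j = 0) \<and>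
      (\<exists>i j. i \<noteq> j \<and> reduced_entry G m V X i i = reduced_entry G m V X j j)"
    using adapted_frame_near_regular_shape[OF assms(1) m assms(3), where thesis=thesis] by blast
  define a where "a = reduced_entry G m V"
  define H where "H = shape_chart a"
  have smH: "smooth_on S H"
    unfolding H_def a_def by (intro smooth_on_shape_chart smooth_on_reduced_entry S pos V)
  have "normalised_shape regular_shape"
    by (simp add: normalised_shape_def regular_shape_def sum_4)
  then have H0: "H regular_shape = 0"
    using shape_chart_plane[of a regular_shape 0 0] by (simp add: H_def a_def reduced_entry_regular_shape)
  define DH where "DH = frechet_derivative H (at regular_shape)"
  have derH: "(H has_derivative DH) (at regular_shape)"
    unfolding DH_def by (rule smooth_on_has_derivative[OF smH S(2)])
  have slope: "deriv (force G) (1 / 12) \<noteq> 0"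
  proof -
    have "deriv (force G) (1 / 12) = - G / 2 * ((- 3 / 2) * (1 / 12) powr (- 3 / 2 - 1))"
      by (rule DERIV_imp_deriv[OF force_has_derivative]) simp
    moreover have "- G / 2 * ((- 3 / 2) * (1 / 12) powr (- 3 / 2 - 1 :: real)) \<noteq> 0"
      using assms(1) by simp
    ultimately show ?thesis by metis
  qed
  have inj: "h = 0" if "DH h = 0" for h
    by (rule shape_chart_derivative_injective[OF m V(2) derH[unfolded H_def] that slope])
      (unfold a_def, rule reduced_entry_derivative[OF S V(1)])
  obtain U e g where U: "open U" "regular_shape \<in> U" "U \<subseteq> S" "e > 0"
    and hom: "homeomorphism U (ball 0 e) H g" and smg: "smooth_on (ball 0 e) g"
    using smooth_inverse_function[OF S smH derH inj, where thesis=thesis] unfolding H0 by blast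
  have smHU: "smooth_on U H" using smH U(3) smooth_on_subset by blast
  have g0: "g 0 = regular_shape" using hom U(2) H0 by (metis homeomorphism_apply1)
  define L where "L = span {chart_axis1, chart_axis2}"
  have L: "Y \<in> L \<longleftrightarrow> (\<exists>s t. Y = s *\<^sub>R chart_axis1 + t *\<^sub>R chart_axis2)" for Y
    unfolding L_def by (auto simp: span_insert span_singleton algebra_simps)
  have off: "(\<forall>i j. i \<noteq> j \<longrightarrow> a X i j = 0) \<longleftrightarrow> a X 1 2 = 0 \<and> a X 1 3 = 0 \<and> a X 2 3 = 0" for X
    using reduced_entry_commute[of G m V X] unfolding a_def forall_3 by auto
  have HL: "H X \<in> L \<longleftrightarrow> normalised_shape X \<and> (\<forall>i j. i \<noteq> j \<longrightarrow> a X i j = 0)" for X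
    by (auto simp: L H_def shape_chart_plane off)
  define C where "C d = {X \<in> U. \<exists>t. H X = t *\<^sub>R d}" for d
  \<comment> \<open>Every direction in the plane gives a curve; the three used are those on which two eigenvalues agree.\<close>
  have curve: "regular_curve_through (shape r0) (C d)" if "d \<noteq> 0" for d
    using regular_curve_through_line[OF U(1,4) hom smHU smg that] by (simp add: C_def g0 shape0)
  have inter: "C d \<inter> C d' = {shape r0}" if "\<And>s t. s *\<^sub>R d = t *\<^sub>R d' \<Longrightarrow> s *\<^sub>R d = 0" for d d'
  proof (intro equalityI subsetI)
    fix X assume "X \<in> C d \<inter> C d'"
    then obtain s t where X: "X \<in> U" "H X = s *\<^sub>R d" "H X = t *\<^sub>R d'" by (auto simp: C_def)
    then have "H X = 0" using that[of s t] by simp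
    then have "X = g 0" using hom X(1) by (metis homeomorphism_apply1)
    then show "X \<in> {shape r0}" by (simp add: g0 shape0)
  next
    fix X assume "X \<in> {shape r0}"
    moreover have "\<exists>t. 0 = t *\<^sub>R d" for d :: "real ^ 4 ^ 4" by (rule exI[of _ 0]) simp
    ultimately show "X \<in> C d \<inter> C d'" using U(2) by (simp add: C_def shape0 H0)
  qed
  \<comment> \<open>The second difference is minus the first along \<open>chart_axis1 - chart_axis2\<close>, that is, \<open>\<alpha>\<^sub>1 = \<alpha>\<^sub>3\<close>.\<close>
  have union: "relative_equilibrium_shapes_R4 G m \<inter> U =
      C chart_axis2 \<union> C chart_axis1 \<union> C (chart_axis1 - chart_axis2)"
  proof -
    have two: "(\<exists>i j. i \<noteq> j \<and> a X i i = a X j j) \<longleftrightarrow>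
        a X 1 1 = a X 2 2 \<or> a X 2 2 = a X 3 3 \<or> a X 1 1 = a X 3 3" for X
      by (rule exists_equal_pair_3)
    have "(\<exists>t. H X = t *\<^sub>R chart_axis2) \<longleftrightarrow> H X \<in> L \<and> a X 1 1 = a X 2 2"
      "(\<exists>t. H X = t *\<^sub>R chart_axis1) \<longleftrightarrow> H X \<in> L \<and> a X 2 2 = a X 3 3"
      "(\<exists>t. H X = t *\<^sub>R (chart_axis1 - chart_axis2)) \<longleftrightarrow> H X \<in> L \<and> a X 1 1 = a X 3 3" for X
    proof -
      note plane = shape_chart_plane[of a X, folded H_def]
      have "H X = t *\<^sub>R chart_axis2 \<longleftrightarrow> H X = 0 *\<^sub>R chart_axis1 + t *\<^sub>R chart_axis2"
        "H X = t *\<^sub>R chart_axis1 \<longleftrightarrow> H X = t *\<^sub>R chart_axis1 + 0 *\<^sub>R chart_axis2"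
        "H X = t *\<^sub>R (chart_axis1 - chart_axis2) \<longleftrightarrow> H X = t *\<^sub>R chart_axis1 + (- t) *\<^sub>R chart_axis2" for t
        by (simp_all add: algebra_simps)
      note line = this[unfolded plane]
      show "(\<exists>t. H X = t *\<^sub>R chart_axis2) \<longleftrightarrow> H X \<in> L \<and> a X 1 1 = a X 2 2"
        unfolding line HL off by auto
      show "(\<exists>t. H X = t *\<^sub>R chart_axis1) \<longleftrightarrow> H X \<in> L \<and> a X 2 2 = a X 3 3"
        unfolding line HL off by auto
      show "(\<exists>t. H X = t *\<^sub>R (chart_axis1 - chart_axis2)) \<longleftrightarrow> H X \<in> L \<and> a X 1 1 = a X 3 3"
        unfolding line HL off by auto
    qed
    then show ?thesis
      using equilibrium[folded a_def, OF subsetD[OF U(3)]] by (auto simp: C_def HL two)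
  qed
  show ?thesis
  proof (rule exI[of _ U], intro conjI)
    show "open U" "shape r0 \<in> U" using U by (simp_all add: shape0)
    show "smooth_submanifold 2 (balanced_shapes G m \<inter> U)"
    proof (rule smooth_submanifold_from_chart[OF U(1) open_ball hom smHU smg])
      show "subspace L" "dim L = 2" unfolding L_def using dim_chart_plane by simp_all
      show "X \<in> balanced_shapes G m \<longleftrightarrow> H X \<in> L" if "X \<in> U" for X
        using balanced[folded a_def, OF subsetD[OF U(3) that]] by (simp only: HL)
    qed
    show "\<exists>C1 C2 C3.
         regular_curve_through (shape r0) C1 \<and>
         regular_curve_through (shape r0) C2 \<and>
         regular_curve_through (shape r0) C3 \<and>
         C1 \<inter> C2 = {shape r0} \<and> C2 \<inter> C3 = {shape r0} \<and> C1 \<inter> C3 = {shape r0} \<and>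
         relative_equilibrium_shapes_R4 G m \<inter> U = C1 \<union> C2 \<union> C3"
      by (rule exI[of _ "C chart_axis2"], rule exI[of _ "C chart_axis1"],
          rule exI[of _ "C (chart_axis1 - chart_axis2)"], intro conjI curve inter union)
        (auto simp: mat4_eq_iff axis_def)
  qed
qed

end
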